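(* Given an IP $(\mathbf{c},A,\mathbf{b})$ with $n$ variables and $m$ constraints, there is a set of at most $O\!\left(14^n(m+2n)^{3n^2}\tau^{5n^2}\right)$ polynomial hypersurfaces of degree at most $5$ partitioning $\mathbb{R}^{n+1}$ into connected components such that the branch-and-cut tree built after adding the cut $\boldsymbol{\alpha}^T\mathbf{x}\le\beta$ at the root is invariant over all $(\boldsymbol{\alpha},\beta)$ within a given component.
   Context: The IP $(\mathbf{c},A,\mathbf{b})$, $\mathbf{c}\in\mathbb{R}^n$, $A\in\mathbb{Z}^{m\times n}$, $\mathbf{b}\in\mathbb{Z}^m$, is $\max\{\mathbf{c}^T\mathbf{x}:A\mathbf{x}\le\mathbf{b},\mathbf{x}\ge\mathbf{0},\mathbf{x}\in\mathbb{Z}^n\}$; $\mathcal{P}$ is the feasible region of its LP relaxation, assumed to be a nonempty rational polytope, and the $m$ constraints are those defining $\mathcal{P}$ (nonnegativity constraints counted among them). $\tau=\lceil\max_{\mathbf{x}\in\mathcal{P}}\|\mathbf{x}\|_\infty\rceil$. The set of possible branching constraints is $\mathcal{BC}=\{\mathbf{x}[i]\le\ell,\ \mathbf{x}[i]\ge\ell\}_{0\le\ell\le\tau,\,i\in[n]}$. For a set of constraints $\sigma$, $\mathcal{P}(\sigma)$ is the intersection of $\mathcal{P}$ with the constraints in $\sigma$, and $\mathbf{x}^*_{\mathrm{LP}}(\cdot)$, $z^*_{\mathrm{LP}}(\cdot)$ denote the optimal solution and optimal value of the LP relaxation with the listed constraints added. Optimal solutions are treated as unique; where they are not, $\mathbf{x}^*_{\mathrm{LP}}(\boldsymbol{\alpha}^T\mathbf{x}\le\beta,\sigma)$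 is $\mathbf{x}^*_{\mathrm{LP}}(\sigma)$ if that point satisfies the cut, and otherwise ties among optimal vertices are broken by a fixed rule depending only on which edges of $\mathcal{P}(\sigma)$ contain an optimal vertex. Branch-and-cut (B&C): the cut is added at the root and remains in the LP of every node. A node is identified with the set $\sigma\subseteq\mathcal{BC}$ of branching constraints added on the path from the root; its LP optimum is $\mathbf{x}^*_{\mathrm{LP}}(\boldsymbol{\alpha}^T\mathbf{x}\le\beta,\sigma)$. Leaves are chosen by a fixed node selection policy. A node is fathomed if (i) its LP is infeasible, (ii) its LP optimum is integral, or (iii) its LP optimal value is no better than the best integral solution found so far. Otherwise a variable $x_i$ is chosen and two children are created by adding $x_i\le\lfloor\mathbf{x}^*_{\mathrm{LP}}(\boldsymbol{\alpha}^T\mathbf{x}\le\beta,\sigma)[i]\rfloor$ and $x_i\ge\lceil\mathbf{x}^*_{\mathrm{LP}}(\boldsymbol{\alpha}^T\mathbf{x}\le\beta,\sigma)[i]\rceil$, respectively. The variable is chosen by the product scoring rule: with $\mathbf{x}^*$, $z^*$ the LP optimum and value at the node, it maximizes over $i\in[n]$ the quantity $\max\{z^*-z^-_i,10^{-6}\}\cdot\max\{z^*-z^+_i,10^{-6}\}$, where $z_i^-$ and $z_i^+$ are the LP values after adding $x_i\le\lfloor\mathbf{x}^*[i]\rfloor$ and $x_i\ge\lceil\mathbf{x}^*[i]\rceil$, respectively (score ties broken by a fixed order). A cut is valid if it is satisfied by every point of $\mathcal{P}\cap\mathbb{Z}^n$; for invalid cuts the B&C tree is assumed to take one fixed special form denoting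 an invalid cut. A degree-$d$ polynomial hypersurface is the zero set of a polynomial of degree at most $d$. A finite set of hypersurfaces $\{p_j=0\}$ partitions $\mathbb{R}^k$ into connected components: the maximal connected subsets on which each $p_j$ is either identically zero or nowhere zero.
   Formalization: In the bound, τ is replaced by max(1, τ): when the LP region is {0}, τ = 0 and the stated bound would be zero hypersurfaces for n ≥ 1, which is false since valid and invalid cuts must still be separated; for τ ≥ 1 nothing changes. *)

theory Defs
  imports
    "HOL-Analysis.Analysis"
    "HOL-Library.Function_Algebras"
    "HOL-Library.Poly_Mapping"
begin

text \<open>
  The dimension varies inside the theorem, so a vector of $\mathbb{R}^k$ is a function
  \<^typ>\<open>nat \<Rightarrow> real\<close> vanishing at all indices \<open>\<ge> k\<close>, i.e. a point of
  \<^term>\<open>Euclidean_space k\<close>; coordinates are numbered from 0. The pointwise vector space structure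
  makes \<^const>\<open>closed_segment\<close>, \<^const>\<open>face_of\<close> and \<^const>\<open>extreme_point_of\<close> available.
\<close>

instantiation "fun" :: (type, real_vector) real_vector
begin

definition scaleR_fun :: "real \<Rightarrow> ('a \<Rightarrow> 'b) \<Rightarrow> 'a \<Rightarrow> 'b" where
  "scaleR_fun r f = (\<lambda>x. r *\<^sub>R f x)"

instance
  by standard (auto simp: scaleR_fun_def plus_fun_def fun_eq_iff algebra_simps)

end

type_synonym vector = "nat \<Rightarrow> real"

definition dot :: "nat \<Rightarrow> vector \<Rightarrow> vector \<Rightarrow> real" where
  "dot n u x = (\<Sum>i<n. u i * x i)"

text \<open>The \<open>insert 0\<close> only matters for dimension 0.\<close>

definition sup_norm :: "nat \<Rightarrow> vector \<Rightarrow> real" where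
  "sup_norm n x = Max (insert 0 ((\<lambda>i. \<bar>x i\<bar>) ` {..<n}))"


section \<open>Integer programs\<close>

record ip =
  nvars :: nat
  nconstrs :: nat
  objective :: vector
  lhs :: "nat \<Rightarrow> nat \<Rightarrow> int"
  rhs :: "nat \<Rightarrow> int"

definition lp_region :: "ip \<Rightarrow> vector set" where
  "lp_region I =
     {x \<in> topspace (Euclidean_space (nvars I)).
        (\<forall>r<nconstrs I. (\<Sum>i<nvars I. real_of_int (lhs I r i) * x i) \<le> real_of_int (rhs I r)) \<and>
        (\<forall>i<nvars I. 0 \<le> x i)}"

text \<open>
  The LP relaxation is a nonempty polytope; rationality is automatic as the data are integral.
  Boundedness is not expressed by \<^const>\<open>bounded\<close>, since every set is bounded for the metric
  that the library puts on \<^typ>\<open>nat \<Rightarrow> real\<close>.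
\<close>

definition ip_polytope :: "ip \<Rightarrow> bool" where
  "ip_polytope I \<longleftrightarrow> lp_region I \<noteq> {} \<and> bdd_above (sup_norm (nvars I) ` lp_region I)"

definition tau :: "ip \<Rightarrow> int" where
  "tau I = \<lceil>SUP x\<in>lp_region I. sup_norm (nvars I) x\<rceil>"

text \<open>\<open>Upper i l\<close> is the constraint $x_i \le l$ and \<open>Lower i l\<close> is $x_i \ge l$.\<close>

datatype branching = Upper nat int | Lower nat int

fun satisfies :: "vector \<Rightarrow> branching \<Rightarrow> bool" where
  "satisfies x (Upper i l) \<longleftrightarrow> x i \<le> real_of_int l"
| "satisfies x (Lower i l) \<longleftrightarrow> x i \<ge> real_of_int l"

definition branching_constraints :: "ip \<Rightarrow> branching set" where
  "branching_constraints I =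
     (\<Union>i\<in>{..<nvars I}. \<Union>l\<in>{0..tau I}. {Upper i l, Lower i l})"

definition node_region :: "ip \<Rightarrow> branching set \<Rightarrow> vector set" where
  "node_region I \<sigma> = {x \<in> lp_region I. \<forall>\<kappa>\<in>\<sigma>. satisfies x \<kappa>}"

text \<open>
  A cut $\alpha^T x \le \beta$ is a point \<open>y\<close> of $\mathbb{R}^{n+1}$ with $y_i = \alpha_i$ for
  $i < n$ and $y_n = \beta$.
\<close>

definition cut_holds :: "ip \<Rightarrow> vector \<Rightarrow> vector \<Rightarrow> bool" where
  "cut_holds I y x \<longleftrightarrow> dot (nvars I) y x \<le> y (nvars I)"

definition cut_region :: "ip \<Rightarrow> vector \<Rightarrow> branching set \<Rightarrow> vector set" where
  "cut_region I y \<sigma> = {x \<in> node_region I \<sigma>. cut_holds I y x}"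

definition integral_point :: "ip \<Rightarrow> vector \<Rightarrow> bool" where
  "integral_point I x \<longleftrightarrow> (\<forall>i<nvars I. x i \<in> \<int>)"

definition valid_cut :: "ip \<Rightarrow> vector \<Rightarrow> bool" where
  "valid_cut I y \<longleftrightarrow> (\<forall>x\<in>lp_region I. integral_point I x \<longrightarrow> cut_holds I y x)"

text \<open>The optimal value of an infeasible LP is \<open>-\<infinity>\<close>.\<close>

definition lp_value :: "ip \<Rightarrow> vector set \<Rightarrow> ereal" where
  "lp_value I S = (SUP x\<in>S. ereal (dot (nvars I) (objective I) x))"

definition optimal_vertices :: "ip \<Rightarrow> vector set \<Rightarrow> vector set" where
  "optimal_vertices I S =
     {x. x extreme_point_of S \<and>
         (\<forall>z\<in>S. dot (nvars I) (objective I) z \<le> dot (nvars I) (objective I) x)}"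

text \<open>The library's \<^const>\<open>edge_of\<close> is restricted to \<^class>\<open>euclidean_space\<close>.\<close>

definition edges :: "vector set \<Rightarrow> vector set set" where
  "edges S = {e. e face_of S \<and> (\<exists>u v. u \<noteq> v \<and> e = closed_segment u v)}"


section \<open>Branch-and-cut\<close>

text \<open>
  A node of the tree is the list of branching constraints on the path from the root, the most recent
  one last; its set of elements is the constraint set identifying the node.

  The rules fixed once and for all:
  \<^item> \<open>lp_vertex \<sigma>\<close> is the optimal solution of the LP at \<open>\<sigma>\<close> without the cut;
  \<^item> \<open>tie_edge \<sigma> E\<close> breaks ties where the cut removes \<open>lp_vertex \<sigma>\<close>: from the set \<open>E\<close> of edges of the
    region at \<open>\<sigma>\<close> that contain an optimal vertex it picks one edge, as an ordered pair of end points
    (the order decides between two optimal vertices lying on that same edge);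
  \<^item> \<open>var_rank\<close> breaks ties between scores, in favour of the smallest rank;
  \<^item> \<open>node_select T L Q\<close> picks the next leaf from the tree \<open>T\<close> built so far, its set \<open>L\<close> of unprocessed
    leaves, and the comparison \<open>Q\<close> of the LP values of these leaves (so that best-bound selection is
    covered, besides depth-first or breadth-first search).
\<close>

type_synonym node = "branching list"

record bc_rules =
  lp_vertex :: "branching set \<Rightarrow> vector"
  tie_edge :: "branching set \<Rightarrow> vector set set \<Rightarrow> vector \<times> vector"
  var_rank :: "nat \<Rightarrow> nat"
  node_select :: "node set \<Rightarrow> node set \<Rightarrow> (node \<times> node) set \<Rightarrow> node"

definition admissible_rules :: "ip \<Rightarrow> bc_rules \<Rightarrow> bool" where
  "admissible_rules I R \<longleftrightarrow>
     (\<forall>\<sigma>\<subseteq>branching_constraints I. node_region I \<sigma> \<noteq> {} \<longrightarrow>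
        lp_vertex R \<sigma> \<in> optimal_vertices I (node_region I \<sigma>)) \<and>
     (\<forall>\<sigma>\<subseteq>branching_constraints I. \<forall>E\<subseteq>edges (node_region I \<sigma>). E \<noteq> {} \<longrightarrow>
        (case tie_edge R \<sigma> E of (u, v) \<Rightarrow> closed_segment u v \<in> E)) \<and>
     inj_on (var_rank R) {..<nvars I} \<and>
     (\<forall>T L Q. finite L \<longrightarrow> L \<noteq> {} \<longrightarrow> node_select R T L Q \<in> L)"

definition first_on_segment :: "vector \<Rightarrow> vector set \<Rightarrow> vector" where
  "first_on_segment u W = (THE x. x \<in> W \<and> (\<forall>w\<in>W. x \<in> closed_segment u w))"

text \<open>The LP optimum at \<open>\<sigma>\<close> in the presence of the cut \<open>y\<close>; only meaningful for a feasible LP.\<close>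

definition lp_optimum :: "ip \<Rightarrow> bc_rules \<Rightarrow> vector \<Rightarrow> branching set \<Rightarrow> vector" where
  "lp_optimum I R y \<sigma> =
     (if cut_holds I y (lp_vertex R \<sigma>) then lp_vertex R \<sigma>
      else
        let V = optimal_vertices I (cut_region I y \<sigma>);
            E = {e \<in> edges (node_region I \<sigma>). e \<inter> V \<noteq> {}};
            (u, v) = tie_edge R \<sigma> E
        in first_on_segment u (V \<inter> closed_segment u v))"

definition score :: "ip \<Rightarrow> bc_rules \<Rightarrow> vector \<Rightarrow> branching set \<Rightarrow> nat \<Rightarrow> ereal" where
  "score I R y \<sigma> i =
     (let x = lp_optimum I R y \<sigma>;
          z = lp_value I (cut_region I y \<sigma>);
          zminus = lp_value I (cut_region I y (insert (Upper i \<lfloor>x i\<rfloor>) \<sigma>));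
          zplus = lp_value I (cut_region I y (insert (Lower i \<lceil>x i\<rceil>) \<sigma>))
      in max (z - zminus) (ereal (1 / 10 ^ 6)) * max (z - zplus) (ereal (1 / 10 ^ 6)))"

definition branching_variable :: "ip \<Rightarrow> bc_rules \<Rightarrow> vector \<Rightarrow> branching set \<Rightarrow> nat" where
  "branching_variable I R y \<sigma> =
     (ARG_MIN (var_rank R) i. i < nvars I \<and>
        (\<forall>j<nvars I. score I R y \<sigma> j \<le> score I R y \<sigma> i))"

text \<open>
  A state consists of the tree built so far, its leaves that are still unprocessed, and the value of
  the best integral solution found so far (\<open>-\<infinity>\<close> if there is none).
\<close>

type_synonym bc_state = "node set \<times> node set \<times> ereal"

fun bc_step :: "ip \<Rightarrow> bc_rules \<Rightarrow> vector \<Rightarrow> bc_state \<Rightarrow> bc_state" where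
  "bc_step I R y (T, L, inc) =
     (if L = {} then (T, L, inc)
      else
        let val = (\<lambda>p. lp_value I (cut_region I y (set p)));
            q = node_select R T L {(p, p'). p \<in> L \<and> p' \<in> L \<and> val p \<le> val p'};
            x = lp_optimum I R y (set q);
            i = branching_variable I R y (set q);
            children = {q @ [Upper i \<lfloor>x i\<rfloor>], q @ [Lower i \<lceil>x i\<rceil>]}
        in if cut_region I y (set q) = {} then (T, L - {q}, inc)
           else if integral_point I x then (T, L - {q}, max inc (val q))
           else if val q \<le> inc then (T, L - {q}, inc)
           else (T \<union> children, L - {q} \<union> children, inc))"

definition bc_run :: "ip \<Rightarrow> bc_rules \<Rightarrow> vector \<Rightarrow> nat \<Rightarrow> bc_state" where
  "bc_run I R y t = (bc_step I R y ^^ t) ({[]}, {[]}, -\<infinity>)"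

text \<open>
  The tree is the set of all nodes ever created, with \<^const>\<open>None\<close> as the special form for
  an invalid cut. The union over all steps avoids a termination assumption: the scoring rule ranges
  over all variables, so a tie may select one that is already integral at the LP optimum.
\<close>

definition bc_tree :: "ip \<Rightarrow> bc_rules \<Rightarrow> vector \<Rightarrow> node set option" where
  "bc_tree I R y = (if valid_cut I y then Some (\<Union>t. fst (bc_run I R y t)) else None)"


section \<open>Polynomial hypersurfaces and the partition they induce\<close>

text \<open>
  A real polynomial in variables indexed by \<^typ>\<open>nat\<close> maps each monomial (a finitely supported
  exponent vector) to its coefficient.
\<close>

type_synonym real_mpoly = "(nat \<Rightarrow>\<^sub>0 nat) \<Rightarrow>\<^sub>0 real"

definition mpoly_eval :: "real_mpoly \<Rightarrow> vector \<Rightarrow> real" where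
  "mpoly_eval p x =
     (\<Sum>m\<in>Poly_Mapping.keys p. Poly_Mapping.lookup p m *
        (\<Prod>i\<in>Poly_Mapping.keys m. x i ^ Poly_Mapping.lookup m i))"

definition polynomial_hypersurface :: "nat \<Rightarrow> nat \<Rightarrow> vector set \<Rightarrow> bool" where
  "polynomial_hypersurface k d S \<longleftrightarrow>
     (\<exists>p :: real_mpoly.
        (\<forall>m\<in>Poly_Mapping.keys p. Poly_Mapping.keys m \<subseteq> {..<k} \<and>
           (\<Sum>i\<in>Poly_Mapping.keys m. Poly_Mapping.lookup m i) \<le> d) \<and>
        S = {y \<in> topspace (Euclidean_space k). mpoly_eval p y = 0})"

definition unsplit_connected :: "nat \<Rightarrow> vector set set \<Rightarrow> vector set \<Rightarrow> bool" where
  "unsplit_connected k H D \<longleftrightarrow>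
     D \<noteq> {} \<and> connectedin (Euclidean_space k) D \<and> (\<forall>S\<in>H. D \<subseteq> S \<or> D \<inter> S = {})"

definition partition_components :: "nat \<Rightarrow> vector set set \<Rightarrow> vector set set" where
  "partition_components k H =
     {D. unsplit_connected k H D \<and> (\<forall>D'. unsplit_connected k H D' \<and> D \<subseteq> D' \<longrightarrow> D' = D)}"

end

theory Submission
  imports Defs
begin

text \<open>
  Fix the set of branching constraints of a node and let \<open>S\<close> be its LP region without the cut. The
  LP with the cut $\alpha^T x \le \beta$ has its optimum at an extreme point of the intersection
  of \<open>S\<close> with a half-space, and such a point is either a vertex of \<open>S\<close> that satisfies the cut or
  the point in which the bounding hyperplane crosses an edge of \<open>S\<close> (\<open>extreme_points_of_cut\<close>).
  Both kinds come from the faces of \<open>S\<close> that are segments $[u,v]$, with $u = v$ allowed; the pairs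
  $(u,v)$ are called candidates here, and a candidate is live if it produces a point of the cut
  region. The candidates do not depend on the cut. Whether one is live depends only on the signs
  of the affine forms $\alpha^T u - \beta$ at its ends, and if it is live then the coordinates of
  its point and its objective value are quotients of two affine forms in $(\alpha,\beta)$ with
  positive denominator.

  Hence every decision of branch-and-cut is a matter of signs of polynomials in $(\alpha,\beta)$.
  Validity of the cut and liveness of candidates involve affine forms, since an integral point is
  itself a vertex of the region cut out by fixing all its coordinates. Integrality and rounding of
  an LP optimum compare coordinates with integers, again affine after clearing the denominator.
  Pruning and node selection compare two LP values, which has degree 2. The product rule compares
  $(z-a)(z-b)$ with $(z-c)(z-d)$, where $z$ is the value of the node and $a,b,c,d$ are values of
  children; the term $z^2$ cancels, so that one factor for each of the five denominators suffices
  and the degree is 5. The threshold in the rule replaces some of the factors by a constant, which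
  gives polynomials of degree 2, 4 or 5. On a connected component all these signs are constant,
  because a continuous function without zeros on a connected set does not change sign
  (\<open>sgn_constant_on_component\<close>). By induction on the number of steps, two cuts of one component go
  through the same runs (\<open>bc_tree_agree\<close>).

  For the count, only the lower and upper bounds of the variables matter for the region of a node,
  so there are at most $(\tau+1)^{2n}$ regions. Each is described by $m+2n$ inequalities, and a
  face that is a segment is recovered from at most $n$ of those that are tight on it, namely a
  basis of them (\<open>segment_face_tight\<close>). So there are at most $2(m+2n+1)^n(\tau+1)^{2n}$
  candidates. The largest family of polynomials is indexed by five of them, which yields the
  exponents $10n \le 5n^2$ of $\tau$ and $5n \le 3n^2$ of $m+2n$ as soon as $n \ge 2$; constants
  to the power $n$ are absorbed by the factor $(m+2n)^{3n^2-5n}$ once $n$ is large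
  (\<open>count_bound\<close>). With a single variable there is nothing for the scoring rule to compare, and
  pairs of candidates suffice.
\<close>

section \<open>Systems of linear inequalities\<close>

abbreviation rspace :: "nat \<Rightarrow> vector set" where
  "rspace n \<equiv> topspace (Euclidean_space n)"

lemma scaleR_fun_apply [simp]: "(r *\<^sub>R f) x = r *\<^sub>R f x" for f :: "'a \<Rightarrow> 'b::real_vector"
  by (simp add: scaleR_fun_def)

lemma rspace_iff: "x \<in> rspace n \<longleftrightarrow> (\<forall>i\<ge>n. x i = 0)"
  by (simp add: topspace_Euclidean_space)

lemma rspace_add: "x \<in> rspace n \<Longrightarrow> y \<in> rspace n \<Longrightarrow> x + y \<in> rspace n"
  and rspace_diff: "x \<in> rspace n \<Longrightarrow> y \<in> rspace n \<Longrightarrow> x - y \<in> rspace n"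
  and rspace_scaleR: "x \<in> rspace n \<Longrightarrow> r *\<^sub>R x \<in> rspace n"
  and rspace_uminus: "x \<in> rspace n \<Longrightarrow> - x \<in> rspace n"
  by (simp_all add: rspace_iff)

lemmas rspace_intros = rspace_add rspace_diff rspace_scaleR rspace_uminus

lemma dot_add_right: "dot n a (x + y) = dot n a x + dot n a y"
  and dot_diff_right: "dot n a (x - y) = dot n a x - dot n a y"
  and dot_scaleR_right: "dot n a (r *\<^sub>R x) = r * dot n a x"
  and dot_uminus_right: "dot n a (- x) = - dot n a x"
  by (simp_all add: dot_def algebra_simps sum.distrib sum_subtractf sum_distrib_left sum_negf)

lemmas dot_right = dot_add_right dot_diff_right dot_scaleR_right dot_uminus_right

lemma dot_sum_left: "dot n (\<lambda>i. \<Sum>p\<in>T. f p i) x = (\<Sum>p\<in>T. dot n (f p) x)"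
  unfolding dot_def by (simp add: sum_distrib_right sum.swap[of _ _ "{..<n}"])

text \<open>
  A system is a finite set of pairs of a row and a right-hand side, so that adding a cut is an
  \<^const>\<open>insert\<close>, and a face is given by the subset of the inequalities that are tight on it.
\<close>

definition solutions :: "nat \<Rightarrow> (vector \<times> real) set \<Rightarrow> vector set" where
  "solutions n J = {x \<in> rspace n. \<forall>p\<in>J. dot n (fst p) x \<le> snd p}"

definition tight :: "nat \<Rightarrow> (vector \<times> real) set \<Rightarrow> vector \<Rightarrow> (vector \<times> real) set" where
  "tight n J x = {p\<in>J. dot n (fst p) x = snd p}"

text \<open>
  Boundedness, in the form in which it is used: one can travel along a line only until some
  inequality becomes tight. The predicate \<^const>\<open>bounded\<close> holds for every set of this type.
\<close>

definition no_ray :: "vector set \<Rightarrow> bool" where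
  "no_ray S \<longleftrightarrow> (\<forall>x\<in>S. \<forall>d. d \<noteq> 0 \<longrightarrow> (\<exists>t\<ge>0. x + t *\<^sub>R d \<notin> S))"

lemma no_ray_subset: "no_ray S \<Longrightarrow> T \<subseteq> S \<Longrightarrow> no_ray T"
  unfolding no_ray_def by blast

lemma convex_solutions: "convex (solutions n J)"
proof (rule convexI)
  fix x y and u v :: real
  assume xy: "x \<in> solutions n J" "y \<in> solutions n J" and uv: "0 \<le> u" "0 \<le> v" "u + v = 1"
  have "dot n (fst p) (u *\<^sub>R x + v *\<^sub>R y) \<le> snd p" if "p \<in> J" for p
  proof -
    have "u * dot n (fst p) x + v * dot n (fst p) y \<le> u * snd p + v * snd p"
      using xy that uv by (intro add_mono mult_left_mono) (auto simp: solutions_def)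
    also have "\<dots> = snd p" using uv by (simp add: distrib_right[symmetric])
    finally show ?thesis by (simp add: dot_right)
  qed
  then show "u *\<^sub>R x + v *\<^sub>R y \<in> solutions n J"
    using xy by (simp add: solutions_def rspace_intros)
qed

text \<open>
  The ratio test of the simplex method: the first inequality to become tight along \<open>d\<close> determines
  how far one can go. Most facts below come from moving along a direction that keeps the tight
  inequalities tight.
\<close>

lemma ray_exit:
  assumes fin: "finite J" and nr: "no_ray (solutions n J)" and x: "x \<in> solutions n J"
    and d: "d \<in> rspace n" "d \<noteq> 0" and td: "\<And>p. p \<in> tight n J x \<Longrightarrow> dot n (fst p) d \<le> 0"
  obtains s where "s > 0" "\<And>t. t \<ge> 0 \<Longrightarrow> x + t *\<^sub>R d \<in> solutions n J \<longleftrightarrow> t \<le> s"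
    "\<exists>p\<in>J. dot n (fst p) (x + s *\<^sub>R d) = snd p \<and> dot n (fst p) d > 0"
proof -
  define P where "P = {p\<in>J. dot n (fst p) d > 0}"
  define q where "q p = (snd p - dot n (fst p) x) / dot n (fst p) d" for p
  have finP: "finite P" using fin by (simp add: P_def)
  have iff: "x + t *\<^sub>R d \<in> solutions n J \<longleftrightarrow> (\<forall>p\<in>P. t \<le> q p)" if "t \<ge> 0" for t
  proof -
    have "dot n (fst p) (x + t *\<^sub>R d) \<le> snd p \<longleftrightarrow> (p \<in> P \<longrightarrow> t \<le> q p)" if "p \<in> J" for p
    proof (cases "p \<in> P")
      case True
      then show ?thesis by (auto simp: P_def q_def dot_right field_simps)
    next
      case False
      then have "dot n (fst p) d \<le> 0" using that by (auto simp: P_def)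
      then have "t * dot n (fst p) d \<le> 0" using \<open>t \<ge> 0\<close> by (simp add: mult_nonneg_nonpos)
      moreover have "dot n (fst p) x \<le> snd p" using x that by (auto simp: solutions_def)
      ultimately show ?thesis using False by (simp add: dot_right)
    qed
    moreover have "x + t *\<^sub>R d \<in> rspace n" using x d by (simp add: solutions_def rspace_intros)
    ultimately show ?thesis by (auto simp: solutions_def P_def)
  qed
  have "P \<noteq> {}"
  proof
    assume "P = {}"
    then show False using nr x d iff by (auto simp: no_ray_def)
  qed
  define s where "s = Min (q ` P)"
  have s_in: "s \<in> q ` P" unfolding s_def using finP \<open>P \<noteq> {}\<close> by simp
  have qpos: "q p > 0" if "p \<in> P" for p
  proof -
    have "p \<in> J" "dot n (fst p) d > 0" using that by (auto simp: P_def)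
    moreover from this have "p \<notin> tight n J x" using td by fastforce
    ultimately have "dot n (fst p) x < snd p" using x by (auto simp: solutions_def tight_def less_le)
    then show ?thesis using \<open>dot n (fst p) d > 0\<close> by (simp add: q_def)
  qed
  obtain p where p: "p \<in> P" "s = q p" using s_in by blast
  show ?thesis
  proof
    show "s > 0" using p qpos by simp
    show "x + t *\<^sub>R d \<in> solutions n J \<longleftrightarrow> t \<le> s" if "t \<ge> 0" for t
      using iff[OF that] finP \<open>P \<noteq> {}\<close> by (simp add: s_def)
    have "dot n (fst p) (x + s *\<^sub>R d) = snd p"
      using p by (simp add: dot_right q_def P_def)
    then show "\<exists>p\<in>J. dot n (fst p) (x + s *\<^sub>R d) = snd p \<and> dot n (fst p) d > 0"
      using p by (auto simp: P_def)
  qed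
qed

lemma tight_open_segment:
  assumes "x \<in> open_segment u v" "u \<in> solutions n J" "v \<in> solutions n J"
  shows "tight n J x = tight n J u \<inter> tight n J v"
proof -
  obtain t where t: "0 < t" "t < 1" "x = (1 - t) *\<^sub>R u + t *\<^sub>R v"
    using assms(1) by (auto simp: in_segment)
  have "dot n (fst p) x = snd p \<longleftrightarrow> dot n (fst p) u = snd p \<and> dot n (fst p) v = snd p" if "p \<in> J" for p
  proof -
    have le: "dot n (fst p) u \<le> snd p" "dot n (fst p) v \<le> snd p"
      using assms that by (auto simp: solutions_def)
    have eq: "snd p - dot n (fst p) x = (1-t) * (snd p - dot n (fst p) u) + t *
        (snd p - dot n (fst p) v)"
      by (simp add: t(3) dot_right algebra_simps)
    have "(1-t) * (snd p - dot n (fst p) u) \<ge> 0" "t * (snd p - dot n (fst p) v) \<ge> 0"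
      using t le by auto
    then have "snd p - dot n (fst p) x = 0 \<longleftrightarrow>
       (1-t) * (snd p - dot n (fst p) u) = 0 \<and> t * (snd p - dot n (fst p) v) = 0"
      using eq add_nonneg_eq_0_iff by metis
    moreover have "1 - t \<noteq> 0" "t \<noteq> 0" using t by auto
    ultimately show ?thesis unfolding mult_eq_0_iff right_minus_eq by metis
  qed
  then show ?thesis unfolding tight_def by blast
qed

text \<open>
  A nonzero direction on which all tight rows vanish can be followed both ways, which puts \<open>x\<close>
  inside a segment; conversely the tight rows vanish on the direction of any segment around \<open>x\<close>.
\<close>

lemma extreme_point_iff_tight:
  assumes fin: "finite J" and nr: "no_ray (solutions n J)" and x: "x \<in> solutions n J"
  shows "x extreme_point_of solutions n J \<longleftrightarrow>
    (\<forall>d\<in>rspace n. (\<forall>p\<in>tight n J x. dot n (fst p) d = 0) \<longrightarrow> d = 0)" (is "_ \<longleftrightarrow> ?R")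
proof
  assume ext: "x extreme_point_of solutions n J"
  show ?R
  proof (intro ballI impI, rule ccontr)
    fix d assume d: "d \<in> rspace n" "\<forall>p\<in>tight n J x. dot n (fst p) d = 0" "d \<noteq> 0"
    obtain s where s: "s > 0" "\<And>t. t \<ge> 0 \<Longrightarrow> x + t *\<^sub>R d \<in> solutions n J \<longleftrightarrow> t \<le> s"
      using ray_exit[OF fin nr x d(1,3)] d(2) by (metis order_refl)
    have "- d \<noteq> 0" "dot n (fst p) (- d) \<le> 0" if "p \<in> tight n J x" for p
      using d(2,3) that by (simp_all add: dot_right)
    then obtain s' where s': "s' > 0" "\<And>t. t \<ge> 0 \<Longrightarrow> x + t *\<^sub>R (- d) \<in> solutions n J \<longleftrightarrow> t \<le> s'"
      using ray_exit[OF fin nr x rspace_uminus[OF d(1)]] d(3) by (metis neg_equal_0_iff_equal)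
    define e where "e = min s s'"
    have "x + e *\<^sub>R d \<in> solutions n J" "x + e *\<^sub>R (- d) \<in> solutions n J"
      using s s' by (auto simp: e_def)
    moreover have "x \<in> open_segment (x + e *\<^sub>R d) (x + e *\<^sub>R (- d))"
    proof -
      have "e > 0" using s s' by (simp add: e_def)
      moreover obtain i where "d i \<noteq> 0" using d(3) by (auto simp: fun_eq_iff)
      ultimately have "(x + e *\<^sub>R d) i \<noteq> (x + e *\<^sub>R (- d)) i" by simp
      then have "x + e *\<^sub>R d \<noteq> x + e *\<^sub>R (- d)" by metis
      moreover have "x = (1 - 1/2) *\<^sub>R (x + e *\<^sub>R d) + (1/2) *\<^sub>R (x + e *\<^sub>R (- d))"
        by (simp add: fun_eq_iff algebra_simps)
      ultimately show ?thesis unfolding in_segment by (intro conjI exI[of _ "1/2"]) auto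
    qed
    ultimately show False using ext by (auto simp: extreme_point_of_def)
  qed
next
  assume R: ?R
  show "x extreme_point_of solutions n J"
    unfolding extreme_point_of_def
  proof (intro conjI x ballI notI)
    fix u v assume uv: "u \<in> solutions n J" "v \<in> solutions n J" "x \<in> open_segment u v"
    have "v - u \<in> rspace n" using uv by (simp add: solutions_def rspace_intros)
    moreover have "\<forall>p\<in>tight n J x. dot n (fst p) (v - u) = 0"
      using tight_open_segment[OF uv(3,1,2)] by (auto simp: tight_def dot_right)
    ultimately have "v - u = 0" using R by blast
    then show False using uv(3) by simp
  qed
qed

text \<open>
  As long as the point is not extreme, some direction keeps all its tight inequalities tight; up
  to sign it does not decrease the objective. Following it until a new inequality becomes tight
  leaves fewer slack inequalities. This replaces both compactness and the Krein-Milman theorem.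
\<close>

lemma extreme_point_at_least:
  assumes fin: "finite J" and nr: "no_ray (solutions n J)" and x: "x \<in> solutions n J"
  shows "\<exists>v. v extreme_point_of solutions n J \<and> dot n c x \<le> dot n c v"
  using x
proof (induction "card (J - tight n J x)" arbitrary: x rule: less_induct)
  case less
  show ?case
  proof (cases "x extreme_point_of solutions n J")
    case False
    then obtain d0 where d0: "d0 \<in> rspace n" "\<forall>p\<in>tight n J x. dot n (fst p) d0 = 0" "d0 \<noteq> 0"
      using extreme_point_iff_tight[OF fin nr less.prems] by blast
    define d where "d = (if dot n c d0 \<ge> 0 then d0 else - d0)"
    have d: "d \<in> rspace n" "\<forall>p\<in>tight n J x. dot n (fst p) d = 0" "d \<noteq> 0" "dot n c d \<ge> 0"
      using d0 by (auto simp: d_def dot_right rspace_intros)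
    obtain s where s: "s > 0" "\<And>t. t \<ge> 0 \<Longrightarrow> x + t *\<^sub>R d \<in> solutions n J \<longleftrightarrow> t \<le> s"
       "\<exists>p\<in>J. dot n (fst p) (x + s *\<^sub>R d) = snd p \<and> dot n (fst p) d > 0"
      using ray_exit[OF fin nr less.prems d(1,3)] d(2) by (metis order_refl)
    define z where "z = x + s *\<^sub>R d"
    have z: "z \<in> solutions n J" using s by (simp add: z_def)
    have "J - tight n J z \<subset> J - tight n J x"
    proof -
      have "tight n J x \<subseteq> tight n J z" using d(2) by (auto simp: tight_def z_def dot_right)
      moreover obtain p where p: "p \<in> J" "dot n (fst p) z = snd p" "dot n (fst p) d > 0"
        using s(3) unfolding z_def by blast
      moreover have "p \<in> tight n J z" using p by (simp add: tight_def)
      moreover have "p \<notin> tight n J x" using p(3) d(2) by force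
      ultimately show ?thesis by blast
    qed
    then have "card (J - tight n J z) < card (J - tight n J x)"
      using fin by (intro psubset_card_mono) auto
    from less.hyps[OF this z] obtain v where "v extreme_point_of solutions n J" "dot n c z \<le> dot n c v"
      by blast
    moreover have "dot n c x \<le> dot n c z" using d(4) s(1) by (simp add: z_def dot_right)
    ultimately show ?thesis by (meson order_trans)
  qed auto
qed

lemma face_of_tight:
  "{x \<in> solutions n J. T \<subseteq> tight n J x} face_of solutions n J"
  unfolding face_of_def
proof (intro conjI ballI impI)
  show "convex {x \<in> solutions n J. T \<subseteq> tight n J x}"
  proof (rule convexI)
    fix x y and u v :: real
    assume xy: "x \<in> {x \<in> solutions n J. T \<subseteq> tight n J x}" "y \<in> {x \<in> solutions n J. T \<subseteq> tight n J x}"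
      and uv: "0 \<le> u" "0 \<le> v" "u + v = 1"
    have "u *\<^sub>R x + v *\<^sub>R y \<in> solutions n J"
      using xy uv convex_solutions[of n J] by (auto simp: convex_def)
    moreover have "dot n (fst p) (u *\<^sub>R x + v *\<^sub>R y) = snd p" if "p \<in> T" for p
    proof -
      have "dot n (fst p) x = snd p" "dot n (fst p) y = snd p" using xy that by (auto simp: tight_def)
      then show ?thesis using uv by (simp add: dot_right distrib_right[symmetric])
    qed
    ultimately show "u *\<^sub>R x + v *\<^sub>R y \<in> {x \<in> solutions n J. T \<subseteq> tight n J x}"
      using xy by (auto simp: tight_def)
  qed
qed (use tight_open_segment in \<open>blast+\<close>)

text \<open>
  A point \<open>w\<close> at which as few inequalities as possible are tight behaves like a relative interior
  point: from any solution \<open>x\<close> tight where \<open>w\<close> is, the segment through \<open>w\<close> can be prolonged a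
  little beyond \<open>w\<close>, so that the face contains \<open>x\<close>.
\<close>

lemma face_eq_tight:
  assumes fin: "finite J" and nr: "no_ray (solutions n J)"
    and F: "F face_of solutions n J" and w: "w \<in> F"
    and wt: "\<And>x. x \<in> F \<Longrightarrow> tight n J w \<subseteq> tight n J x"
  shows "F = {x \<in> solutions n J. tight n J w \<subseteq> tight n J x}"
proof
  show "F \<subseteq> {x \<in> solutions n J. tight n J w \<subseteq> tight n J x}"
    using F wt by (auto dest: face_of_imp_subset)
  show "{x \<in> solutions n J. tight n J w \<subseteq> tight n J x} \<subseteq> F"
  proof safe
    fix x assume x: "x \<in> solutions n J" "tight n J w \<subseteq> tight n J x"
    have wS: "w \<in> solutions n J" using F w by (auto dest: face_of_imp_subset)
    show "x \<in> F"
    proof (cases "x = w")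
      case False
      have "w - x \<in> rspace n" using wS x by (simp add: solutions_def rspace_intros)
      moreover have "dot n (fst p) (w - x) \<le> 0" if "p \<in> tight n J w" for p
        using that x by (auto simp: tight_def dot_right)
      ultimately obtain s where s: "s > 0"
        "\<And>t. t \<ge> 0 \<Longrightarrow> w + t *\<^sub>R (w - x) \<in> solutions n J \<longleftrightarrow> t \<le> s"
        using ray_exit[OF fin nr wS, of "w - x"] False by (metis eq_iff_diff_eq_0)
      define z where "z = w + s *\<^sub>R (w - x)"
      have z: "z \<in> solutions n J" using s by (simp add: z_def)
      define r where "r = 1 / (1 + s)"
      have r: "0 < r" "r < 1" "r * (1 + s) = 1" using s(1) by (simp_all add: r_def)
      have "(1 - r) *\<^sub>R x + r *\<^sub>R z = x + (r * (1 + s)) *\<^sub>R (w - x)"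
        by (simp add: z_def algebra_simps)
      then have "w = (1 - r) *\<^sub>R x + r *\<^sub>R z" using r by simp
      moreover have "x \<noteq> z" using False s(1)
      proof -
        have "z - x = (1 + s) *\<^sub>R (w - x)" by (simp add: z_def algebra_simps)
        then show ?thesis using False s(1) by auto
      qed
      ultimately have "w \<in> open_segment x z" unfolding in_segment
        using r(1,2) by blast
      then show ?thesis using face_ofD[OF F _ x(1) z w] by blast
    qed (use w in simp)
  qed
qed

text \<open>
  A maximal linearly independent set of rows has at most \<open>n\<close> members, and a direction orthogonal
  to it is orthogonal to all rows.
\<close>

lemma tight_basis:
  fixes T :: "(vector \<times> real) set"
  shows "\<exists>B\<subseteq>T. card B \<le> n \<and> (\<forall>d. (\<forall>p\<in>B. dot n (fst p) d = 0) \<longrightarrow> (\<forall>p\<in>T. dot n (fst p) d = 0))"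
proof -
  \<comment> \<open>The rows live in a space of infinite dimension; only their first \<open>n\<close> entries matter, and
      truncated rows are spanned by \<open>n\<close> unit vectors.\<close>
  define cut where "cut p = (\<lambda>i. if i < n then fst p i else 0 :: real)" for p :: "vector \<times> real"
  define ax where "ax j = (\<lambda>i. if i = j then 1 else 0 :: real)" for j :: nat
  have dot_cut: "dot n (cut p) d = dot n (fst p) d" for p d by (simp add: dot_def cut_def)
  obtain C where C: "C \<subseteq> cut ` T" "independent C" "cut ` T \<subseteq> span C"
    using real_vector.maximal_independent_subset[of "cut ` T"] by metis
  have "cut p \<in> span (ax ` {..<n})" for p
  proof -
    have eq: "cut p = (\<Sum>j<n. fst p j *\<^sub>R ax j)"
    proof
      fix i
      have "(\<Sum>j<n. fst p j *\<^sub>R ax j) i = (\<Sum>j<n. fst p j * ax j i)"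
        by (induction n) (auto simp: scaleR_fun_def)
      then show "cut p i = (\<Sum>j<n. fst p j *\<^sub>R ax j) i"
        by (simp add: cut_def ax_def if_distrib sum.delta cong: if_cong)
    qed
    have "fst p j *\<^sub>R ax j \<in> span (ax ` {..<n})" if "j < n" for j
      by (rule span_scale, rule span_base) (use that in simp)
    then show ?thesis unfolding eq by (intro real_vector.span_sum) simp
  qed
  then have "C \<subseteq> span (ax ` {..<n})" using C(1) by auto
  from real_vector.independent_span_bound[OF _ C(2) this] have "finite C" "card C
      \<le> card (ax ` {..<n})" by auto
  then have cardC: "card C \<le> n" using card_image_le[of "{..<n}" ax] by simp
  obtain B where B: "B \<subseteq> T" "inj_on cut B" "cut ` B = C"
    using C(1) subset_image_inj by metis
  have "\<forall>p\<in>T. dot n (fst p) d = 0" if d: "\<forall>p\<in>B. dot n (fst p) d = 0" for d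
  proof
    fix p assume "p \<in> T"
    have "subspace {a. dot n a d = 0}"
      by (auto simp: subspace_def dot_def algebra_simps sum.distrib sum_distrib_left[symmetric])
    moreover have "C \<subseteq> {a. dot n a d = 0}" using d B(3) dot_cut by force
    ultimately have "span C \<subseteq> {a. dot n a d = 0}" by (rule span_minimal[rotated])
    moreover have "cut p \<in> span C" using C(3) \<open>p \<in> T\<close> by blast
    ultimately have "dot n (cut p) d = 0" by blast
    then show "dot n (fst p) d = 0" by (simp add: dot_cut)
  qed
  moreover have "card B \<le> n" using B cardC card_image by metis
  ultimately show ?thesis using B(1) by blast
qed

text \<open>
  Vertices and edges together: a vertex is the segment from the point to itself.
\<close>

definition segment_faces :: "vector set \<Rightarrow> vector set set" where
  "segment_faces S = {f. f face_of S \<and> (\<exists>u v. f = closed_segment u v)}"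

text \<open>
  The midpoint of a segment face is tight exactly where the whole face is, so the face is cut out
  by the inequalities tight there, and a basis of these suffices.
\<close>

lemma segment_face_tight:
  assumes fin: "finite J" and nr: "no_ray (solutions n J)" and f: "f \<in> segment_faces (solutions n J)"
  shows "\<exists>B\<subseteq>J. card B \<le> n \<and> f = {x \<in> solutions n J. B \<subseteq> tight n J x}"
proof -
  obtain u v where uv: "f face_of solutions n J" "f = closed_segment u v"
    using f by (auto simp: segment_faces_def)
  define w where "w = midpoint u v"
  have wf: "w \<in> f" using uv by (simp add: w_def)
  have uvS: "u \<in> solutions n J" "v \<in> solutions n J" 
    using uv face_of_imp_subset by (auto simp del: ends_in_segment intro: ends_in_segment)
  have wt: "tight n J w \<subseteq> tight n J x" if x: "x \<in> f" for x
  proof (cases "u = v")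
    case True
    then show ?thesis using wf x uv by simp
  next
    case False
    then have "w \<in> open_segment u v" by (simp add: w_def)
    then have w: "tight n J w = tight n J u \<inter> tight n J v"
      using tight_open_segment uvS by blast
    show ?thesis
    proof (cases "x = u \<or> x = v")
      case True
      then show ?thesis using w by blast
    next
      case False
      then have "x \<in> open_segment u v" using x uv by (auto simp: open_segment_def)
      then show ?thesis using tight_open_segment uvS w by blast
    qed
  qed
  have feq: "f = {x \<in> solutions n J. tight n J w \<subseteq> tight n J x}"
    using face_eq_tight[OF fin nr uv(1) wf wt] .
  obtain B where B: "B \<subseteq> tight n J w" "card B \<le> n"
    "\<And>d. \<forall>p\<in>B. dot n (fst p) d = 0 \<Longrightarrow> \<forall>p\<in>tight n J w. dot n (fst p) d = 0"
    using tight_basis[of "tight n J w" n] by blast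
  have "tight n J w \<subseteq> tight n J x" if "B \<subseteq> tight n J x" for x
  proof -
    have "dot n (fst p) (x - w) = 0" if "p \<in> B" for p
    proof -
      have "p \<in> tight n J x" "p \<in> tight n J w" using that \<open>B \<subseteq> tight n J x\<close> B(1) by blast+
      then show ?thesis by (simp add: tight_def dot_right)
    qed
    then have "\<forall>p\<in>tight n J w. dot n (fst p) (x - w) = 0" using B(3) by blast
    then show ?thesis by (simp add: tight_def dot_right subset_iff)
  qed
  then have "f = {x \<in> solutions n J. B \<subseteq> tight n J x}" using feq B(1) by auto
  moreover have "B \<subseteq> J" using B(1) by (auto simp: tight_def)
  ultimately show ?thesis using B(2) by blast
qed

text \<open>
  At most \<open>n\<close> inequalities out of \<open>N\<close> are chosen by a function on \<open>n\<close> positions with \<^const>\<open>None\<close> as an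
  extra value, which covers choices of fewer than \<open>n\<close>.
\<close>

lemma card_segment_faces:
  assumes fin: "finite J" and nr: "no_ray (solutions n J)" and N: "card J \<le> N"
  shows "finite (segment_faces (solutions n J)) \<and> card (segment_faces (solutions n J)) \<le> (N + 1) ^ n"
proof -
  define sub where "sub g = {x \<in> solutions n J. (the ` (g ` {..<n} - {None})) \<subseteq> tight n J x}"
    for g :: "nat \<Rightarrow> (vector \<times> real) option"
  define G where "G = PiE {..<n} (\<lambda>_. insert None (Some ` J))"
  have finG: "finite G" using fin by (auto simp: G_def intro: finite_PiE)
  have "card (insert None (Some ` J)) = card J + 1"
    using fin by (simp add: card_image)
  then have cardG: "card G \<le> (N + 1) ^ n"
    using N by (simp add: G_def card_PiE power_mono)
  have "segment_faces (solutions n J) \<subseteq> sub ` G"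
  proof
    fix f assume "f \<in> segment_faces (solutions n J)"
    from segment_face_tight[OF fin nr this] obtain B where
      B: "B \<subseteq> J" "card B \<le> n" "f = {x \<in> solutions n J. B \<subseteq> tight n J x}" by blast
    have finB: "finite B" using B fin finite_subset by blast
    obtain h where h: "bij_betw h {..<card B} B"
      using finB by (metis ex_bij_betw_nat_finite lessThan_atLeast0)
    define g where "g = (\<lambda>i\<in>{..<n}. if i < card B then Some (h i) else None)"
    have "h i \<in> J" if "i < card B" for i using h B(1) that by (auto simp: bij_betw_def)
    then have "g \<in> G" by (simp add: g_def G_def)
    moreover have "the ` (g ` {..<n} - {None}) = B"
    proof -
      have "g ` {..<n} - {None} = Some ` h ` {..<card B}"
      proof (intro equalityI subsetI)
        fix z assume "z \<in> g ` {..<n} - {None}"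
        then obtain i where "i < n" "z = g i" "g i \<noteq> None" by blast
        then show "z \<in> Some ` h ` {..<card B}" by (simp add: g_def split: if_splits)
      next
        fix z assume "z \<in> Some ` h ` {..<card B}"
        then obtain i where i: "i < card B" "z = Some (h i)" by blast
        then have "i < n" "z = g i" using B(2) by (simp_all add: g_def)
        then show "z \<in> g ` {..<n} - {None}" using i by blast
      qed
      then show ?thesis using h by (simp add: bij_betw_def image_image)
    qed
    ultimately show "f \<in> sub ` G" using B(3) by (force simp: sub_def)
  qed
  then show ?thesis using finG cardG
    by (meson card_image_le card_mono finite_imageI finite_subset order_trans)
qed

section \<open>Extreme points of a polytope cut by a half-space\<close>


text \<open>
  The pairs are ordered because the rule for ties orders the ends of an edge, and because an edge
  can be crossed by the hyperplane of the cut in two directions.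
\<close>

definition cands :: "vector set \<Rightarrow> (vector \<times> vector) set" where
  "cands S = {(u, v). closed_segment u v face_of S}"

lemma cands_diag: "(u, u) \<in> cands S \<longleftrightarrow> u extreme_point_of S"
  by (simp add: cands_def face_of_singleton)

lemma cands_sym: "(u, v) \<in> cands S \<longleftrightarrow> (v, u) \<in> cands S"
  by (simp add: cands_def closed_segment_commute)

lemma extreme_point_of_closed_segment:
  fixes u v :: "'a::real_vector"
  shows "x extreme_point_of closed_segment u v \<longleftrightarrow> x = u \<or> x = v"
proof -
  have end1: "u extreme_point_of closed_segment u v" for u v :: 'a
    unfolding extreme_point_of_def
  proof (intro conjI ballI notI)
    fix a b assume ab: "a \<in> closed_segment u v" "b \<in> closed_segment u v" "u \<in> open_segment a b"
    obtain s t r where "0 \<le> s" "0 \<le> t" "0 < r" "r < 1"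
      and a: "a = (1 - s) *\<^sub>R u + s *\<^sub>R v" and b: "b = (1 - t) *\<^sub>R u + t *\<^sub>R v"
      and u: "u = (1 - r) *\<^sub>R a + r *\<^sub>R b" and "a \<noteq> b"
      using ab unfolding in_segment by blast
    have "((1 - r) * s + r * t) *\<^sub>R (v - u) = 0"
    proof -
      have "((1 - r) * s + r * t) *\<^sub>R (v - u) = (1 - r) *\<^sub>R a + r *\<^sub>R b - u"
        unfolding a b by (simp add: algebra_simps)
      then show ?thesis using u by simp
    qed
    moreover have "v \<noteq> u" using a b \<open>a \<noteq> b\<close> by (auto simp: scaleR_left_distrib[symmetric])
    ultimately have "(1 - r) * s + r * t = 0" by simp
    moreover have "0 \<le> (1 - r) * s" "0 \<le> r * t" using \<open>0 \<le> s\<close> \<open>0 \<le> t\<close> \<open>0 < r\<close> \<open>r < 1\<close> by auto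
    ultimately have "(1 - r) * s = 0" "r * t = 0" by linarith+
    then have "s = 0" "t = 0" using \<open>0 < r\<close> \<open>r < 1\<close> by auto
    then show False using a b \<open>a \<noteq> b\<close> by simp
  qed simp
  show ?thesis
  proof
    assume x: "x extreme_point_of closed_segment u v"
    then have "x \<in> closed_segment u v" "x \<notin> open_segment u v"
      by (auto simp: extreme_point_of_def)
    then show "x = u \<or> x = v" by (simp add: open_segment_def)
  next
    assume "x = u \<or> x = v"
    then show "x extreme_point_of closed_segment u v"
      using end1[of u v] end1[of v u] by (auto simp: closed_segment_commute)
  qed
qed

lemma closed_segment_eq_ends:
  fixes u v :: "'a::real_vector"
  assumes "closed_segment u v = closed_segment u' v'"
  shows "(u = u' \<and> v = v') \<or> (u = v' \<and> v = u')"
proof -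
  have "x = u \<or> x = v \<longleftrightarrow> x = u' \<or> x = v'" for x
    using extreme_point_of_closed_segment[of x] assms by metis
  then show ?thesis by metis
qed

lemma cands_ends:
  assumes "(u, v) \<in> cands S"
  shows "u extreme_point_of S" "v extreme_point_of S" "u \<in> S" "v \<in> S"
proof -
  show u: "u extreme_point_of S" and v: "v extreme_point_of S"
    using assms extreme_point_of_closed_segment extreme_point_of_face[of "closed_segment u v" S]
    by (auto simp: cands_def)
  show "u \<in> S" "v \<in> S" using u v by (auto simp: extreme_point_of_def)
qed

lemma card_cands:
  assumes fin: "finite (segment_faces S)"
  shows "finite (cands S) \<and> card (cands S) \<le> 2 * card (segment_faces S)"
proof -
  have eq: "cands S = (\<Union>f\<in>segment_faces S. {(u, v). closed_segment u v = f})"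
    by (auto simp: cands_def segment_faces_def)
  have each: "finite {(u, v). closed_segment u v = f} \<and> card {(u, v). closed_segment u v = f} \<le> 2"
    if f: "f \<in> segment_faces S" for f
  proof -
    obtain a b where "f = closed_segment a b" using f unfolding segment_faces_def by blast
    then have sub: "{(u, v). closed_segment u v = f} \<subseteq> {(a, b), (b, a)}"
      using closed_segment_eq_ends by blast
    have "card {(a, b), (b, a)} \<le> 2" by (rule card_insert_le_m1) simp_all
    then show ?thesis using sub
      by (meson card_mono finite.emptyI finite.insertI finite_subset order_trans)
  qed
  have "card (cands S) \<le> (\<Sum>f\<in>segment_faces S. card {(u, v). closed_segment u v = f})"
    unfolding eq by (rule card_UN_le[OF fin])
  also have "\<dots> \<le> (\<Sum>f\<in>segment_faces S. 2)" using each by (intro sum_mono) blast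
  finally have "card (cands S) \<le> 2 * card (segment_faces S)" by simp
  moreover have "finite (cands S)" unfolding eq using fin each by blast
  ultimately show ?thesis by blast
qed

text \<open>
  An edge is oriented so that the cut holds strictly at its first end and fails at its second.
  This makes the denominator of the crossing point positive.
\<close>

definition live :: "nat \<Rightarrow> vector \<Rightarrow> vector \<times> vector \<Rightarrow> bool" where
  "live n y k = (case k of (u, v) \<Rightarrow>
     (if u = v then dot n y u \<le> y n else dot n y u < y n \<and> y n < dot n y v))"

definition cand_point :: "nat \<Rightarrow> vector \<Rightarrow> vector \<times> vector \<Rightarrow> vector" where
  "cand_point n y k = (case k of (u, v) \<Rightarrow>
     (if u = v then u else u + ((y n - dot n y u) / dot n y (v - u)) *\<^sub>R (v - u)))"

definition halfspace :: "nat \<Rightarrow> vector \<Rightarrow> vector set" where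
  "halfspace n y = {x. dot n y x \<le> y n}"

lemma solutions_cut: "solutions n (insert (y, y n) J) = solutions n J \<inter> halfspace n y"
  by (auto simp: solutions_def halfspace_def)

lemma cand_point_crossing:
  assumes "live n y (u, v)" "u \<noteq> v"
  shows "dot n y (cand_point n y (u, v)) = y n" "cand_point n y (u, v) \<in> open_segment u v"
proof -
  define s where "s = (y n - dot n y u) / dot n y (v - u)"
  have D: "dot n y (v - u) > y n - dot n y u" "y n - dot n y u > 0"
    using assms by (auto simp: live_def dot_right)
  have p: "cand_point n y (u, v) = u + s *\<^sub>R (v - u)" using assms by (simp add: cand_point_def s_def)
  have "dot n y (cand_point n y (u, v)) = dot n y u + s * dot n y (v - u)" unfolding p
      by (simp add: dot_right)
  also have "s * dot n y (v - u) = y n - dot n y u" using D by (simp add: s_def)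
  finally show "dot n y (cand_point n y (u, v)) = y n" by simp
  have "0 < s" "s < 1" using D by (auto simp: s_def)
  moreover have "cand_point n y (u, v) = (1 - s) *\<^sub>R u + s *\<^sub>R v" unfolding p
      by (simp add: algebra_simps)
  ultimately show "cand_point n y (u, v) \<in> open_segment u v" using assms(2) unfolding in_segment
      by blast
qed

lemma cand_point_in_cut:
  assumes "k \<in> cands S" "live n y k"
  shows "cand_point n y k \<in> S \<inter> halfspace n y"
proof (cases k)
  case (Pair u v)
  show ?thesis
  proof (cases "u = v")
    case True
    then show ?thesis using assms cands_ends(3)[of u v S] Pair
        by (simp add: live_def cand_point_def halfspace_def)
  next
    case False
    have "closed_segment u v \<subseteq> S" using assms(1) Pair face_of_imp_subset by (auto simp: cands_def)
    then show ?thesis using cand_point_crossing[of n y u v] False assms(2) Pair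
      by (auto simp: halfspace_def open_segment_def)
  qed
qed

text \<open>
  On the segment there is only one point of the hyperplane. A segment in the cut region through
  that point stays in the face and, as the cut is tight in the middle, in the hyperplane.
\<close>

lemma cand_point_extreme:
  assumes k: "k \<in> cands S" "live n y k"
  shows "cand_point n y k extreme_point_of (S \<inter> halfspace n y)"
proof (cases k)
  case (Pair u v)
  show ?thesis
  proof (cases "u = v")
    case True
    have "u extreme_point_of S" using k Pair cands_ends by blast
    moreover have "u \<in> halfspace n y" using k Pair True by (simp add: live_def halfspace_def)
    ultimately show ?thesis using Pair True by (auto simp: extreme_point_of_def cand_point_def)
  next
    case False
    define x where "x = cand_point n y k"
    have x: "dot n y x = y n" "x \<in> closed_segment u v"
      using cand_point_crossing[of n y u v] False k(2) Pair by (auto simp: x_def open_segment_def)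
    have D: "dot n y u < y n" "y n < dot n y v" using k(2) Pair False by (auto simp: live_def)
    show ?thesis unfolding x_def[symmetric] extreme_point_of_def
    proof (intro conjI ballI notI)
      show "x \<in> S \<inter> halfspace n y" using cand_point_in_cut[OF k] by (simp add: x_def)
      fix a b assume ab: "a \<in> S \<inter> halfspace n y" "b \<in> S \<inter> halfspace n y" "x \<in> open_segment a b"
      have "a \<in> closed_segment u v" "b \<in> closed_segment u v"
        using face_ofD[of "closed_segment u v" S x a b] k(1) Pair ab x(2) by (auto simp: cands_def)
      then obtain s t where a: "a = (1 - s) *\<^sub>R u + s *\<^sub>R v" and b: "b = (1 - t) *\<^sub>R u + t *\<^sub>R v"
        unfolding in_segment by blast
      obtain r where r: "0 < r" "r < 1" "x = (1 - r) *\<^sub>R a + r *\<^sub>R b" "a \<noteq> b"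
        using ab(3) unfolding in_segment by blast
      have "(1 - r) * (y n - dot n y a) + r * (y n - dot n y b) = y n - dot n y x"
        by (simp add: r(3) dot_right algebra_simps)
      moreover have "0 \<le> (1 - r) * (y n - dot n y a)" "0 \<le> r * (y n - dot n y b)"
        using r ab by (auto simp: halfspace_def)
      ultimately have "(1 - r) * (y n - dot n y a) = 0" "r * (y n - dot n y b) = 0"
        using x(1) by linarith+
      then have "dot n y a = dot n y b" using r by simp
      then have "s * (dot n y v - dot n y u) = t * (dot n y v - dot n y u)"
        by (simp add: a b dot_right algebra_simps)
      then have "s = t" using D by simp
      then show False using a b r(4) by simp
    qed
  qed
qed

text \<open>
  Otherwise the point could be moved both ways along the edge: if the cut is slack there, or if it
  is constant along the edge. The four pairs are the ways in which the edge and its ends can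
  contribute.
\<close>

lemma extreme_on_segment:
  assumes k: "(u, v) \<in> cands S" and x: "x \<in> closed_segment u v"
    and ext: "x extreme_point_of (S \<inter> halfspace n y)"
  shows "\<exists>k\<in>{(u, u), (v, v), (u, v), (v, u)}. live n y k \<and> x = cand_point n y k"
proof (cases "x = u \<or> x = v")
  case True
  have "dot n y x \<le> y n" using ext by (simp add: extreme_point_of_def halfspace_def)
  then have "live n y (x, x) \<and> x = cand_point n y (x, x)" by (simp add: live_def cand_point_def)
  then show ?thesis using True by auto
next
  case False
  define D where "D = dot n y (v - u)"
  have xo: "x \<in> open_segment u v" using x False by (simp add: open_segment_def)
  then obtain s where s: "0 < s" "s < 1" "x = (1 - s) *\<^sub>R u + s *\<^sub>R v" "u \<noteq> v"
    unfolding in_segment by blast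
  have xle: "dot n y x \<le> y n" using ext by (simp add: extreme_point_of_def halfspace_def)
  have segS: "closed_segment u v \<subseteq> S" using k face_of_imp_subset by (auto simp: cands_def)
  \<comment> \<open>Two opposite steps of length \<open>e\<close> along the edge would make \<open>x\<close> the midpoint of a segment in
      the cut region.\<close>
  have noe: False if e: "0 < e" "e \<le> s" "e \<le> 1 - s" "e * \<bar>D\<bar> \<le> y n - dot n y x" for e
  proof -
    define a b where "a = x + e *\<^sub>R (v - u)" and "b = x - e *\<^sub>R (v - u)"
    have "a = (1 - (s + e)) *\<^sub>R u + (s + e) *\<^sub>R v" "b = (1 - (s - e)) *\<^sub>R u + (s - e) *\<^sub>R v"
      unfolding a_def b_def s(3) by (simp_all add: algebra_simps)
    then have "a \<in> closed_segment u v" "b \<in> closed_segment u v"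
      using e s unfolding in_segment
      by (intro exI[of _ "s + e"], simp, intro exI[of _ "s - e"], simp)
    then have abS: "a \<in> S" "b \<in> S" using segS by auto
    have "dot n y a = dot n y x + e * D" "dot n y b = dot n y x - e * D"
      unfolding a_def b_def D_def by (simp_all add: dot_right)
    moreover have "\<bar>e * D\<bar> \<le> y n - dot n y x" using e by (simp add: abs_mult)
    ultimately have "dot n y a \<le> y n" "dot n y b \<le> y n" by linarith+
    then have ab: "a \<in> S \<inter> halfspace n y" "b \<in> S \<inter> halfspace n y" using abS
        by (auto simp: halfspace_def)
    have "a - b = (2 * e) *\<^sub>R (v - u)" unfolding a_def b_def scaleR_left_distrib mult_2 by simp
    then have "a \<noteq> b" using e s(4) by auto
    moreover have "x = (1 - 1/2) *\<^sub>R a + (1/2) *\<^sub>R b"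
    proof -
      have "(1 - 1/2) *\<^sub>R a + (1/2) *\<^sub>R b = (1/2 + 1/2) *\<^sub>R x"
        unfolding a_def b_def scaleR_left_distrib
            by (simp add: scaleR_right_distrib scaleR_right_diff_distrib)
      then show ?thesis by simp
    qed
    ultimately have "x \<in> open_segment a b" unfolding in_segment
      by (intro conjI exI[of _ "1/2"]) auto
    then show False using ext ab by (auto simp: extreme_point_of_def)
  qed
  have "D \<noteq> 0"
  proof
    assume "D = 0"
    then show False using noe[of "min s (1 - s)"] s xle by simp
  qed
  have xeq: "dot n y x = y n"
  proof (rule ccontr)
    assume "dot n y x \<noteq> y n"
    then have lt: "0 < y n - dot n y x" using xle by simp
    define e where "e = min (min s (1 - s)) ((y n - dot n y x) / \<bar>D\<bar>)"
    have "e * \<bar>D\<bar> \<le> ((y n - dot n y x) / \<bar>D\<bar>) * \<bar>D\<bar>"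
      by (intro mult_right_mono) (auto simp: e_def)
    then have "e * \<bar>D\<bar> \<le> y n - dot n y x" using \<open>D \<noteq> 0\<close> by simp
    moreover have "0 < e" using s(1,2) lt \<open>D \<noteq> 0\<close> by (simp add: e_def)
    moreover have "e \<le> s" "e \<le> 1 - s" by (simp_all add: e_def)
    ultimately show False using noe by blast
  qed
  have sD: "s * D = y n - dot n y u" using xeq by (simp add: s(3) D_def dot_right algebra_simps)
  have vu: "D = dot n y v - dot n y u" by (simp add: D_def dot_right)
  show ?thesis
  proof (cases "D > 0")
    case True
    then have "0 < s * D" "s * D < D" using s by auto
    then have "live n y (u, v)" using s(4) sD vu by (auto simp: live_def)
    moreover have "s = (y n - dot n y u) / D" using sD True by (simp add: field_simps)
    then have "x = cand_point n y (u, v)" using s(3,4)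
        by (simp add: cand_point_def D_def[symmetric] algebra_simps)
    ultimately show ?thesis by blast
  next
    case False
    then have "D < 0" using \<open>D \<noteq> 0\<close> by simp
    then have "s * D < 0" "s * D > D" using s by (auto simp: mult_less_cancel_right mult_pos_neg)
    then have "live n y (v, u)" using s(4) sD vu by (auto simp: live_def)
    moreover have D': "dot n y (u - v) = - D" by (simp add: D_def dot_right)
    have "(1 - s) * (- D) = s * D - D" by (simp add: algebra_simps)
    then have "(1 - s) * (- D) = y n - dot n y v" using sD vu by simp
    then have "1 - s = (y n - dot n y v) / (- D)" using \<open>D < 0\<close> by (simp only: eq_divide_eq) simp
    moreover have "x = v + (1 - s) *\<^sub>R (u - v)" unfolding s(3) by (simp add: algebra_simps)
    ultimately have "x = cand_point n y (v, u)" using s(4) D' by (simp add: cand_point_def)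
    then show ?thesis using \<open>live n y (v, u)\<close> by blast
  qed
qed

text \<open>
  If \<open>x\<close> is not a vertex of the polytope, then the common kernel of its tight rows is nonzero, but
  the row of the cut reduces it to zero. So the kernel is a line, and the smallest face containing
  \<open>x\<close> is a segment.
\<close>

lemma extreme_of_cut_on_segment_face:
  assumes fin: "finite J" and nr: "no_ray (solutions n J)"
    and ext: "x extreme_point_of (solutions n J \<inter> halfspace n y)"
  shows "\<exists>(u, v)\<in>cands (solutions n J). x \<in> closed_segment u v"
proof (cases "x extreme_point_of solutions n J")
  case True
  then show ?thesis using cands_diag by force
next
  case False
  let ?J = "insert (y, y n) J"
  let ?K = "tight n J x"
  have xS: "x \<in> solutions n J" using ext by (auto simp: extreme_point_of_def)
  have xJ: "x \<in> solutions n ?J" using ext by (simp add: extreme_point_of_def solutions_cut)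
  have nrJ: "no_ray (solutions n ?J)" using nr by (rule no_ray_subset) (simp add: solutions_cut)
  have ker: "d = 0" if "d \<in> rspace n" "\<forall>p\<in>?K. dot n (fst p) d = 0" "dot n y d = 0" for d
  proof -
    have "\<forall>p\<in>tight n ?J x. dot n (fst p) d = 0" using that(2,3) by (auto simp: tight_def)
    then show ?thesis using extreme_point_iff_tight[of ?J n x] fin nrJ xJ ext that(1)
      by (simp add: solutions_cut)
  qed
  obtain d where d: "d \<in> rspace n" "\<forall>p\<in>?K. dot n (fst p) d = 0" "d \<noteq> 0"
    using extreme_point_iff_tight[OF fin nr xS] False by blast
  have yd: "dot n y d \<noteq> 0" using ker d by blast
  obtain s where s: "s > 0" "\<And>t. t \<ge> 0 \<Longrightarrow> x + t *\<^sub>R d \<in> solutions n J \<longleftrightarrow> t \<le> s"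
    using ray_exit[OF fin nr xS d(1,3)] d(2) by (metis order_refl)
  have "- d \<noteq> 0" "\<forall>p\<in>?K. dot n (fst p) (- d) = 0" using d(2,3) by (simp_all add: dot_right)
  then obtain s' where s': "s' > 0" "\<And>t. t \<ge> 0 \<Longrightarrow> x + t *\<^sub>R (- d) \<in> solutions n J \<longleftrightarrow> t \<le> s'"
    using ray_exit[OF fin nr xS rspace_uminus[OF d(1)]] by (metis order_refl)
  define u v where "u = x + s' *\<^sub>R (- d)" and "v = x + s *\<^sub>R d"
  define F where "F = {z \<in> solutions n J. ?K \<subseteq> tight n J z}"
  have F: "F face_of solutions n J" unfolding F_def by (rule face_of_tight)
  have "u \<in> solutions n J" "v \<in> solutions n J" using s s' by (auto simp: u_def v_def)
  moreover have "dot n (fst p) u = snd p" "dot n (fst p) v = snd p" if "p \<in> ?K" for p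
    using that d(2) by (auto simp: u_def v_def dot_right tight_def)
  ultimately have "u \<in> F" "v \<in> F" by (auto simp: F_def tight_def)
  then have sub1: "closed_segment u v \<subseteq> F" using F by (meson closed_segment_subset face_of_def)
  have comb: "x + c *\<^sub>R d \<in> closed_segment u v" if "- s' \<le> c" "c \<le> s" for c
  proof -
    define r where "r = (c + s') / (s + s')"
    have r: "0 \<le> r" "r \<le> 1" "r * (s + s') = c + s'" using that s(1) s'(1) by (auto simp: r_def)
    have "(1 - r) *\<^sub>R u + r *\<^sub>R v = x + (r * (s + s') - s') *\<^sub>R d"
      unfolding u_def v_def by (simp add: algebra_simps)
    then have "x + c *\<^sub>R d = (1 - r) *\<^sub>R u + r *\<^sub>R v" using r by simp
    then show ?thesis using r unfolding in_segment by blast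
  qed
  have "F \<subseteq> closed_segment u v"
  proof
    fix z assume z: "z \<in> F"
    define c where "c = dot n y (z - x) / dot n y d"
    have "z - x - c *\<^sub>R d = 0"
    proof (rule ker)
      show "z - x - c *\<^sub>R d \<in> rspace n"
        using z xS d(1) by (auto simp: F_def solutions_def intro!: rspace_intros)
      show "\<forall>p\<in>?K. dot n (fst p) (z - x - c *\<^sub>R d) = 0"
      proof
        fix p assume p: "p \<in> ?K"
        then have "p \<in> tight n J z" using z by (auto simp: F_def)
        then show "dot n (fst p) (z - x - c *\<^sub>R d) = 0" using p d(2) by (simp add: tight_def dot_right)
      qed
      show "dot n y (z - x - c *\<^sub>R d) = 0" using yd by (simp add: c_def dot_right)
    qed
    then have zc: "z = x + c *\<^sub>R d" by (simp add: algebra_simps)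
    have zS: "z \<in> solutions n J" using z by (simp add: F_def)
    have "c \<le> s" using s zS zc by (cases "c \<ge> 0") auto
    moreover have "- c \<le> s'" using s'(1) s'(2)[of "- c"] zS zc by (cases "c \<le> 0") auto
    ultimately show "z \<in> closed_segment u v" using comb zc by simp
  qed
  then have "F = closed_segment u v" using sub1 by blast
  then have "(u, v) \<in> cands (solutions n J)" using F by (simp add: cands_def)
  moreover have "x \<in> closed_segment u v" using comb[of 0] s(1) s'(1) by simp
  ultimately show ?thesis by blast
qed

theorem extreme_points_of_cut:
  assumes fin: "finite J" and nr: "no_ray (solutions n J)"
  shows "x extreme_point_of (solutions n J \<inter> halfspace n y) \<longleftrightarrow>
    (\<exists>k\<in>cands (solutions n J). live n y k \<and> x = cand_point n y k)"
proof
  assume x: "x extreme_point_of (solutions n J \<inter> halfspace n y)"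
  obtain u v where k: "(u, v) \<in> cands (solutions n J)" "x \<in> closed_segment u v"
    using extreme_of_cut_on_segment_face[OF fin nr x] by blast
  have "{(u, u), (v, v), (u, v), (v, u)} \<subseteq> cands (solutions n J)"
    using k(1) cands_ends(1,2)[OF k(1)] by (simp add: cands_diag cands_sym[of v u])
  then show "\<exists>k\<in>cands (solutions n J). live n y k \<and> x = cand_point n y k"
    using extreme_on_segment[OF k x] by blast
qed (use cand_point_extreme in blast)

text \<open>
  The sum \<open>g\<close> of the tight rows attains its maximum over the polytope only at the vertex \<open>x\<close>. Cut
  \<open>x\<close> off by a hyperplane \<open>g = \<delta>\<close> that leaves all other vertices on the far side: a maximum of \<open>g\<close>
  after the cut is not a vertex of the polytope, so it lies on an edge crossing the hyperplane,
  and that edge ends in \<open>x\<close>.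
\<close>

lemma edge_at_vertex:
  assumes fin: "finite J" and nr: "no_ray (solutions n J)"
    and x: "x extreme_point_of solutions n J" and w: "w \<in> solutions n J" "w \<noteq> x"
  shows "\<exists>v. v \<noteq> x \<and> (x, v) \<in> cands (solutions n J)"
proof -
  let ?S = "solutions n J" and ?K = "tight n J x"
  define g where "g = (\<lambda>i. \<Sum>p\<in>?K. fst p i)"
  have xS: "x \<in> ?S" using x by (simp add: extreme_point_of_def)
  have finK: "finite ?K" using fin by (simp add: tight_def)
  have g: "dot n g z = (\<Sum>p\<in>?K. dot n (fst p) z)" for z unfolding g_def by (rule dot_sum_left)
  have less: "dot n g z < dot n g x" if z: "z \<in> ?S" "z \<noteq> x" for z
  proof (rule ccontr)
    assume nl: "\<not> dot n g z < dot n g x"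
    have le: "dot n (fst p) z \<le> dot n (fst p) x" if "p \<in> ?K" for p
      using that z(1) by (auto simp: tight_def solutions_def)
    have "dot n (fst p) z = dot n (fst p) x" if "p \<in> ?K" for p
    proof (rule ccontr)
      assume "dot n (fst p) z \<noteq> dot n (fst p) x"
      then have "dot n (fst p) z < dot n (fst p) x" using le that by fastforce
      then have "dot n g z < dot n g x" unfolding g
        using le that finK by (intro sum_strict_mono_ex1) auto
      then show False using nl by simp
    qed
    then have "\<forall>p\<in>?K. dot n (fst p) (z - x) = 0" by (simp add: dot_right)
    moreover have "z - x \<in> rspace n" using z xS by (simp add: solutions_def rspace_intros)
    ultimately have "z - x = 0" using x extreme_point_iff_tight[OF fin nr xS] by blast
    then show False using z by simp
  qed
  define M where "M = {v. v extreme_point_of ?S \<and> v \<noteq> x}"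
  have "finite (cands ?S)" using card_cands card_segment_faces[OF fin nr order_refl] by blast
  moreover have "M \<subseteq> fst ` cands ?S"
  proof
    fix v assume "v \<in> M"
    then have "(v, v) \<in> cands ?S" by (simp add: M_def cands_diag)
    then show "v \<in> fst ` cands ?S" by force
  qed
  ultimately have finM: "finite M" by (meson finite_imageI finite_subset)
  obtain v where v: "v extreme_point_of ?S" "dot n (\<lambda>i. - g i) w \<le> dot n (\<lambda>i. - g i) v"
    using extreme_point_at_least[OF fin nr w(1)] by blast
  have "dot n (\<lambda>i. - g i) z = - dot n g z" for z by (simp add: dot_def sum_negf)
  then have "dot n g v < dot n g x" using v(2) less[OF w] by simp
  then have vM: "v \<in> M" using v(1) by (auto simp: M_def)
  define b where "b = Max (dot n g ` M)"
  have bM: "dot n g a \<le> b" if "a \<in> M" for a unfolding b_def using that finM by simp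
  have "b \<in> dot n g ` M" unfolding b_def using finM vM by (intro Max_in) auto
  then obtain a where a: "a \<in> M" "b = dot n g a" by blast
  then have "b < dot n g x" using less by (simp add: M_def extreme_point_of_def)
  then obtain \<delta> where \<delta>: "b < \<delta>" "\<delta> < dot n g x" using dense by blast
  define y where "y = g(n := \<delta>)"
  have y: "dot n y z = dot n g z" "y n = \<delta>" for z by (simp_all add: y_def dot_def)
  define r where "r = (\<delta> - dot n g a) / (dot n g x - dot n g a)"
  have r: "0 \<le> r" "r \<le> 1" "r * (dot n g x - dot n g a) = \<delta> - dot n g a"
    using \<delta> a by (auto simp: r_def)
  define q where "q = (1 - r) *\<^sub>R a + r *\<^sub>R x"
  have "a \<in> ?S" using a by (simp add: M_def extreme_point_of_def)
  then have "q \<in> ?S" using xS r convex_solutions[of n J] unfolding q_def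
    by (intro convexD) auto
  moreover have gq: "dot n g q = \<delta>" using r(3) by (simp add: q_def dot_right algebra_simps)
  ultimately have "q \<in> ?S \<inter> halfspace n y" by (simp add: halfspace_def y)
  then have q: "q \<in> solutions n (insert (y, y n) J)" by (simp only: solutions_cut)
  have "no_ray (solutions n (insert (y, y n) J))"
    using nr by (rule no_ray_subset) (simp add: solutions_cut)
  then obtain p where p: "p extreme_point_of (?S \<inter> halfspace n y)" "\<delta> \<le> dot n g p"
    using extreme_point_at_least[OF _ _ q, of g] fin gq unfolding solutions_cut by auto
  then have gp: "dot n g p = \<delta>" by (simp add: extreme_point_of_def halfspace_def y)
  obtain c d where cd: "(c, d) \<in> cands ?S" "live n y (c, d)" "p = cand_point n y (c, d)"
    using extreme_points_of_cut[OF fin nr] p(1) by auto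
  have ne: "dot n g z \<noteq> \<delta>" if "z extreme_point_of ?S" for z
    using that bM[of z] \<delta> by (cases "z = x") (auto simp: M_def)
  have "c \<noteq> d" using cd(3) gp ne[OF cands_ends(1)[OF cd(1)]] by (auto simp: cand_point_def)
  then have c: "dot n g c < \<delta>" "\<delta> < dot n g d" using cd(2) by (auto simp: live_def y)
  have "d = x"
  proof (rule ccontr)
    assume "d \<noteq> x"
    then have "d \<in> M" using cands_ends(2)[OF cd(1)] by (simp add: M_def)
    then show False using bM c \<delta> by fastforce
  qed
  then show ?thesis using cd(1) \<open>c \<noteq> d\<close> cands_sym by blast
qed

section \<open>Polynomial functions and their signs on components\<close>


definition monomial :: "(nat \<Rightarrow>\<^sub>0 nat) \<Rightarrow> vector \<Rightarrow> real" where
  "monomial m x = (\<Prod>i\<in>Poly_Mapping.keys m. x i ^ Poly_Mapping.lookup m i)"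

definition monomial_degree :: "(nat \<Rightarrow>\<^sub>0 nat) \<Rightarrow> nat" where
  "monomial_degree m = (\<Sum>i\<in>Poly_Mapping.keys m. Poly_Mapping.lookup m i)"

text \<open>
  Closure of polynomials under sums and products is easier to use for the functions they define
  than for finitely supported coefficient maps.
\<close>

definition polyfun :: "nat \<Rightarrow> nat \<Rightarrow> (vector \<Rightarrow> real) \<Rightarrow> bool" where
  "polyfun k d f \<longleftrightarrow> (\<exists>p :: real_mpoly.
     (\<forall>m\<in>Poly_Mapping.keys p. Poly_Mapping.keys m \<subseteq> {..<k} \<and> monomial_degree m \<le> d) \<and> mpoly_eval p = f)"

lemma polyfun_hypersurface:
  "polyfun k d f \<Longrightarrow> polynomial_hypersurface k d {y \<in> rspace k. f y = 0}"
  unfolding polynomial_hypersurface_def polyfun_def monomial_degree_def by blast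

lemma monomial_superset:
  assumes "finite A" "Poly_Mapping.keys m \<subseteq> A"
  shows "monomial m x = (\<Prod>i\<in>A. x i ^ Poly_Mapping.lookup m i)"
  unfolding monomial_def using assms by (intro prod.mono_neutral_left) (auto simp: in_keys_iff)

lemma monomial_degree_superset:
  assumes "finite A" "Poly_Mapping.keys m \<subseteq> A"
  shows "monomial_degree m = (\<Sum>i\<in>A. Poly_Mapping.lookup m i)"
  unfolding monomial_degree_def using assms by (intro sum.mono_neutral_left) (auto simp: in_keys_iff)

lemma monomial_plus: "monomial (m + m') x = monomial m x * monomial m' x"
  and monomial_degree_plus: "monomial_degree (m + m') = monomial_degree m + monomial_degree m'"
proof -
  let ?A = "Poly_Mapping.keys m \<union> Poly_Mapping.keys m'"
  have A: "finite ?A" "Poly_Mapping.keys (m + m') \<subseteq> ?A" by (auto simp: Poly_Mapping.keys_add)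
  show "monomial (m + m') x = monomial m x * monomial m' x"
    using A by (simp add: monomial_superset[of ?A] lookup_add power_add prod.distrib)
  show "monomial_degree (m + m') = monomial_degree m + monomial_degree m'"
    using A by (simp add: monomial_degree_superset[of ?A] lookup_add sum.distrib)
qed

lemma mpoly_eval_superset:
  assumes "finite A" "Poly_Mapping.keys p \<subseteq> A"
  shows "mpoly_eval p x = (\<Sum>m\<in>A. Poly_Mapping.lookup p m * monomial m x)"
  unfolding mpoly_eval_def monomial_def[symmetric] using assms
  by (intro sum.mono_neutral_left) (auto simp: in_keys_iff)

lemma polyfun_add:
  assumes "polyfun k d f" "polyfun k d g"
  shows "polyfun k d (\<lambda>y. f y + g y)"
proof -
  obtain p q where p: "\<forall>m\<in>Poly_Mapping.keys p. Poly_Mapping.keys m \<subseteq> {..<k} \<and> monomial_degree m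
      \<le> d" "mpoly_eval p = f"
    and q: "\<forall>m\<in>Poly_Mapping.keys q. Poly_Mapping.keys m \<subseteq> {..<k} \<and> monomial_degree m \<le> d"
        "mpoly_eval q = g"
    using assms unfolding polyfun_def by blast
  let ?A = "Poly_Mapping.keys p \<union> Poly_Mapping.keys q"
  have A: "finite ?A" "Poly_Mapping.keys (p + q) \<subseteq> ?A" by (auto simp: Poly_Mapping.keys_add)
  have "mpoly_eval (p + q) y = mpoly_eval p y + mpoly_eval q y" for y
    using A by (simp add: mpoly_eval_superset[of ?A] lookup_add distrib_right sum.distrib)
  then have "mpoly_eval (p + q) = (\<lambda>y. f y + g y)" using p(2) q(2) by auto
  moreover have "\<forall>m\<in>Poly_Mapping.keys (p + q). Poly_Mapping.keys m \<subseteq> {..<k} \<and> monomial_degree m \<le> d"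
    using A(2) p(1) q(1) by blast
  ultimately show ?thesis unfolding polyfun_def by blast
qed

lemma polyfun_monom:
  assumes "Poly_Mapping.keys m \<subseteq> {..<k}" "monomial_degree m \<le> d"
  shows "polyfun k d (\<lambda>y. c * monomial m y)"
proof -
  let ?p = "Poly_Mapping.single m c :: real_mpoly"
  have "mpoly_eval ?p = (\<lambda>y. c * monomial m y)"
    by (cases "c = 0") (auto simp: mpoly_eval_def monomial_def fun_eq_iff)
  moreover have "Poly_Mapping.keys ?p \<subseteq> {m}" by simp
  ultimately show ?thesis using assms unfolding polyfun_def by blast
qed

lemma polyfun_0: "polyfun k d (\<lambda>y. 0)"
  unfolding polyfun_def by (rule exI[of _ 0]) (auto simp: mpoly_eval_def)

lemma polyfun_sum:
  assumes "\<And>i. i \<in> A \<Longrightarrow> polyfun k d (f i)"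
  shows "polyfun k d (\<lambda>y. \<Sum>i\<in>A. f i y)"
  using assms by (induction A rule: infinite_finite_induct) (auto simp: polyfun_0 polyfun_add)

lemma polyfun_mult:
  assumes "polyfun k d f" "polyfun k e g"
  shows "polyfun k (d + e) (\<lambda>y. f y * g y)"
proof -
  obtain p q where p: "\<forall>m\<in>Poly_Mapping.keys p. Poly_Mapping.keys m \<subseteq> {..<k} \<and> monomial_degree m
      \<le> d" "mpoly_eval p = f"
    and q: "\<forall>m\<in>Poly_Mapping.keys q. Poly_Mapping.keys m \<subseteq> {..<k} \<and> monomial_degree m \<le> e"
        "mpoly_eval q = g"
    using assms unfolding polyfun_def by blast
  have "f y * g y = (\<Sum>m\<in>Poly_Mapping.keys p. \<Sum>m'\<in>Poly_Mapping.keys q.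
      (Poly_Mapping.lookup p m * Poly_Mapping.lookup q m') * monomial (m + m') y)" for y
    by (simp add: p(2)[symmetric] q(2)[symmetric] mpoly_eval_def monomial_def[symmetric] sum_product
        monomial_plus mult_ac)
  moreover have "polyfun k (d + e) (\<lambda>y. (Poly_Mapping.lookup p m * Poly_Mapping.lookup q m') *
      monomial (m + m') y)"
    if "m \<in> Poly_Mapping.keys p" "m' \<in> Poly_Mapping.keys q" for m m'
  proof (rule polyfun_monom)
    show "Poly_Mapping.keys (m + m') \<subseteq> {..<k}"
      using Poly_Mapping.keys_add[of m m'] that p(1) q(1) by blast
    show "monomial_degree (m + m') \<le> d + e" using that p(1) q(1)
        by (simp add: monomial_degree_plus add_mono)
  qed
  ultimately show ?thesis by (auto intro!: polyfun_sum)
qed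

lemma polyfun_const: "polyfun k d (\<lambda>y. c)"
  using polyfun_monom[of 0 k d c] by (simp add: monomial_def monomial_degree_def)

lemma polyfun_var: "i < k \<Longrightarrow> polyfun k 1 (\<lambda>y. y i)"
  using polyfun_monom[of "Poly_Mapping.single i 1" k 1 1]
      by (simp add: monomial_def monomial_degree_def)

lemma polyfun_weaken: "polyfun k d f \<Longrightarrow> d \<le> e \<Longrightarrow> polyfun k e f"
  unfolding polyfun_def by (metis order_trans)

lemma polyfun_scale: "polyfun k d f \<Longrightarrow> polyfun k d (\<lambda>y. c * f y)"
  using polyfun_mult[OF polyfun_const[of k 0 c], of d f] by simp

lemma polyfun_diff:
  assumes "polyfun k d f" "polyfun k d g"
  shows "polyfun k d (\<lambda>y. f y - g y)"
  using polyfun_add[OF assms(1) polyfun_scale[OF assms(2), of "-1"]] by simp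

lemma polyfun_dot: "n \<le> k \<Longrightarrow> polyfun k 1 (\<lambda>y. dot n y x)"
  unfolding dot_def
proof (rule polyfun_sum)
  fix i assume "n \<le> k" "i \<in> {..<n}"
  then show "polyfun k 1 (\<lambda>y. y i * x i)"
    using polyfun_scale[OF polyfun_var[of i k], of "x i"] by (simp add: mult.commute)
qed

lemma continuous_on_mpoly_eval: "continuous_on UNIV (mpoly_eval p)"
  unfolding mpoly_eval_def
  by (intro continuous_intros continuous_on_product_coordinates)

lemma connectedin_Euclidean_space_imp_connected:
  "connectedin (Euclidean_space k) D \<Longrightarrow> connected D"
  by (simp add: Euclidean_space_def connectedin_subtopology euclidean_product_topology)

text \<open>
  The polynomial is either zero on the whole component or nowhere zero on it; in the second case
  the intermediate value theorem applies.
\<close>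

lemma sgn_constant_on_component:
  assumes D: "D \<in> partition_components k H" and f: "polyfun k d f"
    and H: "{y \<in> rspace k. f y = 0} \<in> H" and y: "y \<in> D" "y' \<in> D"
  shows "sgn (f y) = sgn (f y')"
proof -
  have un: "unsplit_connected k H D" using D by (simp add: partition_components_def)
  have sub: "D \<subseteq> rspace k" using un by (auto simp: unsplit_connected_def dest:
      connectedin_subset_topspace)
  have conn: "connected D" using un connectedin_Euclidean_space_imp_connected
    by (auto simp: unsplit_connected_def)
  have "D \<subseteq> {y \<in> rspace k. f y = 0} \<or> D \<inter> {y \<in> rspace k. f y = 0} = {}"
    using un H by (auto simp: unsplit_connected_def)
  then show ?thesis
  proof
    assume "D \<subseteq> {y \<in> rspace k. f y = 0}"
    then have "f y = 0" "f y' = 0" using y by blast+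
    then show ?thesis by simp
  next
    assume "D \<inter> {y \<in> rspace k. f y = 0} = {}"
    then have nz: "0 \<notin> f ` D" using sub by force
    have "continuous_on D f"
      using f continuous_on_mpoly_eval continuous_on_subset unfolding polyfun_def by blast
    then have "connected (f ` D)" using conn by (rule connected_continuous_image)
    then have iv: "a \<in> f ` D \<Longrightarrow> b \<in> f ` D \<Longrightarrow> a \<le> 0 \<Longrightarrow> 0 \<le> b \<Longrightarrow> 0 \<in> f ` D" for a b
      unfolding connected_iff_interval by blast
    have "f y \<in> f ` D" "f y' \<in> f ` D" using y by blast+
    then show ?thesis using iv[of "f y" "f y'"] iv[of "f y'" "f y"] nz
      by (auto simp: sgn_if not_less)
  qed
qed

section \<open>Node regions, their candidates and their number\<close>


text \<open>
  Nonnegativity is the lower bound 0 and \<open>tau I\<close> is a redundant upper bound, so that any set of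
  branching constraints leads to one lower and one upper bound for each variable. This gives
  \<open>nconstrs I + 2 * nvars I\<close> rows.
\<close>

definition box_rows :: "ip \<Rightarrow> (nat \<Rightarrow> int) \<Rightarrow> (nat \<Rightarrow> int) \<Rightarrow> (vector \<times> real) set" where
  "box_rows I l u =
     (\<lambda>r. (\<lambda>i. real_of_int (lhs I r i), real_of_int (rhs I r))) ` {..<nconstrs I} \<union>
     (\<lambda>i. (\<lambda>j. if j = i then -1 else 0, - real_of_int (l i))) ` {..<nvars I} \<union>
     (\<lambda>i. (\<lambda>j. if j = i then 1 else 0, real_of_int (u i))) ` {..<nvars I}"

abbreviation box_region :: "ip \<Rightarrow> (nat \<Rightarrow> int) \<Rightarrow> (nat \<Rightarrow> int) \<Rightarrow> vector set" where
  "box_region I l u \<equiv> solutions (nvars I) (box_rows I l u)"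

lemma dot_unit: "i < n \<Longrightarrow> dot n (\<lambda>j. if j = i then c else 0) x = c * x i"
  by (simp add: dot_def if_distribR if_distrib[of "\<lambda>c. c * _"] sum.delta cong: if_cong)

lemma mem_box_region:
  "x \<in> box_region I l u \<longleftrightarrow> x \<in> rspace (nvars I) \<and>
     (\<forall>r<nconstrs I. (\<Sum>i<nvars I. real_of_int (lhs I r i) * x i) \<le> real_of_int (rhs I r)) \<and>
     (\<forall>i<nvars I. real_of_int (l i) \<le> x i \<and> x i \<le> real_of_int (u i))"
proof -
  have "(\<forall>p\<in>box_rows I l u. dot (nvars I) (fst p) x \<le> snd p) \<longleftrightarrow>
     (\<forall>r<nconstrs I. (\<Sum>i<nvars I. real_of_int (lhs I r i) * x i) \<le> real_of_int (rhs I r)) \<and>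
     (\<forall>i<nvars I. real_of_int (l i) \<le> x i) \<and> (\<forall>i<nvars I. x i \<le> real_of_int (u i))"
    unfolding box_rows_def ball_Un ball_simps by (simp add: dot_unit Ball_def) (simp add: dot_def)
  then show ?thesis by (auto simp: solutions_def)
qed

lemma finite_box_rows: "finite (box_rows I l u)"
  by (simp add: box_rows_def)

lemma card_box_rows: "card (box_rows I l u) \<le> nconstrs I + 2 * nvars I"
proof -
  have "card (f ` {..<k}) \<le> k" for f :: "nat \<Rightarrow> vector \<times> real" and k
    using card_image_le[of "{..<k}" f] by simp
  then show ?thesis unfolding box_rows_def mult_2 add.assoc[symmetric]
    by (intro order_trans[OF card_Un_le] add_mono) auto
qed

lemma lp_region_bounds:
  assumes P: "ip_polytope I" and x: "x \<in> lp_region I" and i: "i < nvars I"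
  shows "0 \<le> x i" "x i \<le> real_of_int (tau I)"
proof -
  show "0 \<le> x i" using x i by (simp add: lp_region_def)
  have "x i \<le> sup_norm (nvars I) x"
    unfolding sup_norm_def using i by (intro order_trans[OF abs_ge_self Max_ge]) auto
  also have "\<dots> \<le> (SUP x\<in>lp_region I. sup_norm (nvars I) x)"
    using P x by (intro cSUP_upper) (auto simp: ip_polytope_def)
  also have "\<dots> \<le> real_of_int (tau I)" unfolding tau_def by (rule le_of_int_ceiling)
  finally show "x i \<le> real_of_int (tau I)" .
qed

lemma tau_nonneg:
  assumes P: "ip_polytope I"
  shows "0 \<le> tau I"
proof -
  obtain x where x: "x \<in> lp_region I" using P by (auto simp: ip_polytope_def)
  have "0 \<le> sup_norm (nvars I) x" unfolding sup_norm_def by (intro Max_ge) auto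
  also have "\<dots> \<le> (SUP x\<in>lp_region I. sup_norm (nvars I) x)"
    using P x by (intro cSUP_upper) (auto simp: ip_polytope_def)
  finally show ?thesis unfolding tau_def by linarith
qed

lemma no_ray_lp_region:
  assumes P: "ip_polytope I"
  shows "no_ray (lp_region I)"
  unfolding no_ray_def
proof (intro ballI allI impI, rule ccontr)
  fix x d assume x: "x \<in> lp_region I" and d: "d \<noteq> (0 :: vector)"
    and "\<not> (\<exists>t\<ge>0. x + t *\<^sub>R d \<notin> lp_region I)"
  then have ray: "x + t *\<^sub>R d \<in> lp_region I" if "t \<ge> 0" for t using that by blast
  obtain i where i: "d i \<noteq> 0" using d by (auto simp: fun_eq_iff)
  have "i < nvars I"
  proof (rule ccontr)
    assume "\<not> i < nvars I"
    then have "x i = 0" "(x + 1 *\<^sub>R d) i = 0"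
      using x ray[of 1] by (auto simp: lp_region_def rspace_iff)
    then show False using i by simp
  qed
  define t where "t = (\<bar>x i\<bar> + real_of_int (tau I) + 1) / \<bar>d i\<bar>"
  have "t \<ge> 0" using tau_nonneg[OF P] by (simp add: t_def)
  have "0 \<le> (x + t *\<^sub>R d) i" "(x + t *\<^sub>R d) i \<le> real_of_int (tau I)"
    using lp_region_bounds[OF P ray[OF \<open>t \<ge> 0\<close>] \<open>i < nvars I\<close>] .
  moreover have "\<bar>t * d i\<bar> = \<bar>x i\<bar> + real_of_int (tau I) + 1"
    using i tau_nonneg[OF P] by (simp add: t_def abs_mult)
  ultimately show False using lp_region_bounds(1)[OF P x \<open>i < nvars I\<close>] by simp
qed

lemma no_ray_box_region:
  assumes P: "ip_polytope I" and l: "\<And>i. i < nvars I \<Longrightarrow> 0 \<le> l i"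
  shows "no_ray (box_region I l u)"
proof (rule no_ray_subset[OF no_ray_lp_region[OF P]])
  show "box_region I l u \<subseteq> lp_region I"
  proof
    fix x assume x: "x \<in> box_region I l u"
    have "0 \<le> x i" if "i < nvars I" for i
    proof -
      have "0 \<le> real_of_int (l i)" using l[OF that] by simp
      also have "\<dots> \<le> x i" using x that by (simp add: mem_box_region)
      finally show ?thesis .
    qed
    then show "x \<in> lp_region I" using x by (simp add: mem_box_region lp_region_def)
  qed
qed

definition box_bounds :: "ip \<Rightarrow> (nat \<Rightarrow> int) set" where
  "box_bounds I = PiE {..<nvars I} (\<lambda>_. {0..tau I})"

text \<open>
  The candidates of every region that a node can have, whatever the cut.
\<close>

definition all_cands :: "ip \<Rightarrow> (vector \<times> vector) set" where
  "all_cands I = (\<Union>(l, u)\<in>box_bounds I \<times> box_bounds I. cands (box_region I l u))"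

lemma finite_all_cands_and_card:
  assumes P: "ip_polytope I"
  shows "finite (all_cands I) \<and> card (all_cands I) \<le>
    (nat (tau I) + 1) ^ (2 * nvars I) * (2 * (nconstrs I + 2 * nvars I + 1) ^ nvars I)"
proof -
  let ?B = "box_bounds I \<times> box_bounds I"
  let ?K = "2 * (nconstrs I + 2 * nvars I + 1) ^ nvars I"
  have finB: "finite ?B" by (simp add: box_bounds_def finite_PiE)
  have "card (box_bounds I) = (nat (tau I) + 1) ^ nvars I"
    using tau_nonneg[OF P] by (simp add: box_bounds_def card_PiE nat_add_distrib)
  then have cardB: "card ?B = (nat (tau I) + 1) ^ (2 * nvars I)"
    by (simp add: card_cartesian_product power_add mult_2)
  have each: "finite (cands (box_region I l u)) \<and> card (cands (box_region I l u)) \<le> ?K"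
    if "(l, u) \<in> ?B" for l u
  proof -
    have "0 \<le> l i" if "i < nvars I" for i
      using \<open>(l, u) \<in> ?B\<close> that PiE_mem[of l "{..<nvars I}" _ i] by (auto simp: box_bounds_def)
    then have nr: "no_ray (box_region I l u)" by (rule no_ray_box_region[OF P])
    show ?thesis
      using card_cands card_segment_faces[OF finite_box_rows nr card_box_rows]
      by (meson mult_le_mono2 order_trans)
  qed
  then have "card (all_cands I) \<le> (\<Sum>(l, u)\<in>?B. card (cands (box_region I l u)))"
    unfolding all_cands_def using card_UN_le[OF finB, of "\<lambda>(l, u). cands (box_region I l u)"]
    by (simp add: case_prod_beta')
  also have "\<dots> \<le> (\<Sum>(l, u)\<in>?B. ?K)" using each by (intro sum_mono) auto
  also have "\<dots> = card ?B * ?K" by simp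
  finally have "card (all_cands I) \<le> card ?B * ?K" .
  moreover have "finite (all_cands I)" unfolding all_cands_def using finB each
      by (intro finite_UN_I) auto
  ultimately show ?thesis using cardB by simp
qed

lemma cands_box_subset:
  assumes "\<And>i. i < nvars I \<Longrightarrow> l i \<in> {0..tau I} \<and> u i \<in> {0..tau I}"
  shows "cands (box_region I l u) \<subseteq> all_cands I"
proof -
  let ?l = "restrict l {..<nvars I}" and ?u = "restrict u {..<nvars I}"
  have "box_region I l u = box_region I ?l ?u" by (rule set_eqI) (simp add: mem_box_region)
  moreover have "(?l, ?u) \<in> box_bounds I \<times> box_bounds I" using assms by (simp add: box_bounds_def)
  ultimately show ?thesis unfolding all_cands_def by force
qed

definition lower_bound :: "branching set \<Rightarrow> nat \<Rightarrow> int" where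
  "lower_bound \<sigma> i = Max (insert 0 {k. Lower i k \<in> \<sigma>})"

definition upper_bound :: "ip \<Rightarrow> branching set \<Rightarrow> nat \<Rightarrow> int" where
  "upper_bound I \<sigma> i = Min (insert (tau I) {k. Upper i k \<in> \<sigma>})"

lemma mem_branching_constraints:
  "Upper i k \<in> branching_constraints I \<longleftrightarrow> i < nvars I \<and> 0 \<le> k \<and> k \<le> tau I"
  "Lower i k \<in> branching_constraints I \<longleftrightarrow> i < nvars I \<and> 0 \<le> k \<and> k \<le> tau I"
  by (auto simp: branching_constraints_def)

lemma node_region_box:
  assumes P: "ip_polytope I" and \<sigma>: "\<sigma> \<subseteq> branching_constraints I"
  shows "node_region I \<sigma> = box_region I (lower_bound \<sigma>) (upper_bound I \<sigma>)"
    and "\<And>i. lower_bound \<sigma> i \<in> {0..tau I}" "\<And>i. upper_bound I \<sigma> i \<in> {0..tau I}"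
proof -
  have sub: "{k. Lower i k \<in> \<sigma>} \<subseteq> {0..tau I}" "{k. Upper i k \<in> \<sigma>} \<subseteq> {0..tau I}" for i
    using \<sigma> mem_branching_constraints by fastforce+
  have fin: "finite {k. Lower i k \<in> \<sigma>}" "finite {k. Upper i k \<in> \<sigma>}" for i
    using finite_subset[OF sub(1)] finite_subset[OF sub(2)] by simp_all
  have lo_in: "lower_bound \<sigma> i \<in> insert 0 {k. Lower i k \<in> \<sigma>}" for i
    unfolding lower_bound_def using fin by (intro Max_in) auto
  have up_in: "upper_bound I \<sigma> i \<in> insert (tau I) {k. Upper i k \<in> \<sigma>}" for i
    unfolding upper_bound_def using fin by (intro Min_in) auto
  show "lower_bound \<sigma> i \<in> {0..tau I}" "upper_bound I \<sigma> i \<in> {0..tau I}" for i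
    using lo_in[of i] up_in[of i] sub[of i] tau_nonneg[OF P] by auto
  have lo_ge: "k \<le> lower_bound \<sigma> i" if "Lower i k \<in> \<sigma> \<or> k = 0" for i k
    unfolding lower_bound_def using fin that by (intro Max_ge) auto
  have up_le: "upper_bound I \<sigma> i \<le> k" if "Upper i k \<in> \<sigma> \<or> k = tau I" for i k
    unfolding upper_bound_def using fin that by (intro Min_le) auto
  show "node_region I \<sigma> = box_region I (lower_bound \<sigma>) (upper_bound I \<sigma>)"
  proof (intro equalityI subsetI)
    fix x assume x: "x \<in> node_region I \<sigma>"
    then have xP: "x \<in> lp_region I" by (simp add: node_region_def)
    have "real_of_int (lower_bound \<sigma> i) \<le> x i \<and> x i \<le> real_of_int (upper_bound I \<sigma> i)" if i:
        "i < nvars I" for i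
    proof
      show "real_of_int (lower_bound \<sigma> i) \<le> x i"
        using lo_in[of i] lp_region_bounds(1)[OF P xP i] x by (auto simp: node_region_def)
      show "x i \<le> real_of_int (upper_bound I \<sigma> i)"
        using up_in[of i] lp_region_bounds(2)[OF P xP i] x by (auto simp: node_region_def)
    qed
    then show "x \<in> box_region I (lower_bound \<sigma>) (upper_bound I \<sigma>)" using xP
        by (simp add: mem_box_region lp_region_def)
  next
    fix x assume x: "x \<in> box_region I (lower_bound \<sigma>) (upper_bound I \<sigma>)"
    have b: "real_of_int (lower_bound \<sigma> i) \<le> x i" "x i \<le> real_of_int (upper_bound I \<sigma> i)" if
        "i < nvars I" for i
      using x that by (simp_all add: mem_box_region)
    have "0 \<le> x i" if "i < nvars I" for i
      using b(1)[OF that] lo_ge[of i 0] by (simp add: order_trans[of 0 "real_of_int (lower_bound \<sigma> i)"])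
    moreover have "satisfies x \<kappa>" if "\<kappa> \<in> \<sigma>" for \<kappa>
    proof (cases \<kappa>)
      case (Upper i k)
      then have "i < nvars I" using that \<sigma> mem_branching_constraints by blast
      moreover have "real_of_int (upper_bound I \<sigma> i) \<le> real_of_int k" using up_le that Upper by simp
      ultimately show ?thesis using b(2) Upper by fastforce
    next
      case (Lower i k)
      then have "i < nvars I" using that \<sigma> mem_branching_constraints by blast
      moreover have "real_of_int k \<le> real_of_int (lower_bound \<sigma> i)" using lo_ge that Lower by simp
      ultimately show ?thesis using b(1) Lower by fastforce
    qed
    ultimately show "x \<in> node_region I \<sigma>" using x
        by (simp add: node_region_def lp_region_def mem_box_region)
  qed
qed

lemma cands_node_region:
  assumes "ip_polytope I" "\<sigma> \<subseteq> branching_constraints I"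
  shows "cands (node_region I \<sigma>) \<subseteq> all_cands I"
  using node_region_box[OF assms] cands_box_subset by simp

text \<open>
  An integral point is the only point of the region in which every variable is fixed to its value.
  Therefore the sign conditions on candidates decide whether a cut is valid.
\<close>

lemma integral_point_cand:
  assumes P: "ip_polytope I" and x: "x \<in> lp_region I" "integral_point I x"
  shows "(x, x) \<in> all_cands I"
proof -
  let ?l = "\<lambda>i. \<lfloor>x i\<rfloor>"
  have fl: "real_of_int \<lfloor>x i\<rfloor> = x i" if "i < nvars I" for i
    using x(2) that by (auto simp: integral_point_def Ints_def)
  have "z = x" if "z \<in> box_region I ?l ?l" for z
  proof
    fix i show "z i = x i"
      using that x(1) fl by (cases "i < nvars I")
          (fastforce simp: mem_box_region lp_region_def rspace_iff)+
  qed
  moreover have "x \<in> box_region I ?l ?l" using x by (simp add: mem_box_region lp_region_def fl)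
  ultimately have "box_region I ?l ?l = {x}" by blast
  then have "x extreme_point_of box_region I ?l ?l" by (simp add: extreme_point_of_def)
  moreover have "cands (box_region I ?l ?l) \<subseteq> all_cands I"
  proof (rule cands_box_subset)
    fix i assume i: "i < nvars I"
    have "0 \<le> real_of_int \<lfloor>x i\<rfloor>" "real_of_int \<lfloor>x i\<rfloor> \<le> real_of_int (tau I)"
      unfolding fl[OF i] using lp_region_bounds[OF P x(1) i] by simp_all
    then show "\<lfloor>x i\<rfloor> \<in> {0..tau I} \<and> \<lfloor>x i\<rfloor> \<in> {0..tau I}" by simp
  qed
  ultimately show ?thesis using cands_diag by blast
qed

lemma cut_region_halfspace: "cut_region I y \<sigma> = node_region I \<sigma> \<inter> halfspace (nvars I) y"
  by (auto simp: cut_region_def cut_holds_def halfspace_def)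

definition cand_value :: "ip \<Rightarrow> vector \<Rightarrow> vector \<times> vector \<Rightarrow> real" where
  "cand_value I y k = dot (nvars I) (objective I) (cand_point (nvars I) y k)"

text \<open>
  These candidates stand for the optimal vertices of the cut region. Unlike the vertices
  themselves, they can be the same for different cuts.
\<close>

definition best_cands :: "ip \<Rightarrow> vector \<Rightarrow> branching set \<Rightarrow> (vector \<times> vector) set" where
  "best_cands I y \<sigma> = {k\<in>cands (node_region I \<sigma>). live (nvars I) y k \<and>
     (\<forall>k'\<in>cands (node_region I \<sigma>). live (nvars I) y k' \<longrightarrow> cand_value I y k' \<le> cand_value I y k)}"

definition edge_cands :: "vector \<Rightarrow> vector \<Rightarrow> (vector \<times> vector) set" where
  "edge_cands u v = {(u, u), (v, v), (u, v), (v, u)}"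

context
  fixes I :: ip and \<sigma> :: "branching set"
  assumes P: "ip_polytope I" and \<sigma>: "\<sigma> \<subseteq> branching_constraints I"
begin

lemma node_no_ray: "no_ray (box_region I (lower_bound \<sigma>) (upper_bound I \<sigma>))"
  using no_ray_box_region[OF P, of "lower_bound \<sigma>"] node_region_box(2)[OF P \<sigma>] by simp

lemma finite_node_cands: "finite (cands (node_region I \<sigma>))"
  using finite_subset[OF cands_node_region[OF P \<sigma>]] finite_all_cands_and_card[OF P] by simp

lemma extreme_cut_region:
  "x extreme_point_of cut_region I y \<sigma> \<longleftrightarrow>
     (\<exists>k\<in>cands (node_region I \<sigma>). live (nvars I) y k \<and> x = cand_point (nvars I) y k)"
  unfolding cut_region_halfspace node_region_box(1)[OF P \<sigma>]
  by (rule extreme_points_of_cut[OF finite_box_rows node_no_ray])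

lemma live_cand_at_least:
  assumes "x \<in> cut_region I y \<sigma>"
  shows "\<exists>k\<in>cands (node_region I \<sigma>). live (nvars I) y k \<and> dot (nvars I) (objective I) x
      \<le> cand_value I y k"
proof -
  let ?J = "insert (y, y (nvars I)) (box_rows I (lower_bound \<sigma>) (upper_bound I \<sigma>))"
  have eq: "cut_region I y \<sigma> = solutions (nvars I) ?J"
    by (simp only: solutions_cut cut_region_halfspace node_region_box(1)[OF P \<sigma>])
  have "no_ray (solutions (nvars I) ?J)"
    using node_no_ray by (rule no_ray_subset) (simp add: solutions_cut)
  then obtain v where v: "v extreme_point_of cut_region I y \<sigma>"
    "dot (nvars I) (objective I) x \<le> dot (nvars I) (objective I) v"
    using extreme_point_at_least[of ?J "nvars I" x "objective I"] assms finite_box_rows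
    unfolding eq by blast
  then show ?thesis using extreme_cut_region unfolding cand_value_def by metis
qed

lemma best_nonempty_iff: "best_cands I y \<sigma> \<noteq> {} \<longleftrightarrow> cut_region I y \<sigma> \<noteq> {}"
proof
  assume "best_cands I y \<sigma> \<noteq> {}"
  then obtain k where "k \<in> cands (node_region I \<sigma>)" "live (nvars I) y k" by (auto simp: best_cands_def)
  then show "cut_region I y \<sigma> \<noteq> {}" using cand_point_in_cut unfolding cut_region_halfspace by blast
next
  let ?L = "{k\<in>cands (node_region I \<sigma>). live (nvars I) y k}"
  assume "cut_region I y \<sigma> \<noteq> {}"
  then have "?L \<noteq> {}" using live_cand_at_least by blast
  moreover have "finite ?L" using finite_node_cands by simp
  ultimately have max: "Max (cand_value I y ` ?L) \<in> cand_value I y ` ?L" "\<And>k'. k' \<in> ?L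
      \<Longrightarrow> cand_value I y k' \<le> Max (cand_value I y ` ?L)"
    by (simp_all del: Collect_empty_eq)
  from max(1) obtain k where k: "k \<in> ?L" "Max (cand_value I y ` ?L) = cand_value I y k" by blast
  then have "\<And>k'. k' \<in> ?L \<Longrightarrow> cand_value I y k' \<le> cand_value I y k" using max(2) by simp
  then show "best_cands I y \<sigma> \<noteq> {}" using k(1) unfolding best_cands_def by blast
qed

lemma best_is_optimal:
  assumes "k \<in> best_cands I y \<sigma>" "x \<in> cut_region I y \<sigma>"
  shows "dot (nvars I) (objective I) x \<le> cand_value I y k"
proof -
  obtain k' where "k' \<in> cands (node_region I \<sigma>)" "live (nvars I) y k'"
    "dot (nvars I) (objective I) x \<le> cand_value I y k'"
    using live_cand_at_least[OF assms(2)] by blast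
  moreover from this have "cand_value I y k' \<le> cand_value I y k" using assms(1)
      by (simp add: best_cands_def)
  ultimately show ?thesis by linarith
qed

lemma best_in_cut_region: "k \<in> best_cands I y \<sigma> \<Longrightarrow> cand_point (nvars I) y k \<in> cut_region I y \<sigma>"
  using cand_point_in_cut unfolding best_cands_def cut_region_halfspace by blast

lemma optimal_vertices_best: "optimal_vertices I (cut_region I y \<sigma>)
    = cand_point (nvars I) y ` best_cands I y \<sigma>"
proof (intro equalityI subsetI)
  fix x assume x: "x \<in> optimal_vertices I (cut_region I y \<sigma>)"
  then obtain k where k: "k \<in> cands (node_region I \<sigma>)" "live (nvars I) y k" "x
      = cand_point (nvars I) y k"
    using extreme_cut_region by (auto simp: optimal_vertices_def)
  have "cand_value I y k' \<le> cand_value I y k" if "k' \<in> cands (node_region I \<sigma>)"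
      "live (nvars I) y k'" for k'
    using x cand_point_in_cut[OF that] k(3) by
        (auto simp: optimal_vertices_def cand_value_def cut_region_halfspace)
  then show "x \<in> cand_point (nvars I) y ` best_cands I y \<sigma>" using k by (auto simp: best_cands_def)
next
  fix x assume "x \<in> cand_point (nvars I) y ` best_cands I y \<sigma>"
  then obtain k where k: "k \<in> best_cands I y \<sigma>" "x = cand_point (nvars I) y k" by blast
  then have "x extreme_point_of cut_region I y \<sigma>" using extreme_cut_region
      by (auto simp: best_cands_def)
  then show "x \<in> optimal_vertices I (cut_region I y \<sigma>)"
    using best_is_optimal[OF k(1)] k(2) by (simp add: optimal_vertices_def cand_value_def)
qed

lemma lp_value_best:
  "lp_value I (cut_region I y \<sigma>) =
     (if best_cands I y \<sigma> = {} then -\<infinity> else ereal (cand_value I y (SOME k. k \<in> best_cands I y \<sigma>)))"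
proof (cases "best_cands I y \<sigma> = {}")
  case True
  then have "cut_region I y \<sigma> = {}" using best_nonempty_iff by blast
  then show ?thesis using True by (simp add: lp_value_def bot_ereal_def)
next
  case False
  define k where "k = (SOME k. k \<in> best_cands I y \<sigma>)"
  have k: "k \<in> best_cands I y \<sigma>" unfolding k_def using False by (simp add: some_in_eq)
  have "lp_value I (cut_region I y \<sigma>) = ereal (cand_value I y k)"
    unfolding lp_value_def
  proof (rule antisym)
    show "(SUP x\<in>cut_region I y \<sigma>. ereal (dot (nvars I) (objective I) x)) \<le> ereal (cand_value I y k)"
      using best_is_optimal[OF k] by (intro SUP_least) simp
    show "ereal (cand_value I y k) \<le> (SUP x\<in>cut_region I y \<sigma>. ereal (dot (nvars I) (objective I) x))"
      unfolding cand_value_def by (rule SUP_upper[OF best_in_cut_region[OF k]])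
  qed
  then show ?thesis using False by (simp add: k_def)
qed

lemma optimal_vertices_on_edge:
  assumes e: "(u, v) \<in> cands (node_region I \<sigma>)"
  shows "cand_point (nvars I) y ` best_cands I y \<sigma> \<inter> closed_segment u v
      = cand_point (nvars I) y ` (edge_cands u v \<inter> best_cands I y \<sigma>)"
proof (intro equalityI subsetI)
  fix x assume x: "x \<in> cand_point (nvars I) y ` best_cands I y \<sigma> \<inter> closed_segment u v"
  then have opt: "x \<in> optimal_vertices I (cut_region I y \<sigma>)" by (simp add: optimal_vertices_best)
  then have "x extreme_point_of (node_region I \<sigma> \<inter> halfspace (nvars I) y)"
    by (simp add: optimal_vertices_def cut_region_halfspace)
  from extreme_on_segment[OF e _ this] x obtain k where
    k: "k \<in> edge_cands u v" "live (nvars I) y k" "x = cand_point (nvars I) y k"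
        by (auto simp: edge_cands_def)
  have "k \<in> cands (node_region I \<sigma>)"
    using k(1) e cands_ends(1,2)[OF e] by (auto simp: edge_cands_def cands_diag cands_sym[of v u])
  moreover have "cand_value I y k' \<le> cand_value I y k" if "k' \<in> cands (node_region I \<sigma>)"
      "live (nvars I) y k'" for k'
    using opt cand_point_in_cut[OF that] k(3)
        by (auto simp: optimal_vertices_def cand_value_def cut_region_halfspace)
  ultimately have "k \<in> best_cands I y \<sigma>" using k(2) by (simp add: best_cands_def)
  then show "x \<in> cand_point (nvars I) y ` (edge_cands u v \<inter> best_cands I y \<sigma>)" using k by blast
next
  fix x assume "x \<in> cand_point (nvars I) y ` (edge_cands u v \<inter> best_cands I y \<sigma>)"
  then obtain k where k: "k \<in> edge_cands u v" "k \<in> best_cands I y \<sigma>" "x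
      = cand_point (nvars I) y k" by blast
  have "cand_point (nvars I) y (a, b) \<in> closed_segment a b" if "live (nvars I) y (a, b)" for a b
    using cand_point_crossing(2)[OF that] by (cases "a = b")
        (auto simp: cand_point_def open_segment_def)
  moreover have "live (nvars I) y k" using k(2) by (simp add: best_cands_def)
  ultimately have "x \<in> closed_segment (fst k) (snd k)" using k(3) by (metis prod.collapse)
  then have "x \<in> closed_segment u v" using k(1) by (auto simp: edge_cands_def closed_segment_commute)
  then show "x \<in> cand_point (nvars I) y ` best_cands I y \<sigma> \<inter> closed_segment u v" using k by blast
qed

end

section \<open>The LP optimum as a function of the optimal candidates\<close>


text \<open>
  The candidate of the LP optimum. The flag \<open>h\<close> tells whether the LP optimum without the cut
  survives. The definition refers to the cut only through \<open>h\<close> and the set \<open>B\<close> of optimal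
  candidates. On the chosen edge, the crossing point precedes \<open>v\<close> and comes after \<open>u\<close>.
\<close>

definition selected_cand :: "ip \<Rightarrow> bc_rules \<Rightarrow> bool \<Rightarrow> branching set \<Rightarrow> (vector \<times> vector) set \<Rightarrow> vector
    \<times> vector" where
  "selected_cand I R h \<sigma> B =
     (if h then (lp_vertex R \<sigma>, lp_vertex R \<sigma>)
      else case tie_edge R \<sigma> {e \<in> edges (node_region I \<sigma>). \<exists>u v. e = closed_segment u v
          \<and> edge_cands u v \<inter> B \<noteq> {}} of
        (u, v) \<Rightarrow> if (u, u) \<in> B then (u, u) else if (u, v) \<in> B then (u, v)
                 else if (v, u) \<in> B then (v, u) else (v, v))"

lemma first_on_segment_eqI:
  assumes "x \<in> W" "\<And>w. w \<in> W \<Longrightarrow> x \<in> closed_segment u w"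
    "\<And>z. z \<in> W \<Longrightarrow> z \<in> closed_segment u x \<Longrightarrow> z = x"
  shows "first_on_segment u W = x"
  unfolding first_on_segment_def using assms by (intro the_equality) auto

lemma dot_closed_segment_ge:
  assumes "x \<in> closed_segment u w" "c \<le> dot n y u" "c \<le> dot n y w"
  shows "c \<le> dot n y x"
proof -
  obtain s where s: "0 \<le> s" "s \<le> 1" "x = (1 - s) *\<^sub>R u + s *\<^sub>R w"
    using assms(1) by (auto simp: in_segment)
  have "c = (1 - s) * c + s * c" by (simp add: algebra_simps)
  also have "\<dots> \<le> (1 - s) * dot n y u + s * dot n y w"
    using s assms by (intro add_mono mult_left_mono) auto
  finally show ?thesis by (simp add: s(3) dot_right)
qed

text \<open>
  If the live orientation is from \<open>u\<close> to \<open>v\<close>, the cut removes \<open>v\<close>; if it is from \<open>v\<close> to \<open>u\<close>, it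
  removes \<open>u\<close>. So at most two optimal vertices lie on the edge, and their order is known.
\<close>

lemma first_optimal_on_edge:
  assumes P: "ip_polytope I" and \<sigma>: "\<sigma> \<subseteq> branching_constraints I"
    and e: "(u, v) \<in> cands (node_region I \<sigma>)" "u \<noteq> v" and ne: "edge_cands u v \<inter> best_cands I y \<sigma> \<noteq> {}"
  defines "k \<equiv> if (u, u) \<in> best_cands I y \<sigma> then (u, u) else if (u, v) \<in> best_cands I y \<sigma> then (u, v)
                 else if (v, u) \<in> best_cands I y \<sigma> then (v, u) else (v, v)"
  shows "k \<in> best_cands I y \<sigma>"
    "first_on_segment u (cand_point (nvars I) y ` best_cands I y \<sigma> \<inter> closed_segment u v)
        = cand_point (nvars I) y k"
proof -
  let ?n = "nvars I" and ?B = "best_cands I y \<sigma>"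
  have W: "cand_point ?n y ` ?B \<inter> closed_segment u v = cand_point ?n y ` (edge_cands u v \<inter> ?B)"
    by (rule optimal_vertices_on_edge[OF P \<sigma> e(1)])
  have live: "live ?n y k'" if "k' \<in> ?B" for k' using that by (simp add: best_cands_def)
  show kB: "k \<in> ?B" using ne by (auto simp: k_def edge_cands_def)
  show "first_on_segment u (cand_point ?n y ` ?B \<inter> closed_segment u v) = cand_point ?n y k"
    unfolding W
  proof (rule first_on_segment_eqI)
    have kq: "k \<in> edge_cands u v" by (simp add: k_def edge_cands_def)
    then show "cand_point ?n y k \<in> cand_point ?n y ` (edge_cands u v \<inter> ?B)" using kB by blast
    have diag: "cand_point ?n y (x, x) = x" for x by (simp add: cand_point_def)
    have seg: "cand_point ?n y k \<in> closed_segment u v" using kB kq W by blast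
    consider "(u, u) \<in> ?B" | "(u, u) \<notin> ?B" "(u, v) \<in> ?B" | "(u, u) \<notin> ?B" "(u, v) \<notin> ?B" "(v, u) \<in> ?B"
      | "(u, u) \<notin> ?B" "(u, v) \<notin> ?B" "(v, u) \<notin> ?B" by blast
    then have "(\<forall>k'\<in>edge_cands u v \<inter> ?B. cand_point ?n y k \<in> closed_segment u (cand_point ?n y k')) \<and>
       (\<forall>k'\<in>edge_cands u v \<inter> ?B. cand_point ?n y k' \<in> closed_segment u (cand_point ?n y k) \<longrightarrow>
           cand_point ?n y k' = cand_point ?n y k)"
    proof cases
      case 1
      then show ?thesis by (simp add: k_def diag)
    next
      case 2
      then have k: "k = (u, v)" by (simp add: k_def)
      have "dot ?n y u < y ?n" "y ?n < dot ?n y v" using live[OF 2(2)] e(2) by (auto simp: live_def)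
      then have "(v, v) \<notin> ?B" "(v, u) \<notin> ?B"
        using live[of "(v, v)"] live[of "(v, u)"] e(2) by (auto simp: live_def)
      then have "edge_cands u v \<inter> ?B \<subseteq> {k}" using 2 k by (auto simp: edge_cands_def)
      then show ?thesis by auto
    next
      case 3
      then have k: "k = (v, u)" by (simp add: k_def)
      have d: "dot ?n y v < y ?n" "y ?n < dot ?n y u" using live[OF 3(3)] e(2) by (auto simp: live_def)
      have dk: "dot ?n y (cand_point ?n y k) = y ?n"
          using cand_point_crossing(1)[OF live[OF 3(3)]] e(2) k by simp
      have sub: "edge_cands u v \<inter> ?B \<subseteq> {k, (v, v)}" using 3 k by (auto simp: edge_cands_def)
      have "v \<notin> closed_segment u (cand_point ?n y k)"
        using dot_closed_segment_ge[of v u "cand_point ?n y k" "y ?n" ?n y] d dk by auto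
      then show ?thesis using sub seg diag by auto
    next
      case 4
      then have k: "k = (v, v)" by (simp add: k_def)
      then have "edge_cands u v \<inter> ?B \<subseteq> {k}" using 4 by (auto simp: edge_cands_def)
      then show ?thesis by auto
    qed
    then show "\<And>w. w \<in> cand_point ?n y ` (edge_cands u v \<inter> ?B) \<Longrightarrow> cand_point ?n y k \<in> closed_segment u w"
      "\<And>z. z \<in> cand_point ?n y ` (edge_cands u v \<inter> ?B) \<Longrightarrow> z \<in> closed_segment u (cand_point ?n y k)
          \<Longrightarrow> z = cand_point ?n y k"
      by blast+
  qed
qed

text \<open>
  The point to check is that some edge contains an optimal vertex, as the rule for ties says
  nothing about an empty set of edges. The only critical case is an optimal vertex of the cut
  region that is a vertex of the node region: the vertex removed by the cut is a second point, so
  there is an edge by \<open>edge_at_vertex\<close>.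
\<close>

lemma lp_optimum_selected_cand:
  assumes P: "ip_polytope I" and R: "admissible_rules I R" and \<sigma>: "\<sigma> \<subseteq> branching_constraints I"
    and ne: "cut_region I y \<sigma> \<noteq> {}"
  defines "k \<equiv> selected_cand I R (cut_holds I y (lp_vertex R \<sigma>)) \<sigma> (best_cands I y \<sigma>)"
  shows "k \<in> cands (node_region I \<sigma>) \<and> live (nvars I) y k \<and> lp_optimum I R y \<sigma>
      = cand_point (nvars I) y k"
proof -
  let ?n = "nvars I" and ?S = "node_region I \<sigma>" and ?B = "best_cands I y \<sigma>" and ?v0 = "lp_vertex R \<sigma>"
  have "?S \<noteq> {}" using ne by (auto simp: cut_region_def)
  then have "?v0 \<in> optimal_vertices I ?S" using R \<sigma> by (auto simp: admissible_rules_def)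
  then have v0: "?v0 extreme_point_of ?S" by (simp add: optimal_vertices_def)
  show ?thesis
  proof (cases "cut_holds I y ?v0")
    case True
    then show ?thesis using v0
      by (simp add: k_def selected_cand_def cands_diag live_def lp_optimum_def cand_point_def
          cut_holds_def)
  next
    case False
    define E where "E = {e \<in> edges ?S. e \<inter> cand_point ?n y ` ?B \<noteq> {}}"
    define E' where "E' = {e \<in> edges ?S. \<exists>u v. e = closed_segment u v \<and> edge_cands u v \<inter> ?B \<noteq> {}}"
    have edge: "e \<in> edges ?S \<longleftrightarrow> (\<exists>u v. u \<noteq> v \<and> e = closed_segment u v \<and> (u, v) \<in> cands ?S)" for e
      by (auto simp: edges_def cands_def)
    have meet: "closed_segment u v \<inter> cand_point ?n y ` ?B \<noteq> {} \<longleftrightarrow> edge_cands u v \<inter> ?B \<noteq> {}"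
      if "(u, v) \<in> cands ?S" for u v
      using optimal_vertices_on_edge[OF P \<sigma> that, of y] by (simp add: Int_commute)
    have EE: "E = E'"
    proof (intro equalityI subsetI)
      fix e assume "e \<in> E"
      then have e: "e \<in> edges ?S" "e \<inter> cand_point ?n y ` ?B \<noteq> {}" unfolding E_def by simp_all
      obtain u v where uv: "e = closed_segment u v" "(u, v) \<in> cands ?S"
        using e(1) edge[of e] by metis
      then have "edge_cands u v \<inter> ?B \<noteq> {}" using e(2) meet by metis
      then show "e \<in> E'" using e(1) uv(1) unfolding E'_def by (intro CollectI conjI exI)
    next
      fix e assume "e \<in> E'"
      then obtain u v where "e \<in> edges ?S" "e = closed_segment u v" "edge_cands u v \<inter> ?B \<noteq> {}"
        unfolding E'_def by blast
      moreover from this have "(u, v) \<in> cands ?S" by (auto simp: edges_def cands_def)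
      ultimately show "e \<in> E" using meet unfolding E_def by simp
    qed
    have "E \<noteq> {}"
    proof -
      obtain a b where ab: "(a, b) \<in> ?B" using best_nonempty_iff[OF P \<sigma>, of y] ne by auto
      then have abc: "(a, b) \<in> cands ?S" and live: "live ?n y (a, b)" by (auto simp: best_cands_def)
      show ?thesis
      proof (cases "a = b")
        case False
        then have "closed_segment a b \<in> edges ?S" using abc edge by blast
        moreover have "edge_cands a b \<inter> ?B \<noteq> {}" using ab by (auto simp: edge_cands_def)
        ultimately have "closed_segment a b \<in> E'" unfolding E'_def by (intro CollectI conjI exI) auto
        then show ?thesis using EE by blast
      next
        case True
        then have "a extreme_point_of ?S" using abc cands_diag by blast
        moreover have "?v0 \<noteq> a" using live True False by (auto simp: live_def cut_holds_def)
        moreover have "?v0 \<in> ?S" using v0 by (simp add: extreme_point_of_def)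
        ultimately obtain v where "v \<noteq> a" "(a, v) \<in> cands ?S"
          using edge_at_vertex[OF finite_box_rows node_no_ray[OF P \<sigma>]] 
          unfolding node_region_box(1)[OF P \<sigma>] by blast
        then have "closed_segment a v \<in> edges ?S" using edge by metis
        moreover have "edge_cands a v \<inter> ?B \<noteq> {}" using ab True by (auto simp: edge_cands_def)
        ultimately have "closed_segment a v \<in> E'" unfolding E'_def by (intro CollectI conjI exI) auto
        then show ?thesis using EE by blast
      qed
    qed
    moreover have "E \<subseteq> edges ?S" by (auto simp: E_def)
    moreover obtain u v where uv: "tie_edge R \<sigma> E = (u, v)" by fastforce
    ultimately have uvE: "closed_segment u v \<in> E"
      using R \<sigma> unfolding admissible_rules_def by (metis (no_types, lifting) case_prod_conv)
    then obtain a b where "a \<noteq> b" "closed_segment u v = closed_segment a b" "(a, b) \<in> cands ?S"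
      using edge[of "closed_segment u v"] unfolding E_def by auto
    then have uvc: "(u, v) \<in> cands ?S" "u \<noteq> v"
      using closed_segment_eq_ends[of u v a b] by (auto simp: cands_def)
    then have q: "edge_cands u v \<inter> ?B \<noteq> {}" using uvE meet[OF uvc(1)] unfolding E_def by simp
    have "k = (if (u, u) \<in> ?B then (u, u) else if (u, v) \<in> ?B then (u, v)
                 else if (v, u) \<in> ?B then (v, u) else (v, v))"
      unfolding k_def selected_cand_def E'_def[symmetric] EE[symmetric] uv using False by simp
    moreover have "lp_optimum I R y \<sigma> = first_on_segment u (cand_point ?n y ` ?B \<inter> closed_segment u v)"
      unfolding lp_optimum_def optimal_vertices_best[OF P \<sigma>] Let_def E_def[symmetric] uv
          using False by simp
    ultimately show ?thesis
      using first_optimal_on_edge[OF P \<sigma> uvc q] by (auto simp: best_cands_def)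
  qed
qed

abbreviation eps :: real where "eps \<equiv> 1 / 10 ^ 6"

text \<open>
  The sign conditions that determine the run of branch-and-cut. Those on scores are demanded only
  if there are two variables to compare.
\<close>

definition agree :: "ip \<Rightarrow> vector \<Rightarrow> vector \<Rightarrow> bool" where
  "agree I y y' \<longleftrightarrow>
     (\<forall>(u, v)\<in>all_cands I. sgn (dot (nvars I) y u - y (nvars I))
         = sgn (dot (nvars I) y' u - y' (nvars I))) \<and>
     (\<forall>k\<in>all_cands I. live (nvars I) y k \<longrightarrow> (\<forall>i<nvars I. \<forall>l\<in>{0..tau I}.
        sgn (cand_point (nvars I) y k i - real_of_int l)
            = sgn (cand_point (nvars I) y' k i - real_of_int l))) \<and>
     (let K = {k\<in>all_cands I. live (nvars I) y k}; v = cand_value I y; v' = cand_value I y' in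
       (\<forall>a\<in>K. \<forall>b\<in>K. sgn (v a - v b) = sgn (v' a - v' b) \<and> sgn (v a - v b - eps)
           = sgn (v' a - v' b - eps)) \<and>
       (2 \<le> nvars I \<longrightarrow> (\<forall>z\<in>K. \<forall>a\<in>K. \<forall>b\<in>K. \<forall>c\<in>K.
          sgn ((v z - v a) * (v z - v b) - eps * eps)
              = sgn ((v' z - v' a) * (v' z - v' b) - eps * eps) \<and>
          sgn ((v z - v a) * (v z - v b) - (v z - v c) * eps) =
            sgn ((v' z - v' a) * (v' z - v' b) - (v' z - v' c) * eps) \<and>
          (\<forall>d\<in>K. sgn ((v z - v a) * (v z - v b) - (v z - v c) * (v z - v d)) =
            sgn ((v' z - v' a) * (v' z - v' b) - (v' z - v' c) * (v' z - v' d))))))"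

lemma sgn_eq_imp_le_iff: "sgn (a - b) = sgn (c - d) \<Longrightarrow> a \<le> b \<longleftrightarrow> c \<le> d"
  and sgn_eq_imp_ge_iff: "sgn (a - b) = sgn (c - d) \<Longrightarrow> b \<le> a \<longleftrightarrow> d \<le> c" for a b c d :: real
  by (metis diff_le_0_iff_le sgn_le_0_iff, metis diff_ge_0_iff_ge zero_le_sgn_iff)

lemma live_cong_sgn:
  assumes "sgn (dot n y u - y n) = sgn (dot n y' u - y' n)"
    and "sgn (dot n y v - y n) = sgn (dot n y' v - y' n)"
  shows "live n y (u, v) \<longleftrightarrow> live n y' (u, v)"
  unfolding live_def prod.case
  using sgn_eq_imp_le_iff[OF assms(1)] sgn_eq_imp_le_iff[OF assms(2)]
    sgn_eq_imp_ge_iff[OF assms(1)] sgn_eq_imp_ge_iff[OF assms(2)]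
  by (simp add: not_le[symmetric])

text \<open>
  Each maximum is one of its arguments, and the choice is the same on both sides, so each of the
  sixteen comparisons of products is one of the sign conditions or follows from them by cancelling
  \<open>e\<close>.
\<close>

lemma max_mult_le_iff:
  fixes e :: real
  assumes e: "e > 0"
    and s: "sgn (a - e) = sgn (a' - e)" "sgn (b - e) = sgn (b' - e)"
       "sgn (c - e) = sgn (c' - e)" "sgn (d - e) = sgn (d' - e)"
    and p: "sgn (a * b - c * d) = sgn (a' * b' - c' * d')"
       "sgn (a * b - e * e) = sgn (a' * b' - e * e)" "sgn (c * d - e * e) = sgn (c' * d' - e * e)"
       "sgn (a * b - c * e) = sgn (a' * b' - c' * e)" "sgn (a * b - d * e) = sgn (a' * b' - d' * e)"
       "sgn (c * d - a * e) = sgn (c' * d' - a' * e)" "sgn (c * d - b * e) = sgn (c' * d' - b' * e)"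
    and q: "sgn (a - c) = sgn (a' - c')" "sgn (a - d) = sgn (a' - d')"
       "sgn (b - c) = sgn (b' - c')" "sgn (b - d) = sgn (b' - d')"
  shows "max a e * max b e \<le> max c e * max d e \<longleftrightarrow> max a' e * max b' e \<le> max c' e * max d' e"
proof -
  note le = sgn_eq_imp_le_iff
  note flip = sgn_eq_imp_ge_iff
  note lems = le[OF s(1)] le[OF s(2)] le[OF s(3)] le[OF s(4)] le[OF p(1)] le[OF p(2)] flip[OF p(3)]
     le[OF p(4)] le[OF p(5)] flip[OF p(6)] flip[OF p(7)]
     le[OF q(1)] le[OF q(2)] le[OF q(3)] le[OF q(4)] flip[OF s(1)] flip[OF s(2)] flip[OF s(3)]
         flip[OF s(4)]
  have r: "e * e \<le> x * e \<longleftrightarrow> e \<le> x" "x * e \<le> e * e \<longleftrightarrow> x \<le> e" "x * e \<le> y * e \<longleftrightarrow> x \<le> y" for x y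
    using e by simp_all
  have ch: "max x e = x \<and> max x' e = x' \<or> max x e = e \<and> max x' e = e" if "x \<le> e \<longleftrightarrow> x' \<le> e" for x x'
    using that by (simp add: max_def)
  show ?thesis
    using ch[OF lems(1)] ch[OF lems(2)] ch[OF lems(3)] ch[OF lems(4)]
    by (elim disjE conjE)
      (simp_all only: lems r mult.commute[of e a] mult.commute[of e b] mult.commute[of e c]
          mult.commute[of e d]
        mult.commute[of e a'] mult.commute[of e b'] mult.commute[of e c'] mult.commute[of e d'])
qed

section \<open>Equal signs force equal trees\<close>


lemma all_cands_sym: "(u, v) \<in> all_cands I \<Longrightarrow> (v, u) \<in> all_cands I"
  unfolding all_cands_def using cands_sym[of u v] by blast

lemma score_finite:
  fixes z a b e :: real
  shows "max (ereal z - ereal a) (ereal e) * max (ereal z - ereal b) (ereal e)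
      = ereal (max (z - a) e * max (z - b) e)"
  by (simp add: ereal_max[symmetric] del: ereal_max)

lemma score_infinite:
  assumes "e > 0"
  shows "max (ereal z - (-\<infinity>)) (ereal e) * max w (ereal e) = \<infinity>"
    and "max w (ereal e) * max (ereal z - (-\<infinity>)) (ereal e) = \<infinity>"
proof -
  have pos: "max w (ereal e) > 0" using assms by (simp add: less_le_trans[of 0 "ereal e"])
  have inf: "max (ereal z - (-\<infinity>)) (ereal e) = \<infinity>" by (simp add: max_def)
  show "max (ereal z - (-\<infinity>)) (ereal e) * max w (ereal e) = \<infinity>"
    unfolding inf using pos by (simp add: ereal_infty_mult)
  then show "max w (ereal e) * max (ereal z - (-\<infinity>)) (ereal e) = \<infinity>" by (simp add: mult.commute)
qed

lemma score_cases:
  assumes "e > 0"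
  shows "max (ereal z - (if A then -\<infinity> else ereal a)) (ereal e) * max
      (ereal z - (if B then -\<infinity> else ereal b)) (ereal e)
    = (if A \<or> B then \<infinity> else ereal (max (z - a) e * max (z - b) e))"
  by (cases A; cases B) (simp_all only: score_infinite[OF assms] score_finite if_True if_False
      simp_thms)

text \<open>
  Both numbers lie in the same place relative to the integers from 0 to \<open>t\<close>.
\<close>

lemma floor_ceiling_eq_if_sgn_eq:
  fixes x x' :: real
  assumes x: "0 \<le> x" "x \<le> real_of_int t" and x': "0 \<le> x'" "x' \<le> real_of_int t"
    and s: "\<And>l. l \<in> {0..t} \<Longrightarrow> sgn (x - real_of_int l) = sgn (x' - real_of_int l)"
  shows "\<lfloor>x\<rfloor> = \<lfloor>x'\<rfloor>" "\<lceil>x\<rceil> = \<lceil>x'\<rceil>" "x \<in> \<int> \<longleftrightarrow> x' \<in> \<int>"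
    "0 \<le> \<lfloor>x\<rfloor>" "\<lfloor>x\<rfloor> \<le> t" "0 \<le> \<lceil>x\<rceil>" "\<lceil>x\<rceil> \<le> t"
proof -
  have le: "x \<le> real_of_int l \<longleftrightarrow> x' \<le> real_of_int l" "real_of_int l \<le> x \<longleftrightarrow> real_of_int l \<le> x'"
    if "l \<in> {0..t}" for l
    by (rule sgn_eq_imp_le_iff[OF s[OF that]], rule sgn_eq_imp_ge_iff[OF s[OF that]])
  have r: "0 \<le> \<lfloor>x\<rfloor> \<and> \<lfloor>x\<rfloor> \<le> t \<and> 0 \<le> \<lceil>x\<rceil> \<and> \<lceil>x\<rceil> \<le> t" if "0 \<le> x" "x \<le> real_of_int t" for x :: real
    using that by (simp add: floor_le_iff ceiling_le_iff le_ceiling_iff)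
  note rx = r[OF x] and rx' = r[OF x']
  then show "0 \<le> \<lfloor>x\<rfloor>" "\<lfloor>x\<rfloor> \<le> t" "0 \<le> \<lceil>x\<rceil>" "\<lceil>x\<rceil> \<le> t" by auto
  show fl: "\<lfloor>x\<rfloor> = \<lfloor>x'\<rfloor>"
    using le(2)[of "\<lfloor>x\<rfloor>"] le(2)[of "\<lfloor>x'\<rfloor>"] rx rx' of_int_floor_le[of x] of_int_floor_le[of x']
    by (simp add: le_floor_iff[symmetric])
  show "\<lceil>x\<rceil> = \<lceil>x'\<rceil>"
    using le(1)[of "\<lceil>x\<rceil>"] le(1)[of "\<lceil>x'\<rceil>"] rx rx' le_of_int_ceiling[of x] le_of_int_ceiling[of x']
    by (simp add: ceiling_le_iff[symmetric])
  have int: "x \<in> \<int> \<longleftrightarrow> x \<le> real_of_int \<lfloor>x\<rfloor>" for x :: real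
  proof
    assume "x \<le> real_of_int \<lfloor>x\<rfloor>"
    then have "x = real_of_int \<lfloor>x\<rfloor>" using of_int_floor_le[of x] by simp
    then show "x \<in> \<int>" by (metis Ints_of_int)
  qed (auto elim!: Ints_cases)
  show "x \<in> \<int> \<longleftrightarrow> x' \<in> \<int>"
    unfolding int[of x] int[of x'] using le(1)[of "\<lfloor>x\<rfloor>"] rx fl by simp
qed

locale agreeing_cuts =
  fixes I :: ip and R :: bc_rules and y y' :: vector
  assumes P: "ip_polytope I" and R: "admissible_rules I R" and A: "agree I y y'"
begin

abbreviation "n \<equiv> nvars I"
abbreviation "BC \<equiv> branching_constraints I"

lemma cut_sgn: "(u, v) \<in> all_cands I \<Longrightarrow> sgn (dot n y u - y n) = sgn (dot n y' u - y' n)"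
  using A unfolding agree_def by blast

lemma cut_le: "(u, v) \<in> all_cands I \<Longrightarrow> dot n y u \<le> y n \<longleftrightarrow> dot n y' u \<le> y' n"
  by (rule sgn_eq_imp_le_iff[OF cut_sgn])

lemma live_agree:
  assumes "k \<in> all_cands I"
  shows "live n y k \<longleftrightarrow> live n y' k"
proof (cases k)
  case (Pair u v)
  then have k: "(u, v) \<in> all_cands I" "(v, u) \<in> all_cands I" using assms all_cands_sym by auto
  show ?thesis unfolding Pair by (rule live_cong_sgn[OF cut_sgn[OF k(1)] cut_sgn[OF k(2)]])
qed

lemma coordinate_sgn:
  assumes "k \<in> all_cands I" "live n y k" "i < n" "l \<in> {0..tau I}"
  shows "sgn (cand_point n y k i - real_of_int l) = sgn (cand_point n y' k i - real_of_int l)"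
  using A assms unfolding agree_def by blast

lemma cand_value_sgn:
  assumes "a \<in> all_cands I" "live n y a" "b \<in> all_cands I" "live n y b"
  shows "sgn (cand_value I y a - cand_value I y b) = sgn (cand_value I y' a - cand_value I y' b)"
    "sgn (cand_value I y a - cand_value I y b - eps)
        = sgn (cand_value I y' a - cand_value I y' b - eps)"
  using A assms unfolding agree_def Let_def by blast+

lemma cand_value_le:
  assumes "a \<in> all_cands I" "live n y a" "b \<in> all_cands I" "live n y b"
  shows "cand_value I y a \<le> cand_value I y b \<longleftrightarrow> cand_value I y' a \<le> cand_value I y' b"
  by (rule sgn_eq_imp_le_iff[OF cand_value_sgn(1)[OF assms]])

lemma best_agree:
  assumes "\<sigma> \<subseteq> BC"
  shows "best_cands I y \<sigma> = best_cands I y' \<sigma>"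
proof -
  have sub: "k \<in> all_cands I" if "k \<in> cands (node_region I \<sigma>)" for k
    using cands_node_region[OF P assms] that by blast
  have "k \<in> best_cands I y \<sigma> \<longleftrightarrow> k \<in> best_cands I y' \<sigma>" for k
    unfolding best_cands_def using sub live_agree cand_value_le by (smt (verit) mem_Collect_eq)
  then show ?thesis by blast
qed

lemma best_mem: "\<sigma> \<subseteq> BC \<Longrightarrow> k \<in> best_cands I y \<sigma> \<Longrightarrow> k \<in> all_cands I \<and> live n y k"
  using cands_node_region[OF P] unfolding best_cands_def by blast

lemma cut_region_empty_agree: "\<sigma> \<subseteq> BC \<Longrightarrow> cut_region I y \<sigma> = {} \<longleftrightarrow> cut_region I y' \<sigma> = {}"
  using best_nonempty_iff[OF P] best_agree by metis

lemma lp_value_le_agree: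
  assumes "\<sigma> \<subseteq> BC" "\<sigma>' \<subseteq> BC"
  shows "lp_value I (cut_region I y \<sigma>) \<le> lp_value I (cut_region I y \<sigma>') \<longleftrightarrow>
    lp_value I (cut_region I y' \<sigma>) \<le> lp_value I (cut_region I y' \<sigma>')"
proof -
  have "(SOME k. k \<in> best_cands I y' s) \<in> all_cands I \<and> live n y (SOME k. k \<in> best_cands I y' s)"
    if "s \<subseteq> BC" "best_cands I y' s \<noteq> {}" for s
    using that best_mem[OF that(1)] best_agree[OF that(1)] some_in_eq by metis
  then show ?thesis
    unfolding lp_value_best[OF P assms(1)] lp_value_best[OF P assms(2)] best_agree[OF assms(1)]
        best_agree[OF assms(2)]
    using cand_value_le assms by simp
qed

lemma lp_optimum_agree:
  assumes \<sigma>: "\<sigma> \<subseteq> BC" and ne: "cut_region I y \<sigma> \<noteq> {}"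
  obtains k where "k \<in> cands (node_region I \<sigma>)" "live n y k" "live n y' k"
    "lp_optimum I R y \<sigma> = cand_point n y k" "lp_optimum I R y' \<sigma> = cand_point n y' k"
proof -
  have "node_region I \<sigma> \<noteq> {}" using ne by (auto simp: cut_region_def)
  then have "lp_vertex R \<sigma> extreme_point_of node_region I \<sigma>"
    using R \<sigma> by (auto simp: admissible_rules_def optimal_vertices_def)
  then have "(lp_vertex R \<sigma>, lp_vertex R \<sigma>) \<in> all_cands I"
    using cands_node_region[OF P \<sigma>] cands_diag by blast
  then have h: "cut_holds I y (lp_vertex R \<sigma>) = cut_holds I y' (lp_vertex R \<sigma>)"
    using cut_le by (simp add: cut_holds_def)
  have ne': "cut_region I y' \<sigma> \<noteq> {}" using ne cut_region_empty_agree[OF \<sigma>] by simp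
  show ?thesis
    by (rule that[of "selected_cand I R (cut_holds I y (lp_vertex R \<sigma>)) \<sigma> (best_cands I y \<sigma>)"])
      (use lp_optimum_selected_cand[OF P R \<sigma> ne] lp_optimum_selected_cand[OF P R \<sigma> ne'] h
          best_agree[OF \<sigma>] in simp_all)
qed

lemma lp_optimum_rounding_agree:
  assumes \<sigma>: "\<sigma> \<subseteq> BC" and ne: "cut_region I y \<sigma> \<noteq> {}" and i: "i < n"
  defines "x \<equiv> lp_optimum I R y \<sigma>" and "x' \<equiv> lp_optimum I R y' \<sigma>"
  shows "\<lfloor>x i\<rfloor> = \<lfloor>x' i\<rfloor>" "\<lceil>x i\<rceil> = \<lceil>x' i\<rceil>" "x i \<in> \<int> \<longleftrightarrow> x' i \<in> \<int>"
    "insert (Upper i \<lfloor>x i\<rfloor>) \<sigma> \<subseteq> BC" "insert (Lower i \<lceil>x i\<rceil>) \<sigma> \<subseteq> BC"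
proof -
  obtain k where k: "k \<in> cands (node_region I \<sigma>)" "live n y k" "live n y' k"
    "x = cand_point n y k" "x' = cand_point n y' k"
    using lp_optimum_agree[OF \<sigma> ne] unfolding x_def x'_def by metis
  have ka: "k \<in> all_cands I" using k(1) cands_node_region[OF P \<sigma>] by blast
  have "x \<in> lp_region I" "x' \<in> lp_region I"
    using cand_point_in_cut[OF k(1,2)] cand_point_in_cut[OF k(1,3)] k(4,5)
        by (auto simp: node_region_def)
  note b = lp_region_bounds[OF P this(1) i] lp_region_bounds[OF P this(2) i]
  note f = floor_ceiling_eq_if_sgn_eq[OF b coordinate_sgn[OF ka k(2) i, folded k(4,5)]]
  show "\<lfloor>x i\<rfloor> = \<lfloor>x' i\<rfloor>" "\<lceil>x i\<rceil> = \<lceil>x' i\<rceil>" "x i \<in> \<int> \<longleftrightarrow> x' i \<in> \<int>" using f by auto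
  show "insert (Upper i \<lfloor>x i\<rfloor>) \<sigma> \<subseteq> BC" "insert (Lower i \<lceil>x i\<rceil>) \<sigma> \<subseteq> BC"
    using f i \<sigma> by (simp_all add: mem_branching_constraints)
qed

text \<open>
  The LP value at \<open>s\<close> for the cut \<open>w\<close>, computed from an optimal candidate for \<open>y\<close>. It is meant for
  \<open>w\<close> among \<open>y\<close> and \<open>y'\<close>, which have the same optimal candidates, and for feasible \<open>s\<close>.
\<close>

definition child_val :: "vector \<Rightarrow> branching set \<Rightarrow> real" where
  "child_val w s = cand_value I w (SOME k. k \<in> best_cands I y s)"

lemma score_eq:
  assumes \<sigma>: "\<sigma> \<subseteq> BC" and ne: "cut_region I y \<sigma> \<noteq> {}" and i: "i < n" and w: "w = y \<or> w = y'"
  defines "d \<equiv> insert (Upper i \<lfloor>lp_optimum I R y \<sigma> i\<rfloor>) \<sigma>" and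
      "u \<equiv> insert (Lower i \<lceil>lp_optimum I R y \<sigma> i\<rceil>) \<sigma>"
  shows "score I R w \<sigma> i = (if best_cands I y d = {} \<or> best_cands I y u = {} then \<infinity>
    else ereal (max (child_val w \<sigma> - child_val w d) eps * max (child_val w \<sigma> - child_val w u) eps))"
proof -
  have du: "d \<subseteq> BC" "u \<subseteq> BC"
    using lp_optimum_rounding_agree[OF \<sigma> ne i] by (simp_all add: d_def u_def)
  have d: "d = insert (Upper i \<lfloor>lp_optimum I R w \<sigma> i\<rfloor>) \<sigma>" and u: "u
      = insert (Lower i \<lceil>lp_optimum I R w \<sigma> i\<rceil>) \<sigma>"
    using w lp_optimum_rounding_agree(1,2)[OF \<sigma> ne i] by (auto simp: d_def u_def)
  have v: "lp_value I (cut_region I w s) = (if best_cands I y s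
      = {} then -\<infinity> else ereal (child_val w s))"
    if "s \<subseteq> BC" for s
    using w lp_value_best[OF P that] best_agree[OF that] by (auto simp: child_val_def)
  have "best_cands I y \<sigma> \<noteq> {}" using ne best_nonempty_iff[OF P \<sigma>] by simp
  then show ?thesis
    unfolding score_def Let_def d[symmetric] u[symmetric] v[OF \<sigma>] v[OF du(1)] v[OF du(2)]
    by (simp only: if_False) (rule score_cases, simp)
qed

lemma score_le_agree:
  assumes \<sigma>: "\<sigma> \<subseteq> BC" and ne: "cut_region I y \<sigma> \<noteq> {}" and ij: "i < n" "j < n"
  shows "score I R y \<sigma> i \<le> score I R y \<sigma> j \<longleftrightarrow> score I R y' \<sigma> i \<le> score I R y' \<sigma> j"
proof (cases "i = j")
  case False
  then have n2: "2 \<le> n" using ij by linarith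
  define d where "d i = insert (Upper i \<lfloor>lp_optimum I R y \<sigma> i\<rfloor>) \<sigma>" for i
  define u where "u i = insert (Lower i \<lceil>lp_optimum I R y \<sigma> i\<rceil>) \<sigma>" for i
  have sub: "d i \<subseteq> BC" "u i \<subseteq> BC" if "i < n" for i
    using lp_optimum_rounding_agree[OF \<sigma> ne that] by (simp_all add: d_def u_def)
  note sc = score_eq[OF \<sigma> ne _ disjI1[OF refl], folded d_def u_def]
    score_eq[OF \<sigma> ne _ disjI2[OF refl], folded d_def u_def]
  show ?thesis
  proof (cases "best_cands I y (d i) = {} \<or> best_cands I y (u i) = {} \<or> best_cands I y (d j)
      = {} \<or> best_cands I y (u j) = {}")
    case True
    then show ?thesis using sc ij by (auto simp del: ereal_max)
  next
    case False
    define K where "K = {k\<in>all_cands I. live n y k}"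
    define c where "c s = (SOME k. k \<in> best_cands I y s)" for s
    have cK: "c s \<in> K" if "s \<subseteq> BC" "best_cands I y s \<noteq> {}" for s
      using best_mem[OF that(1)] that(2) by (simp add: c_def K_def some_in_eq)
    have "best_cands I y \<sigma> \<noteq> {}" using ne best_nonempty_iff[OF P \<sigma>] by simp
    then have K: "c \<sigma> \<in> K" "c (d i) \<in> K" "c (u i) \<in> K" "c (d j) \<in> K" "c (u j) \<in> K"
      using cK \<sigma> sub ij False by auto
    have cv: "child_val w s = cand_value I w (c s)" for w s by (simp add: child_val_def c_def)
    have A1: "sgn (cand_value I y a - cand_value I y b) = sgn (cand_value I y' a - cand_value I y' b)"
        "sgn (cand_value I y a - cand_value I y b - eps)
            = sgn (cand_value I y' a - cand_value I y' b - eps)"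
      if "a \<in> K" "b \<in> K" for a b using cand_value_sgn that by (auto simp: K_def)
    have A2: "sgn ((cand_value I y z - cand_value I y a) - (cand_value I y z - cand_value I y b))
        = sgn ((cand_value I y' z - cand_value I y' a) - (cand_value I y' z - cand_value I y' b))"
      if "a \<in> K" "b \<in> K" for a b z using A1(1)[OF that(2,1)] by simp
    have A3: "sgn ((cand_value I y z - cand_value I y a) * (cand_value I y z - cand_value I y b) -
        eps * eps) = sgn ((cand_value I y' z - cand_value I y' a) *
        (cand_value I y' z - cand_value I y' b) - eps * eps)"
      "sgn ((cand_value I y z - cand_value I y a) * (cand_value I y z - cand_value I y b) -
          (cand_value I y z - cand_value I y c) * eps) =
            sgn ((cand_value I y' z - cand_value I y' a) * (cand_value I y' z - cand_value I y' b)
                - (cand_value I y' z - cand_value I y' c) * eps)"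
      "sgn ((cand_value I y z - cand_value I y a) * (cand_value I y z - cand_value I y b) -
          (cand_value I y z - cand_value I y c) * (cand_value I y z - cand_value I y d)) =
            sgn ((cand_value I y' z - cand_value I y' a) * (cand_value I y' z - cand_value I y' b)
                - (cand_value I y' z - cand_value I y' c) * (cand_value I y' z - cand_value I y' d))"
      if "z \<in> K" "a \<in> K" "b \<in> K" "c \<in> K" "d \<in> K" for z a b c d
      using A n2 that unfolding agree_def Let_def K_def by blast+
    have "max (cand_value I y (c \<sigma>) - cand_value I y (c (d i))) eps * max
        (cand_value I y (c \<sigma>) - cand_value I y (c (u i))) eps
        \<le> max (cand_value I y (c \<sigma>) - cand_value I y (c (d j))) eps * max
            (cand_value I y (c \<sigma>) - cand_value I y (c (u j))) eps \<longleftrightarrow>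
      max (cand_value I y' (c \<sigma>) - cand_value I y' (c (d i))) eps * max
          (cand_value I y' (c \<sigma>) - cand_value I y' (c (u i))) eps
        \<le> max (cand_value I y' (c \<sigma>) - cand_value I y' (c (d j))) eps * max
            (cand_value I y' (c \<sigma>) - cand_value I y' (c (u j))) eps"
      by (rule max_mult_le_iff; (rule A1 A2 A3)?; (rule K)?; simp)
    then show ?thesis using sc ij False by (simp add: cv)
  qed
qed simp

lemma branching_variable_agree:
  assumes \<sigma>: "\<sigma> \<subseteq> BC" and ne: "cut_region I y \<sigma> \<noteq> {}"
  shows "branching_variable I R y \<sigma> = branching_variable I R y' \<sigma>"
proof -
  have "(\<lambda>i. i < n \<and> (\<forall>j<n. score I R y \<sigma> j \<le> score I R y \<sigma> i)) =
    (\<lambda>i. i < n \<and> (\<forall>j<n. score I R y' \<sigma> j \<le> score I R y' \<sigma> i))"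
    using score_le_agree[OF \<sigma> ne] by blast
  then show ?thesis by (simp add: branching_variable_def)
qed

lemma branching_variable_less:
  assumes "0 < n"
  shows "branching_variable I R y \<sigma> < n"
proof -
  let ?s = "score I R y \<sigma>"
  have "Max (?s ` {..<n}) \<in> ?s ` {..<n}" using assms by (intro Max_in) auto
  then obtain i where "i < n" "Max (?s ` {..<n}) = ?s i" by auto
  then have "i < n \<and> (\<forall>j<n. ?s j \<le> ?s i)" by (metis Max_ge finite_imageI finite_lessThan imageI
      lessThan_iff)
  from arg_min_nat_lemma[of "\<lambda>i. i < n \<and> (\<forall>j<n. ?s j \<le> ?s i)", OF this]
  show ?thesis unfolding branching_variable_def by blast
qed

text \<open>
  The incumbents are different numbers for the two cuts; what persists is that they are the LP
  values of the same node.
\<close>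

definition similar :: "bc_state \<Rightarrow> bc_state \<Rightarrow> bool" where
  "similar s s' \<longleftrightarrow> (case s of (T, L, inc) \<Rightarrow> case s' of (T', L', inc') \<Rightarrow>
     T = T' \<and> L = L' \<and> finite L \<and> (\<forall>p\<in>L. set p \<subseteq> BC) \<and>
     (inc = -\<infinity> \<and> inc' = -\<infinity> \<or>
      (\<exists>\<sigma>\<subseteq>BC. inc = lp_value I (cut_region I y \<sigma>) \<and> inc' = lp_value I (cut_region I y' \<sigma>))))"

lemma similar_step:
  assumes "similar s s'"
  shows "similar (bc_step I R y s) (bc_step I R y' s')"
proof -
  obtain T L inc inc' where s: "s = (T, L, inc)" "s' = (T, L, inc')" and finL: "finite L"
    and LBC: "\<And>p. p \<in> L \<Longrightarrow> set p \<subseteq> BC"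
    and inc: "inc = -\<infinity> \<and> inc' = -\<infinity> \<or>
      (\<exists>\<sigma>\<subseteq>BC. inc = lp_value I (cut_region I y \<sigma>) \<and> inc' = lp_value I (cut_region I y' \<sigma>))"
    using assms by (auto simp: similar_def split: prod.splits)
  show ?thesis
  proof (cases "L = {}")
    case True
    then show ?thesis using assms by (simp add: s)
  next
    case False
    define v where "v p = lp_value I (cut_region I y (set p))" for p
    define v' where "v' p = lp_value I (cut_region I y' (set p))" for p
    define Q where "Q = {(p, p'). p \<in> L \<and> p' \<in> L \<and> v p \<le> v p'}"
    have Q': "Q = {(p, p'). p \<in> L \<and> p' \<in> L \<and> v' p \<le> v' p'}"
      unfolding Q_def v_def v'_def using lp_value_le_agree LBC by blast
    define q where "q = node_select R T L Q"
    have q: "q \<in> L" unfolding q_def using R finL False by (simp add: admissible_rules_def)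
    note qBC = LBC[OF q]
    define x where "x = lp_optimum I R y (set q)"
    define x' where "x' = lp_optimum I R y' (set q)"
    define i where "i = branching_variable I R y (set q)"
    define i' where "i' = branching_variable I R y' (set q)"
    define ch where "ch = {q @ [Upper i \<lfloor>x i\<rfloor>], q @ [Lower i \<lceil>x i\<rceil>]}"
    define ch' where "ch' = {q @ [Upper i' \<lfloor>x' i'\<rfloor>], q @ [Lower i' \<lceil>x' i'\<rceil>]}"
    have step: "bc_step I R y s =
      (if cut_region I y (set q) = {} then (T, L - {q}, inc)
       else if integral_point I x then (T, L - {q}, max inc (v q))
       else if v q \<le> inc then (T, L - {q}, inc)
       else (T \<union> ch, L - {q} \<union> ch, inc))"
      unfolding s bc_step.simps Let_def v_def[symmetric] Q_def[symmetric] q_def[symmetric]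
        x_def[symmetric] i_def[symmetric] ch_def[symmetric] using False by simp
    have step': "bc_step I R y' s' =
      (if cut_region I y' (set q) = {} then (T, L - {q}, inc')
       else if integral_point I x' then (T, L - {q}, max inc' (v' q))
       else if v' q \<le> inc' then (T, L - {q}, inc')
       else (T \<union> ch', L - {q} \<union> ch', inc'))"
      unfolding s bc_step.simps Let_def v'_def[symmetric] Q'[symmetric] q_def[symmetric]
        x'_def[symmetric] i'_def[symmetric] ch'_def[symmetric] using False by simp
    have base: "finite (L - {q})" "\<forall>p\<in>L - {q}. set p \<subseteq> BC" using finL LBC by auto
    have empty: "cut_region I y (set q) = {} \<longleftrightarrow> cut_region I y' (set q) = {}"
      by (rule cut_region_empty_agree[OF qBC])
    show ?thesis
    proof (cases "cut_region I y (set q) = {}")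
      case True
      then show ?thesis unfolding step step' using empty base inc by (simp add: similar_def)
    next
      case ne: False
      note rd = lp_optimum_rounding_agree[OF qBC ne, folded x_def x'_def]
      have int: "integral_point I x \<longleftrightarrow> integral_point I x'"
        unfolding integral_point_def using rd(3) by blast
      have le: "v q \<le> inc \<longleftrightarrow> v' q \<le> inc'"
      proof (cases "inc = -\<infinity> \<and> inc' = -\<infinity>")
        case True
        have "v q \<noteq> -\<infinity>" "v' q \<noteq> -\<infinity>"
          using ne empty lp_value_best[OF P qBC] best_nonempty_iff[OF P qBC]
              by (simp_all add: v_def v'_def)
        then show ?thesis using True by simp
      next
        case False
        then show ?thesis using inc lp_value_le_agree[OF qBC] unfolding v_def v'_def by blast
      qed
      show ?thesis
      proof (cases "integral_point I x")
        case True
        have "max inc (v q) = (if v q \<le> inc then inc else v q)" by (simp add: max_absorb1 max_absorb2)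
        moreover have "max inc' (v' q) = (if v q \<le> inc then inc' else v' q)" using le
            by (simp add: max_absorb1 max_absorb2)
        ultimately have "similar (T, L - {q}, max inc (v q)) (T, L - {q}, max inc' (v' q))"
          using base inc qBC by (auto simp: similar_def v_def v'_def)
        then show ?thesis unfolding step step' using True int ne empty by simp
      next
        case nint: False
        then have "0 < n" by (auto simp: integral_point_def)
        then have i: "i < n" unfolding i_def by (rule branching_variable_less)
        have "i' = i" unfolding i_def i'_def using branching_variable_agree[OF qBC ne] by simp
        then have "ch' = ch" using rd(1,2)[OF i] by (simp add: ch_def ch'_def)
        moreover have "\<forall>p\<in>ch. set p \<subseteq> BC" using rd(4,5)[OF i] by (simp add: ch_def)
        moreover have "finite ch" by (simp add: ch_def)
        ultimately show ?thesis unfolding step step' using nint int ne empty le base inc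
          by (auto simp: similar_def)
      qed
    qed
  qed
qed

lemma similar_run: "similar (bc_run I R y t) (bc_run I R y' t)"
proof (induction t)
  case 0
  show ?case by (simp add: bc_run_def similar_def)
next
  case (Suc t)
  then show ?case using similar_step by (simp add: bc_run_def)
qed

lemma bc_tree_agree: "bc_tree I R y = bc_tree I R y'"
proof -
  have "valid_cut I y \<longleftrightarrow> valid_cut I y'"
    unfolding valid_cut_def cut_holds_def by (metis integral_point_cand[OF P] cut_le)
  moreover have "fst (bc_run I R y t) = fst (bc_run I R y' t)" for t
    using similar_run[of t] by (auto simp: similar_def split: prod.splits)
  ultimately show ?thesis by (simp add: bc_tree_def)
qed

end

section \<open>The hypersurfaces and their number\<close>


text \<open>
  For a vertex the quotient is its constant value over 1; for an edge the denominator is the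
  difference of the cut form at both ends.
\<close>

definition point_den :: "nat \<Rightarrow> vector \<times> vector \<Rightarrow> vector \<Rightarrow> real" where
  "point_den n k y = (if fst k = snd k then 1 else dot n y (snd k - fst k))"

definition point_num :: "nat \<Rightarrow> vector \<Rightarrow> vector \<times> vector \<Rightarrow> vector \<Rightarrow> real" where
  "point_num n c k y = (if fst k = snd k then dot n c (fst k)
     else dot n c (fst k) * dot n y (snd k - fst k) + dot n c (snd k - fst k) *
         (y n - dot n y (fst k)))"

lemma point_den_pos: "live n y k \<Longrightarrow> 0 < point_den n k y"
  by (cases k) (auto simp: live_def point_den_def dot_right split: if_splits)

lemma dot_cand_point:
  assumes "live n y k"
  shows "dot n c (cand_point n y k) = point_num n c k y / point_den n k y"
proof (cases "fst k = snd k")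
  case True
  then show ?thesis by (cases k) (simp add: cand_point_def point_num_def point_den_def)
next
  case False
  obtain u v where k: "k = (u, v)" by (cases k)
  define D where "D = dot n y (v - u)"
  have "D \<noteq> 0" using point_den_pos[OF assms] False by (simp add: k point_den_def D_def)
  have "dot n c (cand_point n y k) = dot n c u + ((y n - dot n y u) / D) * dot n c (v - u)"
    using False by (simp add: k cand_point_def D_def dot_add_right dot_scaleR_right del:
        scaleR_right_diff_distrib)
  also have "\<dots> = (dot n c u * D + dot n c (v - u) * (y n - dot n y u)) / D"
    using \<open>D \<noteq> 0\<close> by (simp add: add_divide_distrib mult.commute)
  also have "\<dots> = point_num n c k y / point_den n k y" using False
      by (simp add: k point_num_def point_den_def D_def)
  finally show ?thesis .
qed

lemma polyfun_point_den: "polyfun (n + 1) 1 (point_den n k)"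
proof (cases "fst k = snd k")
  case True
  show ?thesis unfolding point_den_def[abs_def] if_P[OF True] by (rule polyfun_const)
next
  case False
  show ?thesis unfolding point_den_def[abs_def] if_not_P[OF False] by (rule polyfun_dot) simp
qed

lemma polyfun_cut: "polyfun (n + 1) 1 (\<lambda>y. dot n y u - y n)"
  by (intro polyfun_diff polyfun_dot polyfun_var) auto

lemma polyfun_point_num: "polyfun (n + 1) 1 (point_num n c k)"
proof (cases "fst k = snd k")
  case True
  then show ?thesis unfolding point_num_def[abs_def] by (simp add: polyfun_const)
next
  case False
  have "polyfun (n + 1) 1 (\<lambda>y. y n - dot n y (fst k))"
    by (intro polyfun_diff polyfun_dot polyfun_var) auto
  then show ?thesis unfolding point_num_def[abs_def] using False
    by (simp only: if_False) (intro polyfun_add polyfun_scale polyfun_dot, auto)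
qed

definition surface :: "nat \<Rightarrow> (vector \<Rightarrow> real) \<Rightarrow> vector set" where
  "surface k f = {y \<in> rspace k. f y = 0}"

context
  fixes I :: ip
begin

abbreviation (input) "value_num k y \<equiv> point_num (nvars I) (objective I) k y"
abbreviation (input) "value_den k y \<equiv> point_den (nvars I) k y"

definition cut_poly :: "vector \<times> vector \<Rightarrow> vector \<Rightarrow> real" where
  "cut_poly k y = dot (nvars I) y (fst k) - y (nvars I)"

definition coordinate_poly :: "(vector \<times> vector) \<times> nat \<times> int \<Rightarrow> vector \<Rightarrow> real" where
  "coordinate_poly = (\<lambda>(k, i, l) y.
     point_num (nvars I) (\<lambda>j. if j = i then 1 else 0) k y - real_of_int l * value_den k y)"

definition value_poly :: "real \<Rightarrow> (vector \<times> vector) \<times> (vector \<times> vector) \<Rightarrow> vector \<Rightarrow> real" where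
  "value_poly e = (\<lambda>(a, b) y. value_num a y * value_den b y - value_num b y * value_den a y - e *
      (value_den a y * value_den b y))"

definition score_poly3 where
  "score_poly3 = (\<lambda>(z, a, b) y. (value_num z y * value_den a y - value_num a y * value_den z y) *
      (value_num z y * value_den b y - value_num b y * value_den z y)
     - eps * eps * (value_den z y * value_den z y * value_den a y * value_den b y))"

text \<open>
  With one factor of the second product replaced by the threshold, \<open>z * z\<close> does not cancel and the
  denominator of \<open>z\<close> enters squared; but there is one value less, so that the degree is again 5.
\<close>

definition score_poly4 where
  "score_poly4 = (\<lambda>(z, a, b, c) y.
     (value_num z y * value_den a y - value_num a y * value_den z y) *
         (value_num z y * value_den b y - value_num b y * value_den z y) * value_den c y
     - eps * ((value_num z y * value_den c y - value_num c y * value_den z y) * value_den z y *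
         value_den a y * value_den b y))"

text \<open>
  The numerator of \<open>(c + d - a - b) * z + a * b - c * d\<close>, which is what remains of \<open>(z - a) * (z -
  b) - (z - c) * (z - d)\<close> after \<open>z * z\<close> has cancelled.
\<close>

definition score_poly5 where
  "score_poly5 = (\<lambda>(z, a, b, c, d) y.
     ((value_num c y * value_den d y + value_num d y * value_den c y) * value_den a y * value_den b y
      - (value_num a y * value_den b y + value_num b y * value_den a y) * value_den c y *
          value_den d y) * value_num z y
     + (value_num a y * value_num b y * value_den c y * value_den d y
        - value_num c y * value_num d y * value_den a y * value_den b y) * value_den z y)"

text \<open>
  The case distinction keeps the count low for a single variable: there the families indexed by
  three or more candidates would exceed the bound.
\<close>

definition surfaces :: "vector set set" where
  "surfaces = (let n = nvars I; K = all_cands I in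
     (\<lambda>x. surface (n + 1) (cut_poly x)) ` K \<union>
     (\<lambda>x. surface (n + 1) (coordinate_poly x)) ` (K \<times> {..<n} \<times> {0..tau I}) \<union>
     (\<lambda>x. surface (n + 1) (value_poly 0 x)) ` (K \<times> K) \<union>
     (\<lambda>x. surface (n + 1) (value_poly eps x)) ` (K \<times> K) \<union>
     (if n < 2 then {} else
       (\<lambda>x. surface (n + 1) (score_poly3 x)) ` (K \<times> K \<times> K) \<union>
       (\<lambda>x. surface (n + 1) (score_poly4 x)) ` (K \<times> K \<times> K \<times> K) \<union>
       (\<lambda>x. surface (n + 1) (score_poly5 x)) ` (K \<times> K \<times> K \<times> K \<times> K)))"

lemma surfaces_memI:
  shows "k \<in> all_cands I \<Longrightarrow> surface (nvars I + 1) (cut_poly k) \<in> surfaces"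
    and "x \<in> all_cands I \<times> {..<nvars I} \<times> {0..tau I}
        \<Longrightarrow> surface (nvars I + 1) (coordinate_poly x) \<in> surfaces"
    and "x2 \<in> all_cands I \<times> all_cands I \<Longrightarrow> e = 0 \<or> e = eps \<Longrightarrow>
      surface (nvars I + 1) (value_poly e x2) \<in> surfaces"
    and "x3 \<in> all_cands I \<times> all_cands I \<times> all_cands I \<Longrightarrow> 2 \<le> nvars I \<Longrightarrow>
      surface (nvars I + 1) (score_poly3 x3) \<in> surfaces"
    and "x4 \<in> all_cands I \<times> all_cands I \<times> all_cands I \<times> all_cands I \<Longrightarrow> 2 \<le> nvars I \<Longrightarrow>
      surface (nvars I + 1) (score_poly4 x4) \<in> surfaces"
    and "x5 \<in> all_cands I \<times> all_cands I \<times> all_cands I \<times> all_cands I \<times> all_cands I \<Longrightarrow> 2 \<le> nvars I \<Longrightarrow>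
      surface (nvars I + 1) (score_poly5 x5) \<in> surfaces"
  unfolding surfaces_def Let_def not_less[symmetric] by (simp_all only: if_False) blast+

lemma polyfun_products:
  shows "polyfun k 1 f \<Longrightarrow> polyfun k 1 g \<Longrightarrow> polyfun k 2 (\<lambda>y. f y * g y)"
    and "polyfun k 2 f' \<Longrightarrow> polyfun k 1 g \<Longrightarrow> polyfun k 3 (\<lambda>y. f' y * g y)"
    and "polyfun k 3 f'' \<Longrightarrow> polyfun k 1 g \<Longrightarrow> polyfun k 4 (\<lambda>y. f'' y * g y)"
    and "polyfun k 4 f''' \<Longrightarrow> polyfun k 1 g \<Longrightarrow> polyfun k 5 (\<lambda>y. f''' y * g y)"
    and "polyfun k 2 f' \<Longrightarrow> polyfun k 2 g' \<Longrightarrow> polyfun k 4 (\<lambda>y. f' y * g' y)"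
  using polyfun_mult[of k 1 f 1 g] polyfun_mult[of k 2 f' 1 g] polyfun_mult[of k 3 f'' 1 g]
    polyfun_mult[of k 4 f''' 1 g] polyfun_mult[of k 2 f' 2 g'] by (simp_all del: One_nat_def)

lemma polyfun_cut_poly: "polyfun (nvars I + 1) 5 (cut_poly k)"
  unfolding cut_poly_def[abs_def] by (rule polyfun_weaken[OF polyfun_cut]) simp

lemma polyfun_coordinate_poly: "polyfun (nvars I + 1) 5 (coordinate_poly x)"
proof -
  obtain k i l where x: "x = (k, i, l)" by (cases x)
  show ?thesis unfolding coordinate_poly_def x prod.case
    by (rule polyfun_weaken[of _ 1]) (intro polyfun_diff polyfun_scale polyfun_point_num
        polyfun_point_den, simp)
qed

lemma polyfun_value_poly: "polyfun (nvars I + 1) 5 (value_poly e x)"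
proof -
  obtain a b where x: "x = (a, b)" by (cases x)
  show ?thesis unfolding value_poly_def x prod.case
    by (rule polyfun_weaken[of _ 2])
      (intro polyfun_diff polyfun_scale polyfun_products polyfun_point_num polyfun_point_den, simp)
qed

lemma polyfun_score_poly3: "polyfun (nvars I + 1) 5 (score_poly3 x)"
proof -
  obtain z a b where x: "x = (z, a, b)" by (cases x)
  show ?thesis unfolding score_poly3_def x prod.case
    by (rule polyfun_weaken[of _ 4])
      (intro polyfun_diff polyfun_scale polyfun_products(1,5) polyfun_point_num polyfun_point_den
        polyfun_products(3)[OF polyfun_products(2)], simp)
qed

lemma polyfun_score_poly4: "polyfun (nvars I + 1) 5 (score_poly4 x)"
proof -
  obtain z a b c where x: "x = (z, a, b, c)" by (cases x)
  show ?thesis unfolding score_poly4_def x prod.case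
    by (intro polyfun_diff polyfun_scale polyfun_products(4)[OF polyfun_products(5)]
        polyfun_products(4)[OF polyfun_products(3)[OF polyfun_products(2)]] polyfun_products(1)
            polyfun_point_num polyfun_point_den)
qed

lemma polyfun_score_poly5: "polyfun (nvars I + 1) 5 (score_poly5 x)"
proof -
  obtain z a b c d where x: "x = (z, a, b, c, d)" by (cases x)
  show ?thesis unfolding score_poly5_def x prod.case
    by (intro polyfun_diff polyfun_add polyfun_products(4) 
        polyfun_products(3)[OF polyfun_products(2)] polyfun_products(1) polyfun_point_num
            polyfun_point_den)
qed

lemma surfaces_polynomial: "S \<in> surfaces \<Longrightarrow> polynomial_hypersurface (nvars I + 1) 5 S"
proof -
  have s: "polynomial_hypersurface (nvars I + 1) 5 (surface (nvars I + 1) f)" if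
      "polyfun (nvars I + 1) 5 f" for f
    using polyfun_hypersurface[OF that] by (simp add: surface_def)
  note polys = polyfun_cut_poly polyfun_coordinate_poly polyfun_value_poly polyfun_score_poly3
    polyfun_score_poly4 polyfun_score_poly5
  assume "S \<in> surfaces"
  then show ?thesis unfolding surfaces_def Let_def
    by (elim UnE imageE; (split if_split_asm)?; (elim UnE imageE emptyE)?) (simp_all only: s polys)
qed

lemma sgn_divide_pos: "0 < b \<Longrightarrow> sgn (a / b) = sgn a" for a b :: real
  by (simp add: sgn_divide)

text \<open>
  Each sign condition concerns a quotient with positive denominator whose numerator defines one of
  the surfaces.
\<close>

lemma agree_on_component:
  assumes D: "D \<in> partition_components (nvars I + 1) surfaces" and y: "y \<in> D" "y' \<in> D"
  shows "agree I y y'"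
proof -
  let ?n = "nvars I" and ?K = "all_cands I"
  have const: "sgn (f y) = sgn (f y')" if "polyfun (?n + 1) 5 f" "surface (?n + 1) f \<in> surfaces" for f
    using sgn_constant_on_component[OF D that(1) _ y] that(2) by (simp add: surface_def)
  have cut: "sgn (dot ?n y u - y ?n) = sgn (dot ?n y' u - y' ?n)" if "(u, v) \<in> ?K" for u v
    using const[OF polyfun_cut_poly surfaces_memI(1)[OF that]] by (simp add: cut_poly_def)
  have live: "live ?n y' k" if "k \<in> ?K" "live ?n y k" for k
  proof -
    obtain u v where k: "k = (u, v)" by (cases k)
    have uv: "(u, v) \<in> ?K" "(v, u) \<in> ?K" using that(1) k all_cands_sym by auto
    show ?thesis using that(2) live_cong_sgn[OF cut[OF uv(1)] cut[OF uv(2)]] by (simp add: k)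
  qed
  have pos: "0 < value_den k y" "0 < value_den k y'" if "k \<in> ?K" "live ?n y k" for k
    using point_den_pos live that by blast+
  have cand_value: "cand_value I y k = value_num k y / value_den k y" "cand_value I y' k
      = value_num k y' / value_den k y'" if "k \<in> ?K" "live ?n y k" for k
    unfolding cand_value_def using dot_cand_point live that by blast+
  have coord: "sgn (cand_point ?n y k i - real_of_int l) = sgn (cand_point ?n y' k i - real_of_int l)"
    if k: "k \<in> ?K" "live ?n y k" and i: "i < ?n" "l \<in> {0..tau I}" for k i l
  proof -
    have e: "sgn (cand_point ?n w k i - real_of_int l) = sgn (coordinate_poly (k, i, l) w)" if w:
        "live ?n w k" for w
    proof -
      have "cand_point ?n w k i = point_num ?n (\<lambda>j. if j = i then 1 else 0) k w / point_den ?n k w"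
        using dot_cand_point[OF w, of "\<lambda>j. if j = i then 1 else 0"] dot_unit[OF i(1), of 1] by simp
      then have "cand_point ?n w k i - real_of_int l = coordinate_poly (k, i, l) w / point_den ?n k w"
        using point_den_pos[OF w] by (simp add: coordinate_poly_def field_simps)
      then show ?thesis using sgn_divide_pos[OF point_den_pos[OF w]] by simp
    qed
    have "surface (?n + 1) (coordinate_poly (k, i, l)) \<in> surfaces"
      using k i by (intro surfaces_memI) auto
    then show ?thesis using e[OF k(2)] e[OF live[OF k]] const[OF polyfun_coordinate_poly] by simp
  qed
  define K where "K = {k\<in>?K. live ?n y k}"
  have KW: "0 < value_den k w" "cand_value I w k = value_num k w / value_den k w" if "k \<in> K" "w
      = y \<or> w = y'" for k w
    using that(2) pos[of k] cand_value[of k] that(1) unfolding K_def by (elim disjE; simp)+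
  have transfer: "sgn (g y) = sgn (g y')"
    if f: "polyfun (?n + 1) 5 f" "surface (?n + 1) f \<in> surfaces"
      and g: "\<And>w. w = y \<or> w = y' \<Longrightarrow> g w = f w / h w \<and> 0 < h w" for f g h :: "vector \<Rightarrow> real"
    using g[of y] g[of y'] const[OF f] sgn_divide_pos by simp
  have v2: "sgn (cand_value I y a - cand_value I y b - e)
      = sgn (cand_value I y' a - cand_value I y' b - e)"
    if "a \<in> K" "b \<in> K" "e = 0 \<or> e = eps" for a b e
  proof (rule transfer[of "value_poly e (a, b)" "\<lambda>w. cand_value I w a - cand_value I w b - e"
      "\<lambda>w. value_den a w * value_den b w"])
    show "surface (?n + 1) (value_poly e (a, b)) \<in> surfaces"
      using that by (intro surfaces_memI) (auto simp: K_def)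
    show "cand_value I w a - cand_value I w b - e
        = value_poly e (a, b) w / (value_den a w * value_den b w) \<and> 0 < value_den a w * value_den b w"
      if w: "w = y \<or> w = y'" for w
      using KW(1)[OF \<open>a \<in> K\<close> w] KW(1)[OF \<open>b \<in> K\<close> w] 
      by (simp add: KW(2)[OF \<open>a \<in> K\<close> w] KW(2)[OF \<open>b \<in> K\<close> w]  value_poly_def field_simps)
  qed (rule polyfun_value_poly)
  have v3: "sgn ((cand_value I y z - cand_value I y a) * (cand_value I y z - cand_value I y b) -
      eps * eps) =
      sgn ((cand_value I y' z - cand_value I y' a) * (cand_value I y' z - cand_value I y' b) - eps
          * eps)"
    if "z \<in> K" "a \<in> K" "b \<in> K" "2 \<le> ?n" for z a b
  proof (rule transfer[of "score_poly3 (z, a, b)"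
        "\<lambda>w. (cand_value I w z - cand_value I w a) * (cand_value I w z - cand_value I w b) - eps *
            eps" "\<lambda>w. value_den z w * value_den z w * value_den a w * value_den b w"])
    show "surface (?n + 1) (score_poly3 (z, a, b)) \<in> surfaces"
      using that by (intro surfaces_memI) (auto simp: K_def)
    show "(cand_value I w z - cand_value I w a) * (cand_value I w z - cand_value I w b) - eps * eps =
        score_poly3 (z, a, b) w / (value_den z w * value_den z w * value_den a w * value_den b w)
            \<and> 0 < value_den z w * value_den z w * value_den a w * value_den b w"
      if w: "w = y \<or> w = y'" for w
      using KW(1)[OF \<open>z \<in> K\<close> w] KW(1)[OF \<open>a \<in> K\<close> w] KW(1)[OF \<open>b \<in> K\<close> w]
      by (simp add: KW(2)[OF \<open>z \<in> K\<close> w] KW(2)[OF \<open>a \<in> K\<close> w] KW(2)[OF \<open>b \<in> K\<close> w] score_poly3_def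
          field_simps)
  qed (rule polyfun_score_poly3)
  have v4: "sgn ((cand_value I y z - cand_value I y a) * (cand_value I y z - cand_value I y b) -
      (cand_value I y z - cand_value I y c) * eps) =
      sgn ((cand_value I y' z - cand_value I y' a) * (cand_value I y' z - cand_value I y' b) -
          (cand_value I y' z - cand_value I y' c) * eps)"
    if "z \<in> K" "a \<in> K" "b \<in> K" "c \<in> K" "2 \<le> ?n" for z a b c
  proof (rule transfer[of "score_poly4 (z, a, b, c)"
        "\<lambda>w. (cand_value I w z - cand_value I w a) * (cand_value I w z - cand_value I w b) -
            (cand_value I w z - cand_value I w c) * eps"
        "\<lambda>w. value_den z w * value_den z w * value_den a w * value_den b w * value_den c w"])
    show "surface (?n + 1) (score_poly4 (z, a, b, c)) \<in> surfaces"
      using that by (intro surfaces_memI) (auto simp: K_def)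
    show "(cand_value I w z - cand_value I w a) * (cand_value I w z - cand_value I w b) -
        (cand_value I w z - cand_value I w c) * eps =
        score_poly4 (z, a, b, c) w / (value_den z w * value_den z w * value_den a w * value_den b
            w * value_den c w) \<and>
        0 < value_den z w * value_den z w * value_den a w * value_den b w * value_den c w"
      if w: "w = y \<or> w = y'" for w
      using KW(1)[OF \<open>z \<in> K\<close> w] KW(1)[OF \<open>a \<in> K\<close> w] KW(1)[OF \<open>b \<in> K\<close> w] KW(1)[OF \<open>c \<in> K\<close> w]
      by (simp add: KW(2)[OF \<open>z \<in> K\<close> w] KW(2)[OF \<open>a \<in> K\<close> w] KW(2)[OF \<open>b \<in> K\<close> w]
          KW(2)[OF \<open>c \<in> K\<close> w] score_poly4_def field_simps)
  qed (rule polyfun_score_poly4)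
  have v5: "sgn ((cand_value I y z - cand_value I y a) * (cand_value I y z - cand_value I y b) -
      (cand_value I y z - cand_value I y c) * (cand_value I y z - cand_value I y d)) =
      sgn ((cand_value I y' z - cand_value I y' a) * (cand_value I y' z - cand_value I y' b) -
          (cand_value I y' z - cand_value I y' c) * (cand_value I y' z - cand_value I y' d))"
    if "z \<in> K" "a \<in> K" "b \<in> K" "c \<in> K" "d \<in> K" "2 \<le> ?n" for z a b c d
  proof (rule transfer[of "score_poly5 (z, a, b, c, d)"
        "\<lambda>w. (cand_value I w z - cand_value I w a) * (cand_value I w z - cand_value I w b) -
            (cand_value I w z - cand_value I w c) * (cand_value I w z - cand_value I w d)"
        "\<lambda>w. value_den z w * value_den a w * value_den b w * value_den c w * value_den d w"])
    show "surface (?n + 1) (score_poly5 (z, a, b, c, d)) \<in> surfaces"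
      using that by (intro surfaces_memI) (auto simp: K_def)
    show "(cand_value I w z - cand_value I w a) * (cand_value I w z - cand_value I w b) -
        (cand_value I w z - cand_value I w c) * (cand_value I w z - cand_value I w d) =
        score_poly5 (z, a, b, c, d) w / (value_den z w * value_den a w * value_den b w * value_den
            c w * value_den d w) \<and>
        0 < value_den z w * value_den a w * value_den b w * value_den c w * value_den d w"
      if w: "w = y \<or> w = y'" for w
      using KW(1)[OF \<open>z \<in> K\<close> w] KW(1)[OF \<open>a \<in> K\<close> w] KW(1)[OF \<open>b \<in> K\<close> w] KW(1)[OF \<open>c \<in> K\<close> w]
          KW(1)[OF \<open>d \<in> K\<close> w]
      by (simp add: KW(2)[OF \<open>z \<in> K\<close> w] KW(2)[OF \<open>a \<in> K\<close> w] KW(2)[OF \<open>b \<in> K\<close> w]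
          KW(2)[OF \<open>c \<in> K\<close> w] KW(2)[OF \<open>d \<in> K\<close> w] score_poly5_def field_simps)
  qed (rule polyfun_score_poly5)
  have v2': "sgn (cand_value I y a - cand_value I y b)
      = sgn (cand_value I y' a - cand_value I y' b)" if "a \<in> K" "b \<in> K" for a b
    using v2[OF that, of 0] by simp
  show ?thesis
    unfolding agree_def Let_def K_def[symmetric]
    by (intro conjI ballI impI allI; clarify?;
        (rule cut coord v2' v2[OF _ _ disjI2[OF refl]] v3 v4 v5; assumption))
qed

lemma card_surfaces:
  assumes P: "ip_polytope I"
  defines "c \<equiv> card (all_cands I)"
  shows "finite surfaces \<and> card surfaces \<le> c + c * (nvars I * (nat (tau I) + 1)) + 2 * c ^ 2 +
    (if nvars I < 2 then 0 else c ^ 3 + c ^ 4 + c ^ 5)"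
proof -
  let ?K = "all_cands I"
  have fin: "finite ?K" using finite_all_cands_and_card[OF P] by blast
  have im: "card (f ` A) \<le> b" if "finite A" "card A = b" for f :: "'z \<Rightarrow> vector set" and A b
    using card_image_le[OF that(1), of f] that(2) by simp
  have ct: "card {0..tau I} = nat (tau I) + 1" using tau_nonneg[OF P] by (simp add: nat_add_distrib)
  have "finite surfaces" using fin by (simp add: surfaces_def Let_def)
  moreover have "card surfaces \<le> c + c * (nvars I * (nat (tau I) + 1)) + c ^ 2 + c ^ 2 +
    (if nvars I < 2 then 0 else c ^ 3 + c ^ 4 + c ^ 5)"
    unfolding surfaces_def Let_def
  proof (intro order_trans[OF card_Un_le] add_mono im)
    show "card (if nvars I < 2 then {} else
       (\<lambda>x. surface (nvars I + 1) (score_poly3 x)) ` (?K \<times> ?K \<times> ?K) \<union>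
       (\<lambda>x. surface (nvars I + 1) (score_poly4 x)) ` (?K \<times> ?K \<times> ?K \<times> ?K) \<union>
       (\<lambda>x. surface (nvars I + 1) (score_poly5 x)) ` (?K \<times> ?K \<times> ?K \<times> ?K \<times> ?K))
      \<le> (if nvars I < 2 then 0 else c ^ 3 + c ^ 4 + c ^ 5)"
    proof (cases "nvars I < 2")
      case False
      then show ?thesis unfolding if_not_P[OF False]
        by (intro order_trans[OF card_Un_le] add_mono im)
          (simp_all add: fin card_cartesian_product c_def eval_nat_numeral)
    qed simp
  qed (simp_all only: fin finite_cartesian_product finite_lessThan finite_atLeastAtMost_int
      card_cartesian_product ct c_def card_lessThan power2_eq_square)
  ultimately show ?thesis by simp
qed

end

text \<open>
  The surplus factor \<open>N ^ (3 * n\<^sup>2 - 5 * n)\<close> is at least \<open>32768 ^ n = 8 ^ (5 * n)\<close> if \<open>n \<ge> 4\<close>,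
  because then \<open>N \<ge> 8\<close> and \<open>10 * n \<le> 3 * n\<^sup>2\<close>; the cases \<open>n = 2\<close> and \<open>n = 3\<close> are paid for by the
  constant.
\<close>

lemma count_bound:
  fixes t N :: real and n :: nat
  assumes t: "1 \<le> t" and N: "2 * real n \<le> N" and n: "2 \<le> n"
  shows "(2 * 8 ^ n * t ^ (2 * n) * N ^ n) ^ 5
      \<le> 32 * 32768 ^ 3 * 14 ^ n * N ^ (3 * n\<^sup>2) * t ^ (5 * n\<^sup>2)"
proof -
  have N1: "1 \<le> N" using N n by linarith
  have "(32768::real) ^ n * N ^ (5 * n) \<le> 32768 ^ 3 * N ^ (3 * n\<^sup>2)"
  proof (cases "n \<le> 3")
    case True
    have "5 * n \<le> 3 * n\<^sup>2" using n by (simp add: power2_eq_square)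
    then have "N ^ (5 * n) \<le> N ^ (3 * n\<^sup>2)" using N1 by (rule power_increasing)
    moreover have "(32768::real) ^ n \<le> 32768 ^ 3" using True by (rule power_increasing) simp
    ultimately show ?thesis using N1 by (intro mult_mono) auto
  next
    case False
    then have "8 \<le> N" using N by linarith
    have "(32768::real) ^ n = (8 ^ 5) ^ n" by simp
    also have "\<dots> = 8 ^ (5 * n)" by (simp only: power_mult)
    also have "\<dots> \<le> N ^ (5 * n)" using \<open>8 \<le> N\<close> by (intro power_mono) auto
    finally have "(32768::real) ^ n * N ^ (5 * n) \<le> N ^ (5 * n) * N ^ (5 * n)"
      using N1 by (intro mult_right_mono) auto
    also have "\<dots> = N ^ (10 * n)" by (simp add: power_add[symmetric])
    also have "\<dots> \<le> N ^ (3 * n\<^sup>2)"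
      using False N1 by (intro power_increasing) (auto simp: power2_eq_square)
    also have "\<dots> \<le> 32768 ^ 3 * N ^ (3 * n\<^sup>2)" using N1 by simp
    finally show ?thesis .
  qed
  moreover have "t ^ (10 * n) \<le> t ^ (5 * n\<^sup>2)"
    using t n by (intro power_increasing) (auto simp: power2_eq_square)
  ultimately have "((32768::real) ^ n * N ^ (5 * n)) * t ^ (10 * n)
      \<le> (32768 ^ 3 * N ^ (3 * n\<^sup>2)) * t ^ (5 * n\<^sup>2)"
    by (rule mult_mono) (use t N1 in auto)
  also have "\<dots> = 1 * ((32768 ^ 3 * N ^ (3 * n\<^sup>2)) * t ^ (5 * n\<^sup>2))" by simp
  also have "\<dots> \<le> 14 ^ n * ((32768 ^ 3 * N ^ (3 * n\<^sup>2)) * t ^ (5 * n\<^sup>2))"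
    by (rule mult_right_mono) (use t N1 in auto)
  finally have main: "((32768::real) ^ n * N ^ (5 * n)) * t ^ (10 * n) \<le>
    14 ^ n * ((32768 ^ 3 * N ^ (3 * n\<^sup>2)) * t ^ (5 * n\<^sup>2))" .
  have "(2 * 8 ^ n * t ^ (2 * n) * N ^ n) ^ 5 = 32 * ((8 ^ n) ^ 5 * (N ^ n) ^ 5 * (t ^ (2 * n)) ^ 5)"
    by (simp only: power_mult_distrib mult_ac) simp
  also have "((8::real) ^ n) ^ 5 = (8 ^ 5) ^ n" by (simp only: power_mult[symmetric] mult.commute)
  also have "(8::real) ^ 5 = 32768" by simp
  also have "(N ^ n) ^ 5 = N ^ (5 * n)" by (simp add: power_mult[symmetric] mult.commute)
  also have "(t ^ (2 * n)) ^ 5 = t ^ (10 * n)" by (simp add: power_mult[symmetric] mult_ac)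
  finally show ?thesis using main by (simp add: mult_ac)
qed

theorem theorem4p5:
  shows "\<exists>C::real. \<forall>(I::ip) (R::bc_rules) (n::nat) (m::nat).
    ip_polytope I \<and> admissible_rules I R \<and> n = nvars I \<and> m = nconstrs I \<longrightarrow>
    (\<exists>H. finite H \<and>
       real (card H) \<le> C * 14 ^ n * real (m + 2 * n) ^ (3 * n\<^sup>2) *
                        max 1 (real_of_int (tau I)) ^ (5 * n\<^sup>2) \<and>
       (\<forall>S\<in>H. polynomial_hypersurface (n + 1) 5 S) \<and>
       (\<forall>D\<in>partition_components (n + 1) H. \<forall>y\<in>D. \<forall>y'\<in>D.
          bc_tree I R y = bc_tree I R y'))"
proof (intro exI[of _ "7 * (32 * 32768 ^ 3)"] allI impI)
  fix I R n m
  assume A: "ip_polytope I \<and> admissible_rules I R \<and> n = nvars I \<and> m = nconstrs I"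
  then have P: "ip_polytope I" and R: "admissible_rules I R" and n: "n = nvars I" and m: "m
      = nconstrs I"
    by auto
  define t where "t = max 1 (real_of_int (tau I))"
  define N where "N = real (m + 2 * n)"
  define Y where "Y = 2 * 8 ^ n * t ^ (2 * n) * N ^ n"
  define c where "c = card (all_cands I)"
  let ?B = "7 * (32 * 32768 ^ 3) * 14 ^ n * N ^ (3 * n\<^sup>2) * t ^ (5 * n\<^sup>2)"
  have t1: "1 \<le> t" by (simp add: t_def)
  have tau: "real (nat (tau I)) + 1 \<le> 2 * t" using tau_nonneg[OF P] by (simp add: t_def)
  have N2: "2 * real n \<le> N" by (simp add: N_def)
  have NY: "real n * (real (nat (tau I)) + 1) \<le> Y \<and> 1 \<le> Y"
  proof (cases "n = 0")
    case False
    then have "1 \<le> N" using N2 by linarith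
    have "real n * (real (nat (tau I)) + 1) \<le> real n * (2 * t)" using tau by (intro mult_left_mono) auto
    also have "\<dots> = (2 * real n) * t" by simp
    also have "\<dots> \<le> N * t" using N2 t1 by (intro mult_right_mono) auto
    also have "\<dots> \<le> N ^ n * t ^ (2 * n)"
      using False \<open>1 \<le> N\<close> t1 by (intro mult_mono self_le_power) auto
    finally have 1: "real n * (real (nat (tau I)) + 1) \<le> N ^ n * t ^ (2 * n)" .
    have 2: "1 \<le> N ^ n * t ^ (2 * n)"
      using mult_mono[of 1 "N ^ n" 1 "t ^ (2 * n)"] \<open>1 \<le> N\<close> t1 by simp
    have "1 * (N ^ n * t ^ (2 * n)) \<le> (2 * 8 ^ n) * (N ^ n * t ^ (2 * n))"
      using 2 mult_mono[of 1 2 1 "8 ^ n :: real"] by (intro mult_right_mono) auto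
    also have "\<dots> = Y" by (simp add: Y_def)
    finally show ?thesis using 1 2 by simp
  qed (simp add: Y_def)
  have cY: "real c \<le> Y"
  proof -
    have "real c \<le> real ((nat (tau I) + 1) ^ (2 * n) * (2 * (m + 2 * n + 1) ^ n))"
      using finite_all_cands_and_card[OF P] unfolding c_def n m of_nat_le_iff by blast
    also have "\<dots> = (real (nat (tau I)) + 1) ^ (2 * n) * (2 * (N + 1) ^ n)" by (simp add: N_def add_ac)
    also have "\<dots> \<le> (2 * t) ^ (2 * n) * (2 * (2 * N) ^ n)"
    proof (intro mult_mono order_refl)
      show "(real (nat (tau I)) + 1) ^ (2 * n) \<le> (2 * t) ^ (2 * n)" using tau by (intro power_mono) auto
      show "(N + 1) ^ n \<le> (2 * N) ^ n"
      proof (cases "n = 0")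
        case False
        then have "1 \<le> real n" by simp
        then have "0 \<le> N + 1" "N + 1 \<le> 2 * N" using N2 by linarith+
        then show ?thesis by (intro power_mono)
      qed simp
    qed (use t1 in \<open>auto simp: N_def\<close>)
    also have "\<dots> = 2 * (2 ^ (2 * n) * 2 ^ n) * t ^ (2 * n) * N ^ n"
      by (simp only: power_mult_distrib mult_ac)
    also have "(2::real) ^ (2 * n) * 2 ^ n = 8 ^ n"
      by (simp add: power_mult power_mult_distrib[symmetric])
    also have "2 * 8 ^ n * t ^ (2 * n) * N ^ n = Y" by (simp add: Y_def)
    finally show ?thesis .
  qed
  have card: "real (card (surfaces I)) \<le> ?B"
  proof -
    have cpow: "real c ^ j \<le> Y ^ j" for j using cY by (intro power_mono) auto
    have "real (card (surfaces I)) \<le> real (c + c * (n * (nat (tau I) + 1)) + 2 * c ^ 2 +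
        (if n < 2 then 0 else c ^ 3 + c ^ 4 + c ^ 5))"
      using card_surfaces[OF P] unfolding c_def n of_nat_le_iff by blast
    also have "\<dots> = real c + real c * (real n * (real (nat (tau I)) + 1)) + 2 * real c ^ 2 +
        (if n < 2 then 0 else real c ^ 3 + real c ^ 4 + real c ^ 5)" by (simp add: distrib_left)
    also have "\<dots> \<le> Y ^ 2 + Y * Y + 2 * Y ^ 2 + (if n < 2 then 0 else Y ^ 5 + Y ^ 5 + Y ^ 5)"
    proof (intro add_mono mult_mono cY)
      have pw: "Y ^ i \<le> Y ^ j" if "i \<le> j" for i j using NY that by (simp add: power_increasing)
      show "real c \<le> Y ^ 2" using cY pw[of 1 2] by simp
      show "(if n < 2 then 0 else real c ^ 3 + real c ^ 4 + real c ^ 5) \<le>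
        (if n < 2 then 0 else Y ^ 5 + Y ^ 5 + Y ^ 5)"
        using cpow[of 3] cpow[of 4] cpow[of 5] pw[of 3 5] pw[of 4 5] by auto
    qed (use NY cpow in auto)
    also have "\<dots> = 4 * Y ^ 2 + (if n < 2 then 0 else 3 * Y ^ 5)" by (simp add: power2_eq_square)
    finally have total: "real (card (surfaces I)) \<le> 4 * Y ^ 2 + (if n < 2 then 0 else 3 * Y ^ 5)" .
    consider "n = 0" | "n = 1" | "2 \<le> n" by linarith
    then show ?thesis
    proof cases
      case 1
      then show ?thesis using total by (simp add: Y_def)
    next
      case 2
      then have "2 \<le> N" using N2 by simp
      have "4 * Y ^ 2 = 1024 * (N ^ 2 * t ^ 4)" using 2
          by (simp add: Y_def power_mult_distrib power_mult[symmetric])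
      also have "\<dots> \<le> 1024 * (N ^ 3 * t ^ 5)"
        using \<open>2 \<le> N\<close> t1 by (intro mult_left_mono mult_mono power_increasing) auto
      also have "\<dots> \<le> (7 * (32 * 32768 ^ 3) * 14) * (N ^ 3 * t ^ 5)"
        using \<open>2 \<le> N\<close> t1 by (intro mult_right_mono) auto
      also have "\<dots> = ?B" using 2 by simp
      finally show ?thesis using total 2 by simp
    next
      case 3
      have "Y ^ 2 \<le> Y ^ 5" using NY by (intro power_increasing) auto
      then have "real (card (surfaces I)) \<le> 7 * Y ^ 5" using total 3 by simp
      also have "\<dots> \<le> 7 * (32 * 32768 ^ 3 * 14 ^ n * N ^ (3 * n\<^sup>2) * t ^ (5 * n\<^sup>2))"
        unfolding Y_def using count_bound[OF t1 N2 3] by (intro mult_left_mono) auto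
      also have "\<dots> = ?B" by simp
      finally show ?thesis .
    qed
  qed
  show "\<exists>H. finite H \<and>
       real (card H) \<le> 7 * (32 * 32768 ^ 3) * 14 ^ n * real (m + 2 * n) ^ (3 * n\<^sup>2) *
                        max 1 (real_of_int (tau I)) ^ (5 * n\<^sup>2) \<and>
       (\<forall>S\<in>H. polynomial_hypersurface (n + 1) 5 S) \<and>
       (\<forall>D\<in>partition_components (n + 1) H. \<forall>y\<in>D. \<forall>y'\<in>D. bc_tree I R y = bc_tree I R y')"
  proof (intro exI[of _ "surfaces I"] conjI ballI)
    show "finite (surfaces I)" using card_surfaces[OF P] by blast
    show "real (card (surfaces I)) \<le> 7 * (32 * 32768 ^ 3) * 14 ^ n * real (m + 2 * n) ^ (3 * n\<^sup>2) *
                        max 1 (real_of_int (tau I)) ^ (5 * n\<^sup>2)"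
      using card by (simp only: N_def t_def)
    show "polynomial_hypersurface (n + 1) 5 S" if "S \<in> surfaces I" for S
      using surfaces_polynomial[OF that] n by simp
    show "bc_tree I R y = bc_tree I R y'"
      if "D \<in> partition_components (n + 1) (surfaces I)" "y \<in> D" "y' \<in> D" for D y y'
      using agreeing_cuts.bc_tree_agree[OF agreeing_cuts.intro[OF P R agree_on_component]] that n
          by blast
  qed
qed

end
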